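(* Let $F: x^3+y^3+z^3=0$ be the Fermat cubic and let $Q\neq Q'$ be two hyperosculating conics of $F$; let $\mathcal{EC}_2=F\cup Q\cup Q'$ (degree $7$). (a) $Q$ and $Q'$ belong to the same set $P_j$ if and only if $\mathcal{EC}_2$ is free with exponents $(3,3)$. (b) $Q$ and $Q'$ do not belong to the same set $P_j$ if and only if $\mathcal{EC}_2$ is nearly free with exponents $(3,4)$.
   Context: Let $\omega=e^{2\pi i/3}$ and the nine points $p_1=(1:1:0)$, $p_2=(1:\omega:0)$, $p_3=(1:\omega^2:0)$, $p_4=(0:1:1)$, $p_5=(0:1:\omega)$, $p_6=(0:1:\omega^2)$, $p_7=(1:0:1)$, $p_8=(\omega:0:1)$, $p_9=(\omega^2:0:1)$. For $j=1,\dots,9$, $P_j$ is the set of hyperosculating conics of $F$ passing through $p_j$ (these partition the $27$ hyperosculating conics into $9$ triples). For a smooth non-inflection point $p$ of a plane curve $C$ of degree $\ge3$, the osculating conic $Q_p$ is the unique conic with $(C,Q_p)_p\ge5$; $p$ is sextactic if $(C,Q_p)_p\ge6$, and then $Q_p$ is the hyperosculating conic at $p$. Let $S=\mathbb{C}[x,y,z]$; for a reduced curve $C:f=0$ of degree $d$, $AR(f)=\{(a,b,c)\in S^3: af_x+bf_y+cf_z=0\}$. $C$ is an $m$-syzygy curve if $AR(f)$ is minimally generated by $m$ homogeneous syzygies of degrees $d_1\le\dots\le d_m$. $C$ is free if it is a $2$-syzygy curve (then $d_1+d_2=d-1$), with exponents $(d_1,d_2)$; $C$ is nearly free if it is a $3$-syzygy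 curve with $d_3=d_2$ and $d_1+d_2=d$, with exponents listed as $(d_1,d_2)$. *)

theory Defs
  imports Complex_Main "HOL-Computational_Algebra.Polynomial" "HOL-Computational_Algebra.Formal_Power_Series"
begin

text \<open>The ring S = C[x,y,z] is represented as complex poly poly poly:
  innermost variable x, middle variable y, outermost variable z.\<close>

type_synonym S = "complex poly poly poly"

definition varX :: S where "varX = [:[:[:0, 1:]:]:]"
definition varY :: S where "varY = [:[:0, 1:]:]"
definition varZ :: S where "varZ = [:0, 1:]"
definition constS :: "complex \<Rightarrow> S" where "constS c = [:[:[:c:]:]:]"

definition mcoeff :: "S \<Rightarrow> nat \<Rightarrow> nat \<Rightarrow> nat \<Rightarrow> complex" where
  "mcoeff p i j k = coeff (coeff (coeff p k) j) i"

definition homog :: "nat \<Rightarrow> S \<Rightarrow> bool" where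
  "homog d p \<longleftrightarrow> (\<forall>i j k. mcoeff p i j k \<noteq> 0 \<longrightarrow> i + j + k = d)"

definition dX :: "S \<Rightarrow> S" where "dX p = map_poly (map_poly pderiv) p"
definition dY :: "S \<Rightarrow> S" where "dY p = map_poly pderiv p"
definition dZ :: "S \<Rightarrow> S" where "dZ p = pderiv p"

definition evalG :: "(complex \<Rightarrow> 'a::comm_ring_1) \<Rightarrow> S \<Rightarrow> 'a \<Rightarrow> 'a \<Rightarrow> 'a \<Rightarrow> 'a" where
  "evalG h p a b c = poly (map_poly (\<lambda>q. poly (map_poly (\<lambda>r. poly (map_poly h r) a) q) b) p) c"

definition evalS :: "S \<Rightarrow> complex \<times> complex \<times> complex \<Rightarrow> complex" where
  "evalS p v = evalG id p (fst v) (fst (snd v)) (snd (snd v))"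

definition evalF :: "S \<Rightarrow> complex fps \<Rightarrow> complex fps \<Rightarrow> complex fps \<Rightarrow> complex fps" where
  "evalF p a b c = evalG fps_const p a b c"

definition smooth_pt :: "S \<Rightarrow> complex \<times> complex \<times> complex \<Rightarrow> bool" where
  "smooth_pt f p \<longleftrightarrow> p \<noteq> (0,0,0) \<and> evalS f p = 0 \<and>
     (evalS (dX f) p, evalS (dY f) p, evalS (dZ f) p) \<noteq> (0,0,0)"

text \<open>Intersection multiplicity at a smooth point p of C: f=0 with the curve g=0 is at least k.
  It is computed along an immersive formal parametrization (g0,g1,g2) of the (unique) branch
  of C at p: the order in t of g(g0,g1,g2), infinite if this vanishes identically.\<close>
definition int_mult_ge :: "S \<Rightarrow> S \<Rightarrow> complex \<times> complex \<times> complex \<Rightarrow> nat \<Rightarrow> bool" where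
  "int_mult_ge f g p k \<longleftrightarrow>
     (\<exists>g0 g1 g2 :: complex fps.
        (fps_nth g0 0, fps_nth g1 0, fps_nth g2 0) = p \<and>
        evalF f g0 g1 g2 = 0 \<and>
        (fps_nth g0 0 * fps_nth g1 1 - fps_nth g1 0 * fps_nth g0 1,
         fps_nth g0 0 * fps_nth g2 1 - fps_nth g2 0 * fps_nth g0 1,
         fps_nth g1 0 * fps_nth g2 1 - fps_nth g2 0 * fps_nth g1 1) \<noteq> (0,0,0) \<and>
        (evalF g g0 g1 g2 = 0 \<or> subdegree (evalF g g0 g1 g2) \<ge> k))"

definition inflection_pt :: "S \<Rightarrow> complex \<times> complex \<times> complex \<Rightarrow> bool" where
  "inflection_pt f p \<longleftrightarrow> smooth_pt f p \<and>
     (\<exists>l. homog 1 l \<and> l \<noteq> 0 \<and> int_mult_ge f l p 3)"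

definition sextactic_pt :: "S \<Rightarrow> complex \<times> complex \<times> complex \<Rightarrow> bool" where
  "sextactic_pt f p \<longleftrightarrow> smooth_pt f p \<and> \<not> inflection_pt f p \<and>
     (\<exists>q. homog 2 q \<and> q \<noteq> 0 \<and> int_mult_ge f q p 6)"

text \<open>q defines a hyperosculating conic of f = 0: the osculating conic at a sextactic point p
  (any conic with multiplicity >= 6 >= 5 at p is the unique osculating conic Q_p).\<close>
definition hyperosc_conic :: "S \<Rightarrow> S \<Rightarrow> bool" where
  "hyperosc_conic f q \<longleftrightarrow> homog 2 q \<and> q \<noteq> 0 \<and>
     (\<exists>p. sextactic_pt f p \<and> int_mult_ge f q p 6)"

definition fermat :: S where "fermat = varX ^ 3 + varY ^ 3 + varZ ^ 3"

definition omega :: complex where "omega = exp (2 * pi * \<i> / 3)"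

definition ptj :: "nat \<Rightarrow> complex \<times> complex \<times> complex" where
  "ptj j = (if j = 1 then (1, 1, 0) else if j = 2 then (1, omega, 0) else
            if j = 3 then (1, omega^2, 0) else if j = 4 then (0, 1, 1) else
            if j = 5 then (0, 1, omega) else if j = 6 then (0, 1, omega^2) else
            if j = 7 then (1, 0, 1) else if j = 8 then (omega, 0, 1) else (omega^2, 0, 1))"

definition Pset :: "nat \<Rightarrow> S set" where
  "Pset j = {q. hyperosc_conic fermat q \<and> evalS q (ptj j) = 0}"

definition AR :: "S \<Rightarrow> (S \<times> S \<times> S) set" where
  "AR f = {(a, b, c). a * dX f + b * dY f + c * dZ f = 0}"

definition homog_triple :: "nat \<Rightarrow> S \<times> S \<times> S \<Rightarrow> bool" where
  "homog_triple d r \<longleftrightarrow> homog d (fst r) \<and> homog d (fst (snd r)) \<and> homog d (snd (snd r))"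

definition in_span :: "nat \<Rightarrow> (nat \<Rightarrow> S \<times> S \<times> S) \<Rightarrow> S \<times> S \<times> S \<Rightarrow> bool" where
  "in_span m g r \<longleftrightarrow> (\<exists>s :: nat \<Rightarrow> S.
     r = ((\<Sum>i<m. s i * fst (g i)), (\<Sum>i<m. s i * fst (snd (g i))), (\<Sum>i<m. s i * snd (snd (g i)))))"

definition homog_gens :: "S \<Rightarrow> nat \<Rightarrow> (nat \<Rightarrow> S \<times> S \<times> S) \<Rightarrow> bool" where
  "homog_gens f m g \<longleftrightarrow> (\<forall>i<m. g i \<in> AR f \<and> (\<exists>d. homog_triple d (g i))) \<and>
     (\<forall>r \<in> AR f. in_span m g r)"

definition m_syzygy :: "S \<Rightarrow> nat \<Rightarrow> nat list \<Rightarrow> bool" where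
  "m_syzygy f m ds \<longleftrightarrow> length ds = m \<and> sorted ds \<and>
     (\<exists>g. homog_gens f m g \<and> (\<forall>i<m. g i \<noteq> (0,0,0) \<and> homog_triple (ds ! i) (g i))) \<and>
     (\<forall>m' g'. homog_gens f m' g' \<longrightarrow> m \<le> m')"

definition free_exps :: "S \<Rightarrow> nat \<Rightarrow> nat \<Rightarrow> bool" where
  "free_exps f d1 d2 \<longleftrightarrow> m_syzygy f 2 [d1, d2]"

definition nearly_free_exps :: "S \<Rightarrow> nat \<Rightarrow> nat \<Rightarrow> bool" where
  "nearly_free_exps f d1 d2 \<longleftrightarrow>
     (\<exists>d. f \<noteq> 0 \<and> homog d f \<and> d1 + d2 = d) \<and> m_syzygy f 3 [d1, d2, d2]"

end

(*
  The field of vector fields tangent to the cubic F is generated, up to the Euler field, by the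
  products grad F x u. For each pair of hyperosculating conics Q, Q' explicit vectors u are given
  whose fields are also tangent to Q and Q'; correcting by a multiple of the Euler field turns them
  into syzygies of f = F Q Q'. Since the partial derivatives of f have no common factor, the cross
  product of two syzygies is a multiple g grad f, and g is read off from det(grad F, u, v). For two
  conics of the same triple g is a nonzero constant for two cubic syzygies, hence they form a basis.
  Otherwise there are syzygies r1, r2, r3 of degrees 3, 4, 4 with a relation h r1 + l r2 = l' r3, and
  the multipliers of r x r1, r x r2, r x r3 for a further syzygy r form a syzygy of the regular
  sequence h, l, l', which is a Koszul syzygy; this writes r as a combination of r1, r2, r3.

  A conic with contact of order 6 at a point is determined by applying the Hamiltonian derivation of
  the cubic repeatedly to its equation; the resulting linear system is singular only at the 27
  sextactic points. Cyclic permutations, cube roots of unity and exchanging the two conics reduce all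
  pairs to four cases.
*)

theory Submission
  imports Defs "HOL-Computational_Algebra.Polynomial_Factorial" "HOL-Computational_Algebra.Field_as_Ring"
begin

section \<open>Ring homomorphisms out of \<open>S\<close>\<close>

text \<open>Freeness and near freeness quantify over all homogeneous generating families, so degree
  counts do not settle them; syzygies have to be exhibited. Working with the vectors
  \<open>u\<close> keeps this small: tangency of \<open>grad F x u\<close> to a conic
  \<open>Q\<close> means that det(grad F, u, grad Q) is divisible by \<open>Q\<close>, a linear
  system for the coefficients of \<open>u\<close>. The obstacle is the cube root of -2 in the
  coordinates of each sextactic point. If the points of the triples of \<open>Q\<close> and
  \<open>Q'\<close> lie on the same coordinate line, one coordinate can be rescaled so that both
  conics have coefficients in Q(omega). On different lines the rescaling that helps one conic spoils
  the other, and two cube roots stay in the formulas; the identities hold modulo the two cubic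
  equations alone, so equal and different roots need no separate treatment. Coprimality of the
  partial derivatives needs no elimination: in \<open>8 F = l^3 + 6 t Q\<close> the form
  \<open>l\<close> is the tangent at the contact point and \<open>t\<close> a flex tangent, and a
  common factor of two components leads to linear forms.\<close>

definition unital_hom :: "('a::comm_ring_1 \<Rightarrow> 'b::comm_ring_1) \<Rightarrow> bool" where
  "unital_hom h \<longleftrightarrow> h 0 = 0 \<and> h 1 = 1 \<and> (\<forall>a b. h (a + b) = h a + h b) \<and> (\<forall>a b. h (a * b) = h a * h b)"

lemma unital_homD:
  assumes "unital_hom h"
  shows "h 0 = 0" "h 1 = 1" "h (a + b) = h a + h b" "h (a * b) = h a * h b"
    "h (- a) = - h a" "h (a - b) = h a - h b" "h (a ^ n) = h a ^ n" "h (numeral k) = numeral k"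
proof -
  show 0: "h 0 = 0" and 1: "h 1 = 1" and add: "\<And>a b. h (a + b) = h a + h b"
    and mult: "\<And>a b. h (a * b) = h a * h b"
    using assms unfolding unital_hom_def by auto
  have "h a + h (- a) = 0" for a
    using add[of a "- a"] 0 by simp
  then show minus: "h (- a) = - h a" for a
    by (metis add_eq_0_iff)
  show "h (a - b) = h a - h b"
    using add[of a "- b"] minus by simp
  show "h (a ^ n) = h a ^ n"
    by (induction n) (auto simp: 1 mult)
  have "h (of_nat n) = of_nat n" for n
    by (induction n) (auto simp: 0 1 add)
  from this[of "numeral k"] show "h (numeral k) = numeral k"
    by simp
qed

text \<open>Applied three times, once per nested variable, this makes \<open>evalG\<close> a
  homomorphism; the evaluations, substitutions and changes of coordinates below are
  instances.\<close>

lemma unital_hom_poly_map_poly: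
  assumes "unital_hom h"
  shows "unital_hom (\<lambda>p. poly (map_poly h p) a)"
proof -
  note h = unital_homD[OF assms]
  have pC: "poly (map_poly h (pCons c p)) a = h c + a * poly (map_poly h p) a" for c p
    by (simp add: map_poly_pCons h)
  have add: "poly (map_poly h (p + q)) a = poly (map_poly h p) a + poly (map_poly h q) a" for p q
    by (induction p q rule: poly_induct2) (simp_all add: pC h algebra_simps)
  have smult: "poly (map_poly h (smult c p)) a = h c * poly (map_poly h p) a" for c p
    by (induction p) (simp_all add: pC h algebra_simps)
  have mult: "poly (map_poly h (p * q)) a = poly (map_poly h p) a * poly (map_poly h q) a" for p q
    by (induction p) (simp_all add: pC h add smult algebra_simps)
  show ?thesis
    unfolding unital_hom_def using add mult by (simp add: h)
qed

lemma unital_hom_evalG: "unital_hom h \<Longrightarrow> unital_hom (\<lambda>p. evalG h p a b c)"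
  unfolding evalG_def by (intro unital_hom_poly_map_poly)

lemma evalG_gens:
  assumes "unital_hom h"
  shows "evalG h varX a b c = a" "evalG h varY a b c = b" "evalG h varZ a b c = c"
    "evalG h (constS k) a b c = h k"
  using unital_homD(1,2)[OF assms]
  by (auto simp: evalG_def varX_def varY_def varZ_def constS_def map_poly_pCons)

lemma unital_hom_constS: "unital_hom constS"
  unfolding unital_hom_def constS_def by (auto simp: one_pCons)

lemmas constS_hom = unital_homD[OF unital_hom_constS]

lemma constS_eq_iff [simp]: "constS a = constS b \<longleftrightarrow> a = b"
  by (simp add: constS_def)

lemma constS_eq_0_iff [simp]: "constS a = 0 \<longleftrightarrow> a = 0"
  by (simp add: constS_def)

text \<open>Horner's scheme in each nested variable: constants and the three variables generate
  \<open>S\<close> as a ring. Identities between homomorphisms or derivations need checking only on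
  these generators.\<close>

lemma S_induct [case_names const X Y Z add mult]:
  assumes const: "\<And>c. P (constS c)" and X: "P varX" and Y: "P varY" and Z: "P varZ"
    and add: "\<And>p q. P p \<Longrightarrow> P q \<Longrightarrow> P (p + q)" and mult: "\<And>p q. P p \<Longrightarrow> P q \<Longrightarrow> P (p * q)"
  shows "P p"
proof -
  have 0: "P 0" using const[of 0] by (simp add: constS_def)
  have x: "P [:[:a:]:]" for a
  proof (induction a)
    case 0
    show ?case using \<open>P 0\<close> by simp
  next
    case (pCons c a)
    have "[:[:pCons c a:]:] = constS c + varX * [:[:a:]:]"
      by (simp add: constS_def varX_def)
    with pCons show ?case by (metis add mult const X)
  qed
  have y: "P [:b:]" for b
  proof (induction b)
    case 0
    show ?case using \<open>P 0\<close> by simp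
  next
    case (pCons c b)
    have "[:pCons c b:] = [:[:c:]:] + varY * [:b:]"
      by (simp add: varY_def)
    with pCons show ?case by (metis add mult x Y)
  qed
  show ?thesis
  proof (induction p)
    case 0
    show ?case by (fact 0)
  next
    case (pCons c p)
    have "pCons c p = [:c:] + varZ * p"
      by (simp add: varZ_def)
    with pCons show ?case by (metis add mult y Z)
  qed
qed

section \<open>Derivations and homogeneity\<close>

text \<open>A derivation of the coefficients extends to polynomials by treating the new variable as
  a constant. One such step gives \<open>dY\<close>, two give \<open>dX\<close>.\<close>

lemma map_poly_derivation:
  fixes \<delta> :: "'a::comm_ring_1 \<Rightarrow> 'a"
  assumes add: "\<And>a b. \<delta> (a + b) = \<delta> a + \<delta> b" and mult: "\<And>a b. \<delta> (a * b) = a * \<delta> b + b * \<delta> a"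
  shows "map_poly \<delta> (p + q) = map_poly \<delta> p + map_poly \<delta> q"
    and "map_poly \<delta> (p * q) = p * map_poly \<delta> q + q * map_poly \<delta> p"
proof -
  have 0: "\<delta> 0 = 0" using add[of 0 0] by simp
  show *: "map_poly \<delta> (p + q) = map_poly \<delta> p + map_poly \<delta> q" for p q
    by (rule poly_eqI) (simp add: coeff_map_poly 0 add)
  have pC: "map_poly \<delta> (pCons c p) = pCons (\<delta> c) (map_poly \<delta> p)" for c p
    by (simp add: map_poly_pCons 0)
  have smult: "map_poly \<delta> (smult c p) = smult c (map_poly \<delta> p) + smult (\<delta> c) p" for c p
    by (rule poly_eqI) (simp add: coeff_map_poly 0 mult algebra_simps)
  show "map_poly \<delta> (p * q) = p * map_poly \<delta> q + q * map_poly \<delta> p"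
    by (induction p) (simp_all add: pC * smult 0 algebra_simps)
qed

lemma dZ_add: "dZ (p + q) = dZ p + dZ q" and dZ_mult: "dZ (p * q) = p * dZ q + q * dZ p"
  unfolding dZ_def by (simp_all add: pderiv_add pderiv_mult)

lemma dY_add: "dY (p + q) = dY p + dY q" and dY_mult: "dY (p * q) = p * dY q + q * dY p"
proof -
  note d = map_poly_derivation[of "pderiv :: complex poly poly \<Rightarrow> _", OF pderiv_add pderiv_mult]
  show "dY (p + q) = dY p + dY q" "dY (p * q) = p * dY q + q * dY p"
    unfolding dY_def by (fact d)+
qed

lemma dX_add: "dX (p + q) = dX p + dX q" and dX_mult: "dX (p * q) = p * dX q + q * dX p"
proof -
  note d = map_poly_derivation[of "pderiv :: complex poly \<Rightarrow> _", OF pderiv_add pderiv_mult]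
  note d' = map_poly_derivation[of "map_poly (pderiv :: complex poly \<Rightarrow> _)", OF d]
  show "dX (p + q) = dX p + dX q" "dX (p * q) = p * dX q + q * dX p"
    unfolding dX_def by (fact d')+
qed

text \<open>A triple is read as a vector field. Syzygies of \<open>f\<close> become the fields
  annihilating \<open>f\<close>, a description that does not refer to coordinates.\<close>

fun D :: "S \<times> S \<times> S \<Rightarrow> S \<Rightarrow> S" where
  "D (a, b, c) p = a * dX p + b * dY p + c * dZ p"

declare D.simps [simp del]

lemma D_var [simp]: "D (a, b, c) varX = a" "D (a, b, c) varY = b" "D (a, b, c) varZ = c"
  "D (a, b, c) (constS k) = 0"
  by (simp_all add: D.simps dX_def dY_def dZ_def varX_def varY_def varZ_def constS_def
      map_poly_pCons pderiv_pCons map_poly_1 flip: one_pCons)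


lemma D_constS [simp]: "D r (constS k) = 0"
  by (cases r) simp

lemma D_add: "D r (p + q) = D r p + D r q"
  by (cases r) (simp add: D.simps dX_add dY_add dZ_add algebra_simps)

lemma D_mult: "D r (p * q) = p * D r q + q * D r p"
  by (cases r) (simp add: D.simps dX_mult dY_mult dZ_mult algebra_simps)

lemma D_diff: "D r (p - q) = D r p - D r q"
  using D_add[of r "p - q" q] by (simp add: algebra_simps)

lemma D_one [simp]: "D r 1 = 0"
  using D_var(4)[of _ _ _ 1] by (cases r) (simp add: constS_hom)

lemma D_power: "D r (p ^ n) = of_nat n * p ^ (n - 1) * D r p"
proof (induction n)
  case (Suc n)
  then show ?case
    by (cases n) (simp_all add: D_mult algebra_simps)
qed simp

lemma AR_iff_D: "r \<in> AR f \<longleftrightarrow> D r f = 0"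
  by (cases r) (simp add: AR_def D.simps)

text \<open>The grading is recorded by \<open>x, y, z \<mapsto> tx, ty, tz\<close>: \<open>p\<close> is homogeneous of degree \<open>d\<close>
  iff its image is \<open>p t\<^sup>d\<close>.\<close>

definition graded :: "S \<Rightarrow> S poly" where
  "graded p = evalG (\<lambda>c. [:constS c:]) p [:0, varX:] [:0, varY:] [:0, varZ:]"

lemma unital_hom_constS_poly: "unital_hom (\<lambda>c. [:constS c:])"
  unfolding unital_hom_def by (auto simp: constS_hom one_pCons)

lemma unital_hom_graded: "unital_hom graded"
  unfolding graded_def[abs_def] by (intro unital_hom_evalG unital_hom_constS_poly)

lemmas graded_hom = unital_homD[OF unital_hom_graded]

lemma graded_gens [simp]:
  "graded varX = [:0, varX:]" "graded varY = [:0, varY:]" "graded varZ = [:0, varZ:]"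
  "graded (constS c) = [:constS c:]"
  unfolding graded_def by (simp_all add: evalG_gens[OF unital_hom_constS_poly])

lemma poly_graded_1: "poly (graded p) 1 = p"
  by (induction p rule: S_induct) (auto simp: graded_hom)

text \<open>The constant term, that is, reduction modulo the irrelevant ideal; the Nakayama argument
  compares generators through it.\<close>

definition eval0 :: "S \<Rightarrow> complex" where "eval0 p = evalG id p 0 0 0"

lemma unital_hom_eval0: "unital_hom eval0"
  unfolding eval0_def[abs_def] by (intro unital_hom_evalG) (simp add: unital_hom_def)

lemmas eval0_hom = unital_homD[OF unital_hom_eval0]

lemma eval0_gens [simp]: "eval0 varX = 0" "eval0 varY = 0" "eval0 varZ = 0" "eval0 (constS c) = c"
  by (simp_all add: eval0_def evalG_gens[of id] unital_hom_def)

lemma poly_graded_0: "poly (graded p) 0 = constS (eval0 p)"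
  by (induction p rule: S_induct) (auto simp: graded_hom eval0_hom constS_hom)

abbreviation mono3 :: "complex \<Rightarrow> nat \<Rightarrow> nat \<Rightarrow> nat \<Rightarrow> S" where
  "mono3 c i j k \<equiv> constS c * varX ^ i * varY ^ j * varZ ^ k"

lemma mono3_eq: "mono3 c i j k = monom (monom (monom c i) j) k"
proof -
  have "varX ^ i = monom (monom (monom 1 i) 0) 0"
    by (induction i) (simp_all add: varX_def monom_0 monom_Suc flip: one_pCons)
  moreover have "varY ^ j = monom (monom 1 j) 0"
    by (induction j) (simp_all add: varY_def monom_0 monom_Suc flip: one_pCons)
  moreover have "varZ ^ k = monom 1 k"
    by (induction k) (simp_all add: varZ_def monom_0 monom_Suc flip: one_pCons)
  ultimately show ?thesis
    by (simp add: constS_def monom_0 smult_monom)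
qed

lemma graded_mono3: "graded (mono3 c i j k) = monom (mono3 c i j k) (i + j + k)"
proof -
  have "[:0, a:] ^ n = monom (a ^ n) n" for a :: S and n
    by (induction n) (simp_all add: monom_0 monom_Suc one_pCons smult_monom)
  then show ?thesis
    by (simp add: graded_hom mult_monom smult_monom mult_ac add_ac)
qed

text \<open>Coefficients are additive but not multiplicative, so \<open>S_induct\<close> does not
  serve for \<open>mcoeff\<close>. Here monomials are added one at a time; the summand
  \<open>q\<close> in the auxiliary facts carries the part already treated.\<close>

lemma S_monom_induct [case_names zero add]:
  assumes "P 0" and add: "\<And>c i j k p. P p \<Longrightarrow> P (mono3 c i j k + p)"
  shows "P p"
proof -
  have x: "P ([:[:a:]:] * varX ^ i * varY ^ j * varZ ^ k + q)" if "P q" for a i j k q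
    using that
  proof (induction a arbitrary: i q)
    case (pCons c a)
    have "[:[:pCons c a:]:] = constS c + varX * [:[:a:]:]"
      by (simp add: constS_def varX_def)
    then have "[:[:pCons c a:]:] * varX ^ i * varY ^ j * varZ ^ k + q =
        mono3 c i j k + ([:[:a:]:] * varX ^ Suc i * varY ^ j * varZ ^ k + q)"
      by (simp add: algebra_simps)
    with add pCons show ?case by metis
  qed simp
  have y: "P ([:b:] * varY ^ j * varZ ^ k + q)" if "P q" for b j k q
    using that
  proof (induction b arbitrary: j q)
    case (pCons c b)
    have "[:pCons c b:] = [:[:c:]:] + varY * [:b:]"
      by (simp add: varY_def)
    then have "[:pCons c b:] * varY ^ j * varZ ^ k + q =
        [:[:c:]:] * varX ^ 0 * varY ^ j * varZ ^ k + ([:b:] * varY ^ Suc j * varZ ^ k + q)"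
      by (simp add: algebra_simps)
    with x pCons show ?case by metis
  qed simp
  have "P (p * varZ ^ k + q)" if "P q" for k q
    using that
  proof (induction p arbitrary: k q)
    case (pCons c p)
    have "pCons c p = [:c:] + varZ * p"
      by (simp add: varZ_def)
    then have "pCons c p * varZ ^ k + q = [:c:] * varY ^ 0 * varZ ^ k + (p * varZ ^ Suc k + q)"
      by (simp add: algebra_simps)
    with y pCons show ?case by metis
  qed simp
  from this[of 0 0] show ?thesis using \<open>P 0\<close> by simp
qed

lemma mcoeff_add [simp]: "mcoeff (p + q) i j k = mcoeff p i j k + mcoeff q i j k"
  and mcoeff_0 [simp]: "mcoeff 0 i j k = 0"
  by (simp_all add: mcoeff_def)

lemma S_eqI: "(\<And>i j k. mcoeff p i j k = mcoeff q i j k) \<Longrightarrow> p = q"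
  unfolding mcoeff_def by (metis poly_eqI)

lemma mcoeff_coeff_graded:
  "mcoeff (coeff (graded p) n) i j k = (if i + j + k = n then mcoeff p i j k else 0)"
proof (induction p rule: S_monom_induct)
  case zero
  then show ?case by (simp add: graded_hom)
next
  case (add c a b d p)
  have "mcoeff (coeff (graded (mono3 c a b d)) n) i j k = (if i + j + k = n then mcoeff (mono3 c a b d) i j k else 0)"
    unfolding graded_mono3 by (auto simp: mono3_eq mcoeff_def)
  with add show ?case
    unfolding graded_hom coeff_add mcoeff_add by simp
qed

lemma homog_iff_graded: "homog d p \<longleftrightarrow> graded p = monom p d"
proof
  assume "homog d p"
  then have "coeff (graded p) n = coeff (monom p d) n" for n
    by (intro S_eqI) (auto simp: mcoeff_coeff_graded homog_def)
  then show "graded p = monom p d" by (rule poly_eqI)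
next
  assume *: "graded p = monom p d"
  show "homog d p"
    unfolding homog_def
  proof (intro allI impI)
    fix i j k assume nz: "mcoeff p i j k \<noteq> 0"
    have "mcoeff (coeff (graded p) (i + j + k)) i j k = mcoeff p i j k"
      by (simp add: mcoeff_coeff_graded)
    with nz show "i + j + k = d"
      unfolding * by (auto split: if_splits)
  qed
qed

lemma homog_gens [simp]: "homog 1 varX" "homog 1 varY" "homog 1 varZ" "homog 0 (constS c)" "homog d 0"
  by (simp_all add: homog_iff_graded monom_altdef graded_hom)

lemma homog_add: "homog d p \<Longrightarrow> homog d q \<Longrightarrow> homog d (p + q)"
  by (simp add: homog_iff_graded graded_hom add_monom)

lemma homog_minus: "homog d p \<Longrightarrow> homog d (- p)"
  by (simp add: homog_iff_graded graded_hom minus_monom)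

lemma homog_diff: "homog d p \<Longrightarrow> homog d q \<Longrightarrow> homog d (p - q)"
  by (simp add: homog_iff_graded graded_hom diff_monom)

lemma homog_mult: "homog d p \<Longrightarrow> homog e q \<Longrightarrow> homog (d + e) (p * q)"
  by (simp add: homog_iff_graded graded_hom mult_monom)

lemma homog_constS_mult: "homog d p \<Longrightarrow> homog d (constS c * p)"
  using homog_mult[of 0 "constS c" d p] by simp

lemma homog_power: "homog d p \<Longrightarrow> homog (n * d) (p ^ n)"
  by (simp add: homog_iff_graded graded_hom monom_power mult.commute)

lemma eval0_homog: "homog d p \<Longrightarrow> d > 0 \<Longrightarrow> eval0 p = 0"
  using poly_graded_0[of p] by (simp add: homog_iff_graded poly_monom power_0_left)

section \<open>Minimal numbers of generators\<close>

text \<open>Gaussian elimination, by induction on the number of equations.\<close>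

lemma underdetermined_system:
  fixes M :: "'i \<Rightarrow> nat \<Rightarrow> complex"
  assumes "finite I" "n < card I"
  obtains x where "\<exists>i\<in>I. x i \<noteq> 0" "\<And>j. j < n \<Longrightarrow> (\<Sum>i\<in>I. x i * M i j) = 0"
proof -
  have "\<exists>x. (\<exists>i\<in>I. x i \<noteq> 0) \<and> (\<forall>j<n. (\<Sum>i\<in>I. x i * M i j) = 0)"
    using assms
  proof (induction n arbitrary: I M)
    case 0
    then obtain i where "i \<in> I" by fastforce
    then show ?case by (intro exI[of _ "\<lambda>_. 1"]) auto
  next
    case (Suc n)
    show ?case
    proof (cases "\<forall>i\<in>I. M i n = 0")
      case True
      from Suc.IH[of I M] Suc.prems obtain x
        where "\<exists>i\<in>I. x i \<noteq> 0" "\<forall>j<n. (\<Sum>i\<in>I. x i * M i j) = 0" by auto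
      with True show ?thesis by (intro exI[of _ x]) (auto simp: less_Suc_eq)
    next
      case False
      then obtain k where k: "k \<in> I" "M k n \<noteq> 0" by auto
      \<comment> \<open>Column \<open>n\<close> is cleared with the pivot \<open>M k n\<close>; the
        value of \<open>y\<close> at \<open>k\<close> is then forced by equation
        \<open>n\<close>.\<close>
      define M' where "M' i j = M i j - M i n / M k n * M k j" for i j
      have "n < card (I - {k})" using Suc.prems k by simp
      from Suc.IH[of "I - {k}" M'] this Suc.prems obtain x
        where x: "\<exists>i\<in>I - {k}. x i \<noteq> 0" "\<forall>j<n. (\<Sum>i\<in>I - {k}. x i * M' i j) = 0" by auto
      define y where "y = x(k := - (\<Sum>i\<in>I - {k}. x i * M i n) / M k n)"
      have sum_y: "(\<Sum>i\<in>I. y i * M i j) = (\<Sum>i\<in>I - {k}. x i * M' i j)" for j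
      proof -
        have "(\<Sum>i\<in>I. y i * M i j) = y k * M k j + (\<Sum>i\<in>I - {k}. x i * M i j)"
          using Suc.prems k by (subst sum.remove[of I k]) (auto simp: y_def intro!: sum.cong)
        also have "\<dots> = (\<Sum>i\<in>I - {k}. x i * M' i j)"
          by (simp add: y_def M'_def algebra_simps sum_subtractf sum_distrib_left sum_divide_distrib
              sum_distrib_right sum_negf)
        finally show ?thesis .
      qed
      have "M' i n = 0" for i using k by (simp add: M'_def)
      then have "\<forall>j<Suc n. (\<Sum>i\<in>I. y i * M i j) = 0"
        using x(2) unfolding sum_y by (auto simp: less_Suc_eq)
      moreover have "\<exists>i\<in>I. y i \<noteq> 0" using x(1) by (auto simp: y_def)
      ultimately show ?thesis by blast
    qed
  qed
  with that show thesis by blast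
qed

lemma eval0_sum: "eval0 (sum u A) = (\<Sum>i\<in>A. eval0 (u i))"
  by (induction A rule: infinite_finite_induct) (auto simp: eval0_hom)

text \<open>Graded Nakayama: generators all of whose relations vanish at the origin are minimal.\<close>

lemma m_syzygyI:
  assumes len: "length ds = m" and sorted: "sorted ds"
    and AR: "\<And>i. i < m \<Longrightarrow> g i \<in> AR f"
    and homog: "\<And>i. i < m \<Longrightarrow> homog_triple (ds ! i) (g i)"
    and span: "\<And>r. r \<in> AR f \<Longrightarrow> in_span m g r"
    and rel: "\<And>u i. \<lbrakk>(\<Sum>i<m. u i * fst (g i)) = 0; (\<Sum>i<m. u i * fst (snd (g i))) = 0;
      (\<Sum>i<m. u i * snd (snd (g i))) = 0; i < m\<rbrakk> \<Longrightarrow> eval0 (u i) = 0"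
  shows "m_syzygy f m ds"
proof -
  have nz: "g i \<noteq> (0, 0, 0)" if "i < m" for i
  proof
    assume z: "g i = (0, 0, 0)"
    \<comment> \<open>If \<open>g i\<close> were zero, the unit vector at \<open>i\<close> would be
      a relation with constant term 1.\<close>
    have "eval0 ((\<lambda>k. if k = i then 1 else 0) i) = 0"
      by (rule rel) (auto simp: if_distrib[of "\<lambda>x. x * _"] z that cong: if_cong)
    then show False by (simp add: eval0_hom)
  qed
  have "m \<le> m'" if g': "homog_gens f m' g'" for m' g'
  proof (rule ccontr)
    assume "\<not> m \<le> m'"
    then have lt: "m' < card {..<m}" by simp
    have "\<forall>i\<in>{..<m}. \<exists>s. g i = ((\<Sum>j<m'. s j * fst (g' j)),
        (\<Sum>j<m'. s j * fst (snd (g' j))), (\<Sum>j<m'. s j * snd (snd (g' j))))"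
      using g' AR unfolding homog_gens_def in_span_def by auto
    from bchoice[OF this] obtain s where s: "\<And>i. i < m \<Longrightarrow> g i = ((\<Sum>j<m'. s i j * fst (g' j)),
        (\<Sum>j<m'. s i j * fst (snd (g' j))), (\<Sum>j<m'. s i j * snd (snd (g' j))))"
      by auto
    have "\<forall>j\<in>{..<m'}. \<exists>t. g' j = ((\<Sum>k<m. t k * fst (g k)),
        (\<Sum>k<m. t k * fst (snd (g k))), (\<Sum>k<m. t k * snd (snd (g k))))"
      using g' span unfolding homog_gens_def in_span_def by auto
    from bchoice[OF this] obtain t where t: "\<And>j. j < m' \<Longrightarrow> g' j = ((\<Sum>k<m. t j k * fst (g k)),
        (\<Sum>k<m. t j k * fst (snd (g k))), (\<Sum>k<m. t j k * snd (snd (g k))))"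
      by auto
    \<comment> \<open>Passing from \<open>g\<close> to \<open>g'\<close> and back expresses each
      \<open>g i\<close> by the \<open>g k\<close>; subtracting the identity matrix gives relations
      among the \<open>g k\<close>. Hence the product of \<open>s\<close> and \<open>t\<close> is
      the identity modulo the irrelevant ideal.\<close>
    define u where "u i k = (\<Sum>j<m'. s i j * t j k) - (if k = i then 1 else 0)" for i k
    have comp: "(\<Sum>k<m. u i k * \<pi> (g k)) = 0"
      if "i < m" and s: "\<pi> (g i) = (\<Sum>j<m'. s i j * \<pi> (g' j))"
        and t: "\<And>j. j < m' \<Longrightarrow> \<pi> (g' j) = (\<Sum>k<m. t j k * \<pi> (g k))" for i and \<pi> :: "S \<times> S \<times> S \<Rightarrow> S"
    proof -
      have "\<pi> (g i) = (\<Sum>j<m'. \<Sum>k<m. s i j * t j k * \<pi> (g k))"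
        unfolding s by (intro sum.cong) (simp_all add: t sum_distrib_left mult.assoc)
      also have "\<dots> = (\<Sum>k<m. (\<Sum>j<m'. s i j * t j k) * \<pi> (g k))"
        by (subst sum.swap) (simp add: sum_distrib_right)
      finally show ?thesis
        using \<open>i < m\<close>
        by (simp add: u_def left_diff_distrib sum_subtractf if_distrib[of "\<lambda>x. x * _"] cong: if_cong)
    qed
    have u0: "eval0 (u i k) = 0" if "i < m" "k < m" for i k
    proof (rule rel[of "u i", OF _ _ _ that(2)])
      note si = s[unfolded lessThan_iff, OF that(1)] and tj = t[unfolded lessThan_iff]
      show "(\<Sum>k<m. u i k * fst (g k)) = 0"
        by (rule comp[OF that(1)]) (subst si tj, assumption?, simp only: fst_conv)+
      show "(\<Sum>k<m. u i k * fst (snd (g k))) = 0"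
        by (rule comp[OF that(1)]) (subst si tj, assumption?, simp only: fst_conv snd_conv)+
      show "(\<Sum>k<m. u i k * snd (snd (g k))) = 0"
        by (rule comp[OF that(1)]) (subst si tj, assumption?, simp only: snd_conv)+
    qed
    have st: "(\<Sum>j<m'. eval0 (s i j) * eval0 (t j k)) = (if k = i then 1 else 0)"
      if "i < m" "k < m" for i k
      using u0[OF that] by (auto simp: u_def eval0_hom eval0_sum split: if_splits)
    \<comment> \<open>With fewer than \<open>m\<close> columns the constant terms of
      \<open>s\<close> kill a nonzero row vector, which the identity matrix cannot do.\<close>
    obtain x where x: "\<exists>i\<in>{..<m}. x i \<noteq> 0"
      "\<And>j. j < m' \<Longrightarrow> (\<Sum>i\<in>{..<m}. x i * eval0 (s i j)) = 0"
      using underdetermined_system[OF _ lt, of "\<lambda>i j. eval0 (s i j)"] by blast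
    have "x k = 0" if "k < m" for k
    proof -
      have "x k = (\<Sum>i<m. x i * (\<Sum>j<m'. eval0 (s i j) * eval0 (t j k)))"
        using that by (simp add: st if_distrib[of "\<lambda>c. _ * c"] cong: if_cong)
      also have "\<dots> = (\<Sum>j<m'. (\<Sum>i<m. x i * eval0 (s i j)) * eval0 (t j k))"
        by (simp add: sum_distrib_left sum_distrib_right mult.assoc) (rule sum.swap)
      finally show ?thesis by (simp add: x(2))
    qed
    with x(1) show False by auto
  qed
  moreover have "homog_gens f m g"
    unfolding homog_gens_def using AR homog span by auto
  ultimately show ?thesis
    unfolding m_syzygy_def using len sorted homog nz by blast
qed

section \<open>Syzygies of a polynomial with coprime partial derivatives\<close>

text \<open>If \<open>p1\<close> is nonzero, it divides \<open>u1 * p1\<close>,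
  \<open>u1 * p2\<close> and \<open>u1 * p3\<close>, hence \<open>u1\<close> times the gcd of the
  three entries, which is a unit. The quotient is the factor; the other components follow by
  cancellation.\<close>

lemma parallel_imp_multiple:
  fixes p1 p2 p3 u1 u2 u3 :: S
  assumes nz: "(p1, p2, p3) \<noteq> (0, 0, 0)"
    and coprime: "\<And>g. \<lbrakk>prime_elem g; g dvd p1; g dvd p2; g dvd p3\<rbrakk> \<Longrightarrow> False"
    and par: "u1 * p2 = u2 * p1" "u1 * p3 = u3 * p1" "u2 * p3 = u3 * p2"
  obtains k where "u1 = k * p1" "u2 = k * p2" "u3 = k * p3"
proof -
  define g where "g = gcd p1 (gcd p2 p3)"
  have g: "g dvd p1" "g dvd p2" "g dvd p3"
    unfolding g_def by (meson gcd_dvd1 gcd_dvd2 dvd_trans)+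
  have "is_unit g"
  proof (rule ccontr)
    assume "\<not> is_unit g"
    moreover have "g \<noteq> 0" using nz g by auto
    ultimately obtain p where "p dvd g" "prime_elem p"
      by (meson prime_divisor_exists prime_imp_prime_elem)
    with coprime g show False by (meson dvd_trans)
  qed
  have dvd: "d dvd u" if "d dvd u * p1" "d dvd u * p2" "d dvd u * p3" for d u
  proof -
    have "d dvd gcd (u * p1) (gcd (u * p2) (u * p3))" using that by simp
    also have "gcd (u * p1) (gcd (u * p2) (u * p3)) = normalize (u * g)"
      unfolding g_def by (simp add: gcd_mult_left)
    finally show ?thesis using \<open>is_unit g\<close> by (simp add: dvd_mult_unit_iff)
  qed
  consider "p1 \<noteq> 0" | "p2 \<noteq> 0" | "p3 \<noteq> 0" using nz by auto
  then show thesis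
  proof cases
    case 1
    have "p1 dvd u1" by (rule dvd) (simp_all add: par)
    then obtain k where k: "u1 = k * p1" by (metis dvdE mult.commute)
    have "p1 * u2 = p1 * (k * p2)" "p1 * u3 = p1 * (k * p3)"
      using par k by algebra+
    then show thesis using k 1 that by (simp only: mult_cancel_left) auto
  next
    case 2
    have "p2 dvd u2" by (rule dvd) (simp_all add: par(3) flip: par(1))
    then obtain k where k: "u2 = k * p2" by (metis dvdE mult.commute)
    have "p2 * u1 = p2 * (k * p1)" "p2 * u3 = p2 * (k * p3)"
      using par k by algebra+
    then show thesis using k 2 that by (simp only: mult_cancel_left) auto
  next
    case 3
    have "p3 dvd u3" by (rule dvd) (simp_all flip: par(2,3))
    then obtain k where k: "u3 = k * p3" by (metis dvdE mult.commute)
    have "p3 * u1 = p3 * (k * p1)" "p3 * u2 = p3 * (k * p2)"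
      using par k by algebra+
    then show thesis using k 3 that by (simp only: mult_cancel_left) auto
  qed
qed

text \<open>Two vectors orthogonal to \<open>p\<close> have a cross product parallel to
  \<open>p\<close>; coprimality of the entries makes the ratio a polynomial.\<close>

lemma cross_syzygies:
  fixes p1 p2 p3 a1 a2 a3 b1 b2 b3 :: S
  assumes "(p1, p2, p3) \<noteq> (0, 0, 0)"
    and "\<And>g. \<lbrakk>prime_elem g; g dvd p1; g dvd p2; g dvd p3\<rbrakk> \<Longrightarrow> False"
    and a: "a1 * p1 + a2 * p2 + a3 * p3 = 0" and b: "b1 * p1 + b2 * p2 + b3 * p3 = 0"
  obtains k where "a2 * b3 - a3 * b2 = k * p1" "a3 * b1 - a1 * b3 = k * p2" "a1 * b2 - a2 * b1 = k * p3"
proof (rule parallel_imp_multiple[OF assms(1,2),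
      where ?u1.0 = "a2 * b3 - a3 * b2" and ?u2.0 = "a3 * b1 - a1 * b3" and ?u3.0 = "a1 * b2 - a2 * b1"])
  show "(a2 * b3 - a3 * b2) * p2 = (a3 * b1 - a1 * b3) * p1" using a b by algebra
  show "(a2 * b3 - a3 * b2) * p3 = (a1 * b2 - a2 * b1) * p1" using a b by algebra
  show "(a3 * b1 - a1 * b3) * p3 = (a1 * b2 - a2 * b1) * p2" using a b by algebra
qed (use that in auto)

text \<open>Cramer's rule in the plane orthogonal to \<open>p\<close>: three vectors there are
  dependent, with their pairwise cross products, measured in multiples of \<open>p\<close>, as
  coefficients.\<close>

lemma plane_relation:
  fixes p1 p2 p3 :: "'a::idom"
  assumes nz: "(p1, p2, p3) \<noteq> (0, 0, 0)"
    and s: "s1 * p1 + s2 * p2 + s3 * p3 = 0"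
    and ab: "a2 * b3 - a3 * b2 = \<alpha> * p1" "a3 * b1 - a1 * b3 = \<alpha> * p2" "a1 * b2 - a2 * b1 = \<alpha> * p3"
    and bs: "b2 * s3 - b3 * s2 = \<beta> * p1" "b3 * s1 - b1 * s3 = \<beta> * p2" "b1 * s2 - b2 * s1 = \<beta> * p3"
    and sa: "s2 * a3 - s3 * a2 = \<gamma> * p1" "s3 * a1 - s1 * a3 = \<gamma> * p2" "s1 * a2 - s2 * a1 = \<gamma> * p3"
  shows "\<alpha> * s1 + \<beta> * a1 + \<gamma> * b1 = 0" "\<alpha> * s2 + \<beta> * a2 + \<gamma> * b2 = 0" "\<alpha> * s3 + \<beta> * a3 + \<gamma> * b3 = 0"
proof -
  have "p1 * (\<alpha> * s1 + \<beta> * a1 + \<gamma> * b1) = 0" "p2 * (\<alpha> * s1 + \<beta> * a1 + \<gamma> * b1) = 0" "p3 * (\<alpha> * s1 + \<beta> * a1 + \<gamma> * b1) = 0"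
    using s ab bs sa by algebra+
  then show "\<alpha> * s1 + \<beta> * a1 + \<gamma> * b1 = 0" using nz by auto
  have "p1 * (\<alpha> * s2 + \<beta> * a2 + \<gamma> * b2) = 0" "p2 * (\<alpha> * s2 + \<beta> * a2 + \<gamma> * b2) = 0" "p3 * (\<alpha> * s2 + \<beta> * a2 + \<gamma> * b2) = 0"
    using s ab bs sa by algebra+
  then show "\<alpha> * s2 + \<beta> * a2 + \<gamma> * b2 = 0" using nz by auto
  have "p1 * (\<alpha> * s3 + \<beta> * a3 + \<gamma> * b3) = 0" "p2 * (\<alpha> * s3 + \<beta> * a3 + \<gamma> * b3) = 0" "p3 * (\<alpha> * s3 + \<beta> * a3 + \<gamma> * b3) = 0"
    using s ab bs sa by algebra+
  then show "\<alpha> * s3 + \<beta> * a3 + \<gamma> * b3 = 0" using nz by auto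
qed

fun vdet :: "S \<times> S \<times> S \<Rightarrow> S \<times> S \<times> S \<Rightarrow> S \<times> S \<times> S \<Rightarrow> S" where
  "vdet (a1, a2, a3) (b1, b2, b3) (c1, c2, c3) =
    a1 * (b2 * c3 - b3 * c2) + a2 * (b3 * c1 - b1 * c3) + a3 * (b1 * c2 - b2 * c1)"

text \<open>Quantifying over all fields instead of the three partial derivatives makes the notion
  independent of coordinates, so it can be tested with fields adapted to a given curve.\<close>

definition coprime_gradient :: "S \<Rightarrow> bool" where
  "coprime_gradient f \<longleftrightarrow> (\<forall>g. prime_elem g \<longrightarrow> \<not> (\<forall>r. g dvd D r f))"

abbreviation euler_field :: "S \<times> S \<times> S" where
  "euler_field \<equiv> (varX, varY, varZ)"

lemma coprime_gradientD:
  assumes "coprime_gradient f" "prime_elem g" "g dvd dX f" "g dvd dY f" "g dvd dZ f"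
  shows False
proof -
  have "g dvd D r f" for r
    using assms(3-5) by (cases r) (simp add: D.simps)
  with assms(1,2) show False unfolding coprime_gradient_def by blast
qed

text \<open>Contracting the cross product \<open>k grad f\<close> with the Euler field gives
  \<open>k d f\<close>, so the multiplier \<open>k\<close> is visible in a determinant.\<close>

lemma AR_cross:
  assumes cop: "coprime_gradient f" and f: "f \<noteq> 0" and euler: "D euler_field f = constS d * f" and d: "d \<noteq> 0"
    and r: "(a1, a2, a3) \<in> AR f" and s: "(b1, b2, b3) \<in> AR f"
  obtains k where "a2 * b3 - a3 * b2 = k * dX f" "a3 * b1 - a1 * b3 = k * dY f"
    "a1 * b2 - a2 * b1 = k * dZ f"
    "vdet euler_field (a1, a2, a3) (b1, b2, b3) = k * constS d * f"
proof -
  have nz: "(dX f, dY f, dZ f) \<noteq> (0, 0, 0)"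
    using f euler d by (auto simp: D.simps)
  have r': "a1 * dX f + a2 * dY f + a3 * dZ f = 0" and s': "b1 * dX f + b2 * dY f + b3 * dZ f = 0"
    using r s by (simp_all add: AR_def)
  obtain k where
    k: "a2 * b3 - a3 * b2 = k * dX f" "a3 * b1 - a1 * b3 = k * dY f" "a1 * b2 - a2 * b1 = k * dZ f"
    by (rule cross_syzygies[OF nz _ r' s']) (use coprime_gradientD[OF cop] in blast)+
  have "vdet euler_field (a1, a2, a3) (b1, b2, b3) = k * D euler_field f"
    by (simp add: k D.simps algebra_simps)
  also have "\<dots> = k * constS d * f"
    by (simp add: euler mult.assoc)
  finally show thesis by (rule that[OF k])
qed

text \<open>Saito's criterion. The determinant makes the multiplier of the two generators a nonzero
  constant, so the planar relation between them and a third syzygy can be solved for the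
  latter.\<close>

lemma free_criterion:
  assumes cop: "coprime_gradient f" and f: "f \<noteq> 0" and euler: "D euler_field f = constS d * f" and d: "d \<noteq> 0"
    and a: "(a1, a2, a3) \<in> AR f" and b: "(b1, b2, b3) \<in> AR f"
    and homog: "homog_triple d1 (a1, a2, a3)" "homog_triple d2 (b1, b2, b3)" "d1 \<le> d2"
    and det: "vdet euler_field (a1, a2, a3) (b1, b2, b3) = constS k * f" and k: "k \<noteq> 0"
  shows "m_syzygy f 2 [d1, d2]"
proof -
  have nz: "(dX f, dY f, dZ f) \<noteq> (0, 0, 0)"
    using f euler d by (auto simp: D.simps)
  note cross = AR_cross[OF cop f euler d]
  obtain g where g: "a2 * b3 - a3 * b2 = g * dX f" "a3 * b1 - a1 * b3 = g * dY f"
    "a1 * b2 - a2 * b1 = g * dZ f" "constS k * f = g * constS d * f"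
    using cross[OF a b] unfolding det by blast
  have "constS k = constS (k / d) * constS d"
    using d by (simp flip: constS_hom)
  with g(4) f d have g_eq: "g = constS (k / d)"
    by simp
  define \<kappa> where "\<kappa> = d / k"
  have \<kappa>: "constS \<kappa> * g = 1"
    using d k by (simp add: g_eq \<kappa>_def flip: constS_hom)
  define gens where "gens i = (if i = 0 then (a1, a2, a3) else (b1, b2, b3))" for i :: nat
  show ?thesis
  proof (rule m_syzygyI[of _ _ gens])
    fix r assume "r \<in> AR f"
    then obtain s1 s2 s3 where r: "r = (s1, s2, s3)" and s: "(s1, s2, s3) \<in> AR f"
      by (cases r) auto
    from cross[OF b s] obtain \<beta> where \<beta>: "b2 * s3 - b3 * s2 = \<beta> * dX f"
      "b3 * s1 - b1 * s3 = \<beta> * dY f" "b1 * s2 - b2 * s1 = \<beta> * dZ f" by blast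
    from cross[OF s a] obtain \<gamma> where \<gamma>: "s2 * a3 - s3 * a2 = \<gamma> * dX f"
      "s3 * a1 - s1 * a3 = \<gamma> * dY f" "s1 * a2 - s2 * a1 = \<gamma> * dZ f" by blast
    have "g * s1 + \<beta> * a1 + \<gamma> * b1 = 0" "g * s2 + \<beta> * a2 + \<gamma> * b2 = 0" "g * s3 + \<beta> * a3 + \<gamma> * b3 = 0"
      by (rule plane_relation[OF nz _ g(1-3) \<beta> \<gamma>]; use s in \<open>simp add: AR_def\<close>)+
    then have "s1 = - constS \<kappa> * \<beta> * a1 - constS \<kappa> * \<gamma> * b1"
      "s2 = - constS \<kappa> * \<beta> * a2 - constS \<kappa> * \<gamma> * b2" "s3 = - constS \<kappa> * \<beta> * a3 - constS \<kappa> * \<gamma> * b3"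
      using \<kappa> by algebra+
    then show "in_span 2 gens r"
      unfolding in_span_def r
      by (intro exI[of _ "\<lambda>i. if i = 0 then - constS \<kappa> * \<beta> else - constS \<kappa> * \<gamma>"])
        (simp add: gens_def numeral_2_eq_2)
  next
    fix u :: "nat \<Rightarrow> S" and i :: nat
    assume "(\<Sum>i<2. u i * fst (gens i)) = 0" "(\<Sum>i<2. u i * fst (snd (gens i))) = 0"
      "(\<Sum>i<2. u i * snd (snd (gens i))) = 0" and i: "i < 2"
    then have u: "u 0 * a1 + u 1 * b1 = 0" "u 0 * a2 + u 1 * b2 = 0" "u 0 * a3 + u 1 * b3 = 0"
      by (simp_all add: gens_def numeral_2_eq_2)
    have "u 0 * g * dX f = 0" "u 0 * g * dY f = 0" "u 0 * g * dZ f = 0"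
      "u 1 * g * dX f = 0" "u 1 * g * dY f = 0" "u 1 * g * dZ f = 0"
      using u g by algebra+
    then have "u 0 = 0" "u 1 = 0" using nz \<kappa> by auto
    then show "eval0 (u i) = 0" using i by (auto simp: less_2_cases_iff eval0_hom)
  qed (use a b homog in \<open>auto simp: gens_def less_2_cases_iff nth_Cons'\<close>)
qed

text \<open>One determinant suffices: \<open>rel\<close> turns the multiplier
  \<open>\<kappa> * l'\<close> of the first two generators into \<open>\<kappa> * l\<close> and
  \<open>- \<kappa> * h\<close> for the other pairs. As \<open>h\<close>, \<open>l\<close>,
  \<open>l'\<close> lack constant terms, \<open>rel\<close> does not allow a generator to be
  dropped.\<close>

lemma nearly_free_criterion:
  assumes cop: "coprime_gradient f" and f: "f \<noteq> 0" and euler: "D euler_field f = constS d * f" and d: "d \<noteq> 0"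
    and a: "(a1, a2, a3) \<in> AR f" and b: "(b1, b2, b3) \<in> AR f" and c: "(c1, c2, c3) \<in> AR f"
    and homog: "homog_triple d1 (a1, a2, a3)" "homog_triple d2 (b1, b2, b3)" "homog_triple d2 (c1, c2, c3)" "d1 \<le> d2"
    and det: "vdet euler_field (a1, a2, a3) (b1, b2, b3) = constS k * l' * f" and k: "k \<noteq> 0"
    and rel: "h * a1 + l * b1 - l' * c1 = 0" "h * a2 + l * b2 - l' * c2 = 0" "h * a3 + l * b3 - l' * c3 = 0"
    and l': "l' \<noteq> 0"
    and regular: "\<And>s t. l * s = l' * t \<Longrightarrow> l' dvd s"
    and regular': "\<And>s t w. h * s = l * t + l' * w \<Longrightarrow> \<exists>t w. s = l * t + l' * w"
    and eval0: "eval0 l = 0" "eval0 l' = 0" "eval0 h = 0"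
  shows "m_syzygy f 3 [d1, d2, d2]"
proof -
  have nz: "(dX f, dY f, dZ f) \<noteq> (0, 0, 0)"
    using f euler d by (auto simp: D.simps)
  note cross = AR_cross[OF cop f euler d]
  define \<kappa> where "\<kappa> = constS (k / d)"
  have \<kappa>: "constS k = \<kappa> * constS d" "constS (d / k) * \<kappa> = 1" "constS d \<noteq> 0" "\<kappa> \<noteq> 0"
    using d k by (simp_all add: \<kappa>_def flip: constS_hom)
  obtain g where g: "a2 * b3 - a3 * b2 = g * dX f" "a3 * b1 - a1 * b3 = g * dY f"
    "a1 * b2 - a2 * b1 = g * dZ f" "constS k * l' * f = g * constS d * f"
    using cross[OF a b] unfolding det by blast
  have g_eq: "g = \<kappa> * l'"
    using g(4) f \<kappa> by simp
  obtain g' where g': "a2 * c3 - a3 * c2 = g' * dX f" "a3 * c1 - a1 * c3 = g' * dY f"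
    "a1 * c2 - a2 * c1 = g' * dZ f" using cross[OF a c] by blast
  have "(l' * g') * dX f = (l * g) * dX f" "(l' * g') * dY f = (l * g) * dY f" "(l' * g') * dZ f = (l * g) * dZ f"
    using g(1-3) g' rel by algebra+
  then have "l' * g' = l * g" using nz by auto
  with l' have g'_eq: "g' = \<kappa> * l" by (simp add: g_eq mult_ac)
  obtain g'' where g'': "b2 * c3 - b3 * c2 = g'' * dX f" "b3 * c1 - b1 * c3 = g'' * dY f"
    "b1 * c2 - b2 * c1 = g'' * dZ f" using cross[OF b c] by blast
  have "(l' * g'' + h * g) * dX f = 0" "(l' * g'' + h * g) * dY f = 0" "(l' * g'' + h * g) * dZ f = 0"
    using g(1-3) g'' rel by algebra+
  then have "l' * g'' + h * g = 0" using nz by auto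
  then have "l' * g'' = l' * (- \<kappa> * h)" unfolding g_eq by algebra
  with l' have g''_eq: "g'' = - \<kappa> * h" by (simp only: mult_cancel_left) auto
  define gens where "gens i = (if i = 0 then (a1, a2, a3) else if i = 1 then (b1, b2, b3) else (c1, c2, c3))"
    for i :: nat
  have less3: "i < 3 \<longleftrightarrow> i = 0 \<or> i = 1 \<or> i = 2" for i :: nat by auto
  show ?thesis
  proof (rule m_syzygyI[of _ _ gens])
    fix r assume "r \<in> AR f"
    then obtain s1 s2 s3 where r: "r = (s1, s2, s3)" and s: "(s1, s2, s3) \<in> AR f"
      by (cases r) auto
    from cross[OF s a] obtain m1 where m1: "s2 * a3 - s3 * a2 = m1 * dX f"
      "s3 * a1 - s1 * a3 = m1 * dY f" "s1 * a2 - s2 * a1 = m1 * dZ f" by blast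
    from cross[OF b s] obtain m2 where m2: "b2 * s3 - b3 * s2 = m2 * dX f"
      "b3 * s1 - b1 * s3 = m2 * dY f" "b1 * s2 - b2 * s1 = m2 * dZ f" by blast
    from cross[OF s c] obtain m3 where m3: "s2 * c3 - s3 * c2 = m3 * dX f"
      "s3 * c1 - s1 * c3 = m3 * dY f" "s1 * c2 - s2 * c1 = m3 * dZ f" by blast
    have "(h * m1 - l * m2 - l' * m3) * dX f = 0" "(h * m1 - l * m2 - l' * m3) * dY f = 0"
      "(h * m1 - l * m2 - l' * m3) * dZ f = 0"
      using m1 m2 m3 rel by algebra+
    then have "h * m1 - l * m2 - l' * m3 = 0" using nz by auto
    then have m: "h * m1 = l * m2 + l' * m3" by algebra
    text \<open>The triple \<open>(m1, - m2, m3)\<close> is a syzygy of the regular sequence \<open>h, l, - l'\<close>, hence a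
      Koszul syzygy with coefficients \<open>k1, k2, k3\<close>.\<close>
    from regular'[OF m] obtain k3 k2 where k32: "m1 = l * k3 + l' * k2" by blast
    have "l * (h * k3 - m2) = l' * (m3 - h * k2)" using m k32 by algebra
    from regular[OF this] obtain k1 where "h * k3 - m2 = l' * k1" by (auto elim: dvdE)
    then have m2_eq: "m2 = h * k3 - l' * k1" by algebra
    have "g * s1 + m2 * a1 + m1 * b1 = 0" "g * s2 + m2 * a2 + m1 * b2 = 0" "g * s3 + m2 * a3 + m1 * b3 = 0"
      by (rule plane_relation[OF nz _ g(1-3) m2 m1]; use s in \<open>simp add: AR_def\<close>)+
    \<comment> \<open>After the Koszul form is inserted, the terms with \<open>k3\<close> combine by
      \<open>rel\<close> to a multiple of \<open>l'\<close>, so \<open>l'\<close> becomes a common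
      factor.\<close>
    then have "l' * (\<kappa> * s1) = l' * (k1 * a1 - k2 * b1 - k3 * c1)"
      "l' * (\<kappa> * s2) = l' * (k1 * a2 - k2 * b2 - k3 * c2)"
      "l' * (\<kappa> * s3) = l' * (k1 * a3 - k2 * b3 - k3 * c3)"
      unfolding g_eq m2_eq k32 using rel by algebra+
    then have "\<kappa> * s1 = k1 * a1 - k2 * b1 - k3 * c1" "\<kappa> * s2 = k1 * a2 - k2 * b2 - k3 * c2"
      "\<kappa> * s3 = k1 * a3 - k2 * b3 - k3 * c3"
      using l' by (simp_all only: mult_cancel_left) auto
    then have "s1 = constS (d / k) * k1 * a1 - constS (d / k) * k2 * b1 - constS (d / k) * k3 * c1"
      "s2 = constS (d / k) * k1 * a2 - constS (d / k) * k2 * b2 - constS (d / k) * k3 * c2"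
      "s3 = constS (d / k) * k1 * a3 - constS (d / k) * k2 * b3 - constS (d / k) * k3 * c3"
      using \<kappa>(2) by algebra+
    then show "in_span 3 gens r"
      unfolding in_span_def r
      by (intro exI[of _ "\<lambda>i. if i = 0 then constS (d / k) * k1
          else if i = 1 then - constS (d / k) * k2 else - constS (d / k) * k3"])
        (simp add: gens_def numeral_3_eq_3)
  next
    fix u :: "nat \<Rightarrow> S" and i :: nat
    assume "(\<Sum>i<3. u i * fst (gens i)) = 0" "(\<Sum>i<3. u i * fst (snd (gens i))) = 0"
      "(\<Sum>i<3. u i * snd (snd (gens i))) = 0" and i: "i < 3"
    then have u: "u 0 * a1 + u 1 * b1 + u 2 * c1 = 0" "u 0 * a2 + u 1 * b2 + u 2 * c2 = 0"
      "u 0 * a3 + u 1 * b3 + u 2 * c3 = 0"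
      by (simp_all add: gens_def numeral_3_eq_3 numeral_2_eq_2)
    have "(u 1 * g + u 2 * g') * dX f = 0" "(u 1 * g + u 2 * g') * dY f = 0" "(u 1 * g + u 2 * g') * dZ f = 0"
      using u g(1-3) g' by algebra+
    then have "u 1 * g + u 2 * g' = 0" using nz by auto
    then have "\<kappa> * (u 1 * l' + u 2 * l) = 0" by (simp add: g_eq g'_eq algebra_simps)
    then have u12: "u 1 * l' + u 2 * l = 0" using \<kappa>(4) by simp
    then have "l * u 2 = l' * (- u 1)" by algebra
    \<comment> \<open>This \<open>w\<close> will exhibit an arbitrary relation as \<open>- w\<close>
      times the given one, whose entries are \<open>h\<close>, \<open>l\<close>,
      \<open>- l'\<close>.\<close>
    from regular[OF this] obtain w where w: "u 2 = l' * w" by (auto elim: dvdE)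
    have "l' * (u 1 + l * w) = 0" using u12 w by algebra
    then have u1: "u 1 = - (l * w)" using l' by (simp add: eq_neg_iff_add_eq_0)
    have "(u 0 * g - u 2 * g'') * dX f = 0" "(u 0 * g - u 2 * g'') * dY f = 0" "(u 0 * g - u 2 * g'') * dZ f = 0"
      using u g(1-3) g'' by algebra+
    then have "u 0 * g - u 2 * g'' = 0" using nz by auto
    then have "\<kappa> * l' * (u 0 + h * w) = 0" by (simp add: g_eq g''_eq w algebra_simps)
    then have u0: "u 0 = - (h * w)" using l' \<kappa>(4) by (simp add: eq_neg_iff_add_eq_0)
    show "eval0 (u i) = 0"
      using i u0 u1 w eval0 by (auto simp: less3 eval0_hom)
  qed (use a b c homog in \<open>auto simp: gens_def less3 nth_Cons'\<close>)
qed

section \<open>Linear forms and linear coordinates\<close>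

text \<open>Coefficients of powers of the grading variable are compared in
  \<open>graded (e * f)\<close>. For nonzero \<open>e\<close> this also yields
  \<open>d \<le> n\<close>, so the truncated difference is the true one; zero is homogeneous of
  every degree.\<close>

lemma homog_cancel:
  assumes "homog d f" "f \<noteq> 0" "homog n (e * f)"
  shows "homog (n - d) e"
proof -
  have eq: "graded e * monom f d = monom (e * f) n"
    using assms by (simp add: homog_iff_graded graded_hom)
  have coeff: "coeff (graded e) k * f = (if k + d = n then e * f else 0)" for k
    using arg_cong[OF eq, of "\<lambda>p. coeff p (k + d)"]
    by (simp add: mult.commute[of _ "monom f d"] coeff_monom_mult)
      (auto simp: mult.commute)
  show ?thesis
    unfolding homog_iff_graded
  proof (rule poly_eqI)
    fix k
    show "coeff (graded e) k = coeff (monom e (n - d)) k"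
    proof (cases "e = 0")
      case True
      then show ?thesis by (simp add: graded_hom)
    next
      case False
      then have "graded e \<noteq> 0" using poly_graded_1[of e] by auto
      then have "e * f \<noteq> 0" "d \<le> n"
        using False assms(2) coeff[of "degree (graded e)"] by (auto split: if_splits)
      with coeff[of k] assms(2) show ?thesis by (auto split: if_splits)
    qed
  qed
qed

lemma degree_graded_0:
  assumes "degree (graded p) = 0"
  shows "p = constS (eval0 p)"
proof -
  from assms obtain a where "graded p = [:a:]" by (metis degree_0_id)
  then show ?thesis using poly_graded_0[of p] poly_graded_1[of p] by simp
qed

lemma degree_graded_factors:
  assumes "homog 1 (g * t)" "g * t \<noteq> 0"
  shows "degree (graded g) + degree (graded t) = 1"
proof -
  have nz: "graded p \<noteq> 0" if "p \<noteq> 0" for p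
    using poly_graded_1[of p] that by auto
  have "degree (graded g * graded t) = 1"
    using assms by (simp add: homog_iff_graded degree_monom_eq flip: graded_hom)
  moreover have "degree (graded g * graded t) = degree (graded g) + degree (graded t)"
    using assms nz by (intro degree_mult_eq) auto
  ultimately show ?thesis by simp
qed

lemma is_unit_constS: "k \<noteq> 0 \<Longrightarrow> is_unit (constS k)"
  by (intro dvdI[of _ _ "constS (1 / k)"]) (simp flip: constS_hom)

text \<open>The degree of \<open>graded\<close> is additive on products, so in a factorisation of a
  linear form one factor is constant.\<close>

lemma homog_1_divisor:
  assumes "homog 1 l" "l \<noteq> 0" "g dvd l" "\<not> is_unit g"
  shows "l dvd g"
proof -
  obtain s where s: "l = g * s" using assms(3) by (elim dvdE)
  have unit: "is_unit p" if "degree (graded p) = 0" "p \<noteq> 0" for p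
    using degree_graded_0[OF that(1)] is_unit_constS[of "eval0 p"] that(2) constS_eq_0_iff by metis
  have "degree (graded g) \<noteq> 0" using unit assms(2,4) s by auto
  with degree_graded_factors[of g s] assms s have "degree (graded s) = 0" by simp
  with unit assms(2) s have "is_unit s" by auto
  then show ?thesis unfolding s by (simp add: mult_unit_dvd_iff)
qed

lemma homog_1_common_divisor:
  assumes hl: "homog 1 l" "homog 1 l'" and l: "l \<noteq> 0" and g: "g dvd l" "g dvd l'" "\<not> is_unit g"
  obtains k where "l' = constS k * l"
proof (cases "l' = 0")
  case True
  then show thesis using that[of 0] by (simp add: constS_hom)
next
  case False
  have "l dvd l'" using homog_1_divisor[OF hl(1) l g(1,3)] g(2) by (rule dvd_trans)
  then obtain t where t: "l' = l * t" by (elim dvdE)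
  have "degree (graded l) = 1" using hl(1) l by (simp add: homog_iff_graded degree_monom_eq)
  with degree_graded_factors[of l t] hl(2) False t have "degree (graded t) = 0" by simp
  from that[of "eval0 t"] degree_graded_0[OF this] t show thesis by (simp add: mult.commute)
qed

lemma unital_hom_subst: "unital_hom (\<lambda>p. evalG constS p a b c)"
  by (intro unital_hom_evalG unital_hom_constS)

text \<open>The splitting \<open>p q - p' q' = (p - p') q + p' (q - q')\<close> carries ideal
  membership through products. It shows later that a substitution changes a polynomial only modulo
  an ideal of linear forms.\<close>

lemma subst_ideal: "\<exists>a b c. p - evalG constS p A B C = a * (varX - A) + b * (varY - B) + c * (varZ - C)"
proof (induction p rule: S_induct)
  case (add p q)
  then obtain a b c a' b' c' where
    "p - evalG constS p A B C = a * (varX - A) + b * (varY - B) + c * (varZ - C)"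
    "q - evalG constS q A B C = a' * (varX - A) + b' * (varY - B) + c' * (varZ - C)" by blast
  then have "p + q - (evalG constS p A B C + evalG constS q A B C) =
    (a + a') * (varX - A) + (b + b') * (varY - B) + (c + c') * (varZ - C)" by algebra
  then show ?case unfolding unital_homD(3)[OF unital_hom_subst] by blast
next
  case (mult p q)
  then obtain a b c a' b' c' where
    "p - evalG constS p A B C = a * (varX - A) + b * (varY - B) + c * (varZ - C)"
    "q - evalG constS q A B C = a' * (varX - A) + b' * (varY - B) + c' * (varZ - C)" by blast
  then have "p * q - (evalG constS p A B C * evalG constS q A B C) =
    (a * q + evalG constS p A B C * a') * (varX - A) + (b * q + evalG constS p A B C * b') * (varY - B)
      + (c * q + evalG constS p A B C * c') * (varZ - C)" by algebra
  then show ?case unfolding unital_homD(4)[OF unital_hom_subst] by blast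
next
  case (const k)
  have "constS k - evalG constS (constS k) A B C = 0 * (varX - A) + 0 * (varY - B) + 0 * (varZ - C)"
    by (simp add: evalG_gens[OF unital_hom_constS])
  then show ?case by blast
next
  case X
  have "varX - evalG constS varX A B C = 1 * (varX - A) + 0 * (varY - B) + 0 * (varZ - C)"
    by (simp add: evalG_gens[OF unital_hom_constS])
  then show ?case by blast
next
  case Y
  have "varY - evalG constS varY A B C = 0 * (varX - A) + 1 * (varY - B) + 0 * (varZ - C)"
    by (simp add: evalG_gens[OF unital_hom_constS])
  then show ?case by blast
next
  case Z
  have "varZ - evalG constS varZ A B C = 0 * (varX - A) + 0 * (varY - B) + 1 * (varZ - C)"
    by (simp add: evalG_gens[OF unital_hom_constS])
  then show ?case by blast
qed

section \<open>Linear changes of coordinates\<close>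

text \<open>The inverse matrix \<open>m\<close> of \<open>n\<close> is carried explicitly:
  \<open>n\<close> defines the forms \<open>X\<close>, \<open>Y\<close>, \<open>Z\<close>, and
  \<open>m\<close> transports fields and substitutions back to the variables without dividing by a
  determinant.\<close>

locale linear_coords =
  fixes n11 n12 n13 n21 n22 n23 n31 n32 n33 m11 m12 m13 m21 m22 m23 m31 m32 m33 :: complex
  assumes nm: "n11 * m11 + n12 * m21 + n13 * m31 = 1" "n11 * m12 + n12 * m22 + n13 * m32 = 0" "n11 * m13 + n12 * m23 + n13 * m33 = 0"
      "n21 * m11 + n22 * m21 + n23 * m31 = 0" "n21 * m12 + n22 * m22 + n23 * m32 = 1" "n21 * m13 + n22 * m23 + n23 * m33 = 0"
      "n31 * m11 + n32 * m21 + n33 * m31 = 0" "n31 * m12 + n32 * m22 + n33 * m32 = 0" "n31 * m13 + n32 * m23 + n33 * m33 = 1"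
    and mn: "m11 * n11 + m12 * n21 + m13 * n31 = 1" "m11 * n12 + m12 * n22 + m13 * n32 = 0" "m11 * n13 + m12 * n23 + m13 * n33 = 0"
      "m21 * n11 + m22 * n21 + m23 * n31 = 0" "m21 * n12 + m22 * n22 + m23 * n32 = 1" "m21 * n13 + m22 * n23 + m23 * n33 = 0"
      "m31 * n11 + m32 * n21 + m33 * n31 = 0" "m31 * n12 + m32 * n22 + m33 * n32 = 0" "m31 * n13 + m32 * n23 + m33 * n33 = 1"
begin

definition X :: S where "X = constS n11 * varX + constS n12 * varY + constS n13 * varZ"
definition Y :: S where "Y = constS n21 * varX + constS n22 * varY + constS n23 * varZ"
definition Z :: S where "Z = constS n31 * varX + constS n32 * varY + constS n33 * varZ"

text \<open>The vector field with components \<open>A, B, C\<close> in the coordinates \<open>X, Y, Z\<close>.\<close>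

definition field :: "S \<Rightarrow> S \<Rightarrow> S \<Rightarrow> S \<times> S \<times> S" where
  "field A B C = (constS m11 * A + constS m12 * B + constS m13 * C,
    constS m21 * A + constS m22 * B + constS m23 * C, constS m31 * A + constS m32 * B + constS m33 * C)"

lemmas nmS = nm[THEN arg_cong[of _ _ constS], unfolded constS_hom]
lemmas mnS = mn[THEN arg_cong[of _ _ constS], unfolded constS_hom]

lemma homog_XYZ: "homog 1 X" "homog 1 Y" "homog 1 Z"
  unfolding X_def Y_def Z_def by (intro homog_add homog_constS_mult homog_gens)+

lemma D_field: "D (field A B C) X = A" "D (field A B C) Y = B" "D (field A B C) Z = C"
proof -
  show "D (field A B C) X = A"
    unfolding X_def field_def using nmS(1-3) by (simp add: D_add D_mult) algebra
  show "D (field A B C) Y = B"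
    unfolding Y_def field_def using nmS(4-6) by (simp add: D_add D_mult) algebra
  show "D (field A B C) Z = C"
    unfolding Z_def field_def using nmS(7-9) by (simp add: D_add D_mult) algebra
qed

lemma field_XYZ: "field X Y Z = euler_field"
proof -
  have "constS m11 * X + constS m12 * Y + constS m13 * Z = varX"
    unfolding X_def Y_def Z_def using mnS(1-3) by algebra
  moreover have "constS m21 * X + constS m22 * Y + constS m23 * Z = varY"
    unfolding X_def Y_def Z_def using mnS(4-6) by algebra
  moreover have "constS m31 * X + constS m32 * Y + constS m33 * Z = varZ"
    unfolding X_def Y_def Z_def using mnS(7-9) by algebra
  ultimately show ?thesis by (simp add: field_def)
qed

lemma homog_field: "homog d A \<Longrightarrow> homog d B \<Longrightarrow> homog d C \<Longrightarrow> homog_triple d (field A B C)"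
  unfolding homog_triple_def field_def by (auto intro!: homog_add homog_constS_mult)

lemma D_field_add: "D (field (A + e * A') (B + e * B') (C + e * C')) p = D (field A B C) p + e * D (field A' B' C') p"
  by (simp add: field_def D.simps algebra_simps)

definition det_m :: complex where
  "det_m = m11 * (m22 * m33 - m23 * m32) + m12 * (m23 * m31 - m21 * m33) + m13 * (m21 * m32 - m22 * m31)"

text \<open>Multiplicativity of the determinant, written out: \<open>det_m\<close> times the
  determinant of \<open>n\<close> is that of the product, which is 1.\<close>

lemma det_m_nonzero: "det_m \<noteq> 0"
proof -
  have "det_m * (n11 * (n22 * n33 - n23 * n32) + n12 * (n23 * n31 - n21 * n33) + n13 * (n21 * n32 - n22 * n31)) =
      (m11 * n11 + m12 * n21 + m13 * n31) * ((m21 * n12 + m22 * n22 + m23 * n32) * (m31 * n13 + m32 * n23 + m33 * n33)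
        - (m21 * n13 + m22 * n23 + m23 * n33) * (m31 * n12 + m32 * n22 + m33 * n32))
      + (m11 * n12 + m12 * n22 + m13 * n32) * ((m21 * n13 + m22 * n23 + m23 * n33) * (m31 * n11 + m32 * n21 + m33 * n31)
        - (m21 * n11 + m22 * n21 + m23 * n31) * (m31 * n13 + m32 * n23 + m33 * n33))
      + (m11 * n13 + m12 * n23 + m13 * n33) * ((m21 * n11 + m22 * n21 + m23 * n31) * (m31 * n12 + m32 * n22 + m33 * n32)
        - (m21 * n12 + m22 * n22 + m23 * n32) * (m31 * n11 + m32 * n21 + m33 * n31))"
    unfolding det_m_def by (simp add: algebra_simps)
  also have "\<dots> = 1" unfolding mn by simp
  finally have "det_m * (n11 * (n22 * n33 - n23 * n32) + n12 * (n23 * n31 - n21 * n33) + n13 * (n21 * n32 - n22 * n31)) = 1" .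
  then show ?thesis by auto
qed

lemma vdet_field:
  "vdet (field A1 A2 A3) (field B1 B2 B3) (field C1 C2 C3) = constS det_m * vdet (A1, A2, A3) (B1, B2, B3) (C1, C2, C3)"
proof -
  have minor: "(p1 * B1 + p2 * B2 + p3 * B3) * (q1 * C1 + q2 * C2 + q3 * C3)
      - (q1 * B1 + q2 * B2 + q3 * B3) * (p1 * C1 + p2 * C2 + p3 * C3)
    = (p2 * q3 - p3 * q2) * (B2 * C3 - B3 * C2) + (p3 * q1 - p1 * q3) * (B3 * C1 - B1 * C3)
      + (p1 * q2 - p2 * q1) * (B1 * C2 - B2 * C1)" for p1 p2 p3 q1 q2 q3 :: S
    by algebra
  have expand: "(p1 * A1 + p2 * A2 + p3 * A3) * ((q2 * r3 - q3 * r2) * U + (q3 * r1 - q1 * r3) * V + (q1 * r2 - q2 * r1) * W)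
    + (q1 * A1 + q2 * A2 + q3 * A3) * ((r2 * p3 - r3 * p2) * U + (r3 * p1 - r1 * p3) * V + (r1 * p2 - r2 * p1) * W)
    + (r1 * A1 + r2 * A2 + r3 * A3) * ((p2 * q3 - p3 * q2) * U + (p3 * q1 - p1 * q3) * V + (p1 * q2 - p2 * q1) * W)
    = (p1 * (q2 * r3 - q3 * r2) + p2 * (q3 * r1 - q1 * r3) + p3 * (q1 * r2 - q2 * r1)) * (A1 * U + A2 * V + A3 * W)"
    for p1 p2 p3 q1 q2 q3 r1 r2 r3 U V W :: S
    by (simp add: algebra_simps)
  show ?thesis
    unfolding field_def det_m_def vdet.simps constS_hom minor expand ..
qed

lemma subst_coords:
  obtains \<pi> where "unital_hom \<pi>" "\<And>c. \<pi> (constS c) = constS c" "\<pi> X = P" "\<pi> Y = Q" "\<pi> Z = R"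
    "\<And>p. \<exists>a b c. p - \<pi> p = a * (X - P) + b * (Y - Q) + c * (Z - R)"
proof -
  define A where "A = constS m11 * P + constS m12 * Q + constS m13 * R"
  define B where "B = constS m21 * P + constS m22 * Q + constS m23 * R"
  define C where "C = constS m31 * P + constS m32 * Q + constS m33 * R"
  define \<pi> where "\<pi> p = evalG constS p A B C" for p
  have h: "unital_hom \<pi>" unfolding \<pi>_def[abs_def] by (rule unital_hom_subst)
  have gens: "\<pi> varX = A" "\<pi> varY = B" "\<pi> varZ = C" "\<And>c. \<pi> (constS c) = constS c"
    by (simp_all add: \<pi>_def evalG_gens[OF unital_hom_constS])
  have "\<pi> X = P" unfolding X_def unital_homD[OF h] gens A_def B_def C_def using nmS(1-3) by algebra
  moreover have "\<pi> Y = Q" unfolding Y_def unital_homD[OF h] gens A_def B_def C_def using nmS(4-6) by algebra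
  moreover have "\<pi> Z = R" unfolding Z_def unital_homD[OF h] gens A_def B_def C_def using nmS(7-9) by algebra
  moreover have "\<exists>a b c. p - \<pi> p = a * (X - P) + b * (Y - Q) + c * (Z - R)" for p
  proof -
    obtain a b c where abc: "p - \<pi> p = a * (varX - A) + b * (varY - B) + c * (varZ - C)"
      using subst_ideal[of p A B C] unfolding \<pi>_def by blast
    have "varX - A = constS m11 * (X - P) + constS m12 * (Y - Q) + constS m13 * (Z - R)"
      "varY - B = constS m21 * (X - P) + constS m22 * (Y - Q) + constS m23 * (Z - R)"
      "varZ - C = constS m31 * (X - P) + constS m32 * (Y - Q) + constS m33 * (Z - R)"
    proof -
      have "varX = constS m11 * X + constS m12 * Y + constS m13 * Z"
        "varY = constS m21 * X + constS m22 * Y + constS m23 * Z"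
        "varZ = constS m31 * X + constS m32 * Y + constS m33 * Z"
        using field_XYZ by (simp_all add: field_def)
      then show "varX - A = constS m11 * (X - P) + constS m12 * (Y - Q) + constS m13 * (Z - R)"
        "varY - B = constS m21 * (X - P) + constS m22 * (Y - Q) + constS m23 * (Z - R)"
        "varZ - C = constS m31 * (X - P) + constS m32 * (Y - Q) + constS m33 * (Z - R)"
        unfolding A_def B_def C_def by algebra+
    qed
    then have "p - \<pi> p = (a * constS m11 + b * constS m21 + c * constS m31) * (X - P)
       + (a * constS m12 + b * constS m22 + c * constS m32) * (Y - Q)
       + (a * constS m13 + b * constS m23 + c * constS m33) * (Z - R)"
      unfolding abc by algebra
    then show ?thesis by blast
  qed
  ultimately show thesis using that[OF h gens(4)] by blast
qed

lemma eval_coords: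
  obtains \<pi> where "unital_hom \<pi>" "\<And>c. \<pi> (constS c) = c" "\<pi> X = a" "\<pi> Y = b" "\<pi> Z = c"
proof -
  obtain \<phi> where \<phi>: "unital_hom \<phi>" "\<And>c. \<phi> (constS c) = constS c" "\<phi> X = constS a" "\<phi> Y = constS b" "\<phi> Z = constS c"
    using subst_coords[of "constS a" "constS b" "constS c"] by metis
  have "unital_hom (\<lambda>p. eval0 (\<phi> p))"
    using unital_homD[OF \<phi>(1)] by (simp add: unital_hom_def eval0_hom)
  from that[OF this] show thesis by (simp add: \<phi>)
qed

definition lin :: "complex \<Rightarrow> complex \<Rightarrow> complex \<Rightarrow> S" where
  "lin a b c = constS a * X + constS b * Y + constS c * Z"

lemma lin_eq_iff: "lin a b c = lin a' b' c' \<longleftrightarrow> a = a' \<and> b = b' \<and> c = c'"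
proof
  assume eq: "lin a b c = lin a' b' c'"
  have "a * x + b * y + c * z = a' * x + b' * y + c' * z" for x y z
  proof -
    obtain \<pi> where \<pi>: "unital_hom \<pi>" "\<And>c. \<pi> (constS c) = c" "\<pi> X = x" "\<pi> Y = y" "\<pi> Z = z"
      using eval_coords[of x y z] by metis
    have "\<pi> (lin p q r) = p * x + q * y + r * z" for p q r
      by (simp add: lin_def unital_homD[OF \<pi>(1)] \<pi>)
    with eq show ?thesis by metis
  qed
  from this[of 1 0 0] this[of 0 1 0] this[of 0 0 1]
  show "a = a' \<and> b = b' \<and> c = c'" by simp
qed simp

lemma homog_lin: "homog 1 (lin a b c)"
  unfolding lin_def by (intro homog_add homog_constS_mult homog_XYZ)

lemma is_unit_common_divisor_lin:
  assumes "g dvd lin a b c" "g dvd lin a' b' c'"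
    and v: "b * c' - c * b' \<noteq> 0 \<or> c * a' - a * c' \<noteq> 0 \<or> a * b' - b * a' \<noteq> 0"
  shows "is_unit g"
proof (rule ccontr)
  assume "\<not> is_unit g"
  moreover have "lin 0 0 0 = 0" by (simp add: lin_def constS_hom)
  then have "lin a b c \<noteq> 0"
    using v lin_eq_iff[of a b c 0 0 0] by auto
  ultimately obtain k where "lin a' b' c' = constS k * lin a b c"
    using homog_1_common_divisor[OF homog_lin homog_lin _ assms(1,2)] by blast
  also have "\<dots> = lin (k * a) (k * b) (k * c)"
    by (simp add: lin_def constS_hom algebra_simps)
  finally show False using v by (auto simp: lin_eq_iff)
qed

text \<open>The ideal of two independent linear forms consists of the polynomials vanishing on a line
  through the origin, spanned by their cross product \<open>v\<close>.\<close>

lemma ideal_lin_lin: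
  assumes v: "v1 = b * c' - c * b'" "v2 = c * a' - a * c'" "v3 = a * b' - b * a'"
    and nz: "v1 \<noteq> 0 \<or> v2 \<noteq> 0 \<or> v3 \<noteq> 0"
  obtains \<pi> T where "unital_hom \<pi>" "\<And>k. \<pi> (constS k) = constS k" "T \<noteq> 0"
    "\<pi> X = constS v1 * T" "\<pi> Y = constS v2 * T" "\<pi> Z = constS v3 * T"
    "\<And>p. \<exists>s t. p - \<pi> p = s * lin a b c + t * lin a' b' c'"
proof -
  have XYZ: "X \<noteq> 0" "Y \<noteq> 0" "Z \<noteq> 0"
    using lin_eq_iff[of 1 0 0 0 0 0] lin_eq_iff[of 0 1 0 0 0 0] lin_eq_iff[of 0 0 1 0 0 0]
    by (simp_all add: lin_def constS_hom)
  note vS = v[THEN arg_cong[of _ _ constS], unfolded constS_hom]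
  \<comment> \<open>These are the entries of the cross product of \<open>v\<close> with
    \<open>(X, Y, Z)\<close>, which lies in the ideal by the triple product expansion. Dividing by a
    nonzero entry of \<open>v\<close> makes \<open>(X, Y, Z)\<close> congruent to
    \<open>v * T\<close>, with \<open>T\<close> the matching coordinate over that entry.\<close>
  have XY: "constS v1 * Y - constS v2 * X = constS c' * lin a b c - constS c * lin a' b' c'"
    and YZ: "constS v2 * Z - constS v3 * Y = constS a' * lin a b c - constS a * lin a' b' c'"
    and ZX: "constS v3 * X - constS v1 * Z = constS b' * lin a b c - constS b * lin a' b' c'"
    unfolding vS lin_def by algebra+
  have "\<exists>T s1 t1 s2 t2 s3 t3. T \<noteq> 0 \<and> X - constS v1 * T = s1 * lin a b c + t1 * lin a' b' c'
    \<and> Y - constS v2 * T = s2 * lin a b c + t2 * lin a' b' c'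
    \<and> Z - constS v3 * T = s3 * lin a b c + t3 * lin a' b' c'"
    using nz
  proof (elim disjE)
    assume nz: "v1 \<noteq> 0"
    define i where "i = constS (1 / v1)"
    have i: "i * constS v1 = 1" using nz by (simp add: i_def flip: constS_hom)
    have "X - constS v1 * (i * X) = 0 * lin a b c + 0 * lin a' b' c'"
      "Y - constS v2 * (i * X) = (i * constS c') * lin a b c + (- i * constS c) * lin a' b' c'"
      "Z - constS v3 * (i * X) = (- i * constS b') * lin a b c + (i * constS b) * lin a' b' c'"
      using i XY YZ ZX by algebra+
    moreover have "i * X \<noteq> 0" using i XYZ by auto
    ultimately show ?thesis by blast
  next
    assume nz: "v2 \<noteq> 0"
    define i where "i = constS (1 / v2)"
    have i: "i * constS v2 = 1" using nz by (simp add: i_def flip: constS_hom)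
    have "X - constS v1 * (i * Y) = (- i * constS c') * lin a b c + (i * constS c) * lin a' b' c'"
      "Y - constS v2 * (i * Y) = 0 * lin a b c + 0 * lin a' b' c'"
      "Z - constS v3 * (i * Y) = (i * constS a') * lin a b c + (- i * constS a) * lin a' b' c'"
      using i XY YZ ZX by algebra+
    moreover have "i * Y \<noteq> 0" using i XYZ by auto
    ultimately show ?thesis by blast
  next
    assume nz: "v3 \<noteq> 0"
    define i where "i = constS (1 / v3)"
    have i: "i * constS v3 = 1" using nz by (simp add: i_def flip: constS_hom)
    have "X - constS v1 * (i * Z) = (i * constS b') * lin a b c + (- i * constS b) * lin a' b' c'"
      "Y - constS v2 * (i * Z) = (- i * constS a') * lin a b c + (i * constS a) * lin a' b' c'"
      "Z - constS v3 * (i * Z) = 0 * lin a b c + 0 * lin a' b' c'"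
      using i XY YZ ZX by algebra+
    moreover have "i * Z \<noteq> 0" using i XYZ by auto
    ultimately show ?thesis by blast
  qed
  then obtain T s1 t1 s2 t2 s3 t3 where T: "T \<noteq> 0" and
    mem: "X - constS v1 * T = s1 * lin a b c + t1 * lin a' b' c'"
    "Y - constS v2 * T = s2 * lin a b c + t2 * lin a' b' c'"
    "Z - constS v3 * T = s3 * lin a b c + t3 * lin a' b' c'" by blast
  obtain \<pi> where \<pi>: "unital_hom \<pi>" "\<And>k. \<pi> (constS k) = constS k"
    "\<pi> X = constS v1 * T" "\<pi> Y = constS v2 * T" "\<pi> Z = constS v3 * T"
    "\<And>p. \<exists>a b c. p - \<pi> p = a * (X - constS v1 * T) + b * (Y - constS v2 * T) + c * (Z - constS v3 * T)"
    using subst_coords[of "constS v1 * T" "constS v2 * T" "constS v3 * T"] by metis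
  have "\<exists>s t. p - \<pi> p = s * lin a b c + t * lin a' b' c'" for p
  proof -
    obtain x y z where "p - \<pi> p = x * (X - constS v1 * T) + y * (Y - constS v2 * T) + z * (Z - constS v3 * T)"
      using \<pi>(6) by blast
    then have "p - \<pi> p = (x * s1 + y * s2 + z * s3) * lin a b c + (x * t1 + y * t2 + z * t3) * lin a' b' c'"
      unfolding mem by algebra
    then show ?thesis by blast
  qed
  then show thesis by (rule that[OF \<pi>(1,2) T \<pi>(3-5)])
qed

end

section \<open>Coprimality of the partial derivatives\<close>

text \<open>What the coprimality proofs use of a linear coordinate system, freed from matrices:
  fields with prescribed derivatives of the three forms, and points with prescribed
  coordinates.\<close>

definition frame :: "S \<Rightarrow> S \<Rightarrow> S \<Rightarrow> bool" where
  "frame X Y Z \<longleftrightarrow> homog 1 X \<and> homog 1 Y \<and> homog 1 Z \<and>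
    (\<forall>A B C. \<exists>r. D r X = A \<and> D r Y = B \<and> D r Z = C) \<and>
    (\<forall>a b c. \<exists>\<pi>. unital_hom \<pi> \<and> (\<forall>k. \<pi> (constS k) = k) \<and> \<pi> X = a \<and> \<pi> Y = b \<and> \<pi> Z = c)"

lemma (in linear_coords) frame_XYZ: "frame X Y Z"
  unfolding frame_def
proof (intro conjI homog_XYZ allI)
  show "\<exists>r. D r X = A \<and> D r Y = B \<and> D r Z = C" for A B C
    using D_field by blast
  show "\<exists>\<pi>. unital_hom \<pi> \<and> (\<forall>k. \<pi> (constS k) = k) \<and> \<pi> X = a \<and> \<pi> Y = b \<and> \<pi> Z = c" for a b c
    using eval_coords[of a b c] by metis
qed

lemma frame_scale:
  assumes "frame X Y Z" "a \<noteq> 0" "b \<noteq> 0" "c \<noteq> 0"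
  shows "frame (constS a * X) (constS b * Y) (constS c * Z)"
  unfolding frame_def
proof (intro conjI allI)
  show "homog 1 (constS a * X)" "homog 1 (constS b * Y)" "homog 1 (constS c * Z)"
    using assms(1) by (auto simp: frame_def intro!: homog_constS_mult)
  have inv: "constS k * (constS (1 / k) * p) = p" if "k \<noteq> 0" for k p
    using that by (simp add: constS_hom(2) flip: mult.assoc constS_hom(4))
  show "\<exists>r. D r (constS a * X) = A \<and> D r (constS b * Y) = B \<and> D r (constS c * Z) = C" for A B C
  proof -
    obtain r where "D r X = constS (1 / a) * A" "D r Y = constS (1 / b) * B" "D r Z = constS (1 / c) * C"
      using assms(1) unfolding frame_def by metis
    then show ?thesis using assms(2-) by (intro exI[of _ r]) (simp add: D_mult inv)
  qed
  show "\<exists>\<pi>. unital_hom \<pi> \<and> (\<forall>k. \<pi> (constS k) = k) \<and> \<pi> (constS a * X) = x \<and> \<pi> (constS b * Y) = y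
    \<and> \<pi> (constS c * Z) = z" for x y z
  proof -
    obtain \<pi> where "unital_hom \<pi>" "\<forall>k. \<pi> (constS k) = k" "\<pi> X = x / a" "\<pi> Y = y / b" "\<pi> Z = z / c"
      using assms(1) unfolding frame_def by metis
    then show ?thesis using assms(2-) by (intro exI[of _ \<pi>]) (simp add: unital_homD)
  qed
qed

text \<open>The fields certify independence: a proportionality \<open>l' = k l\<close> would give
  \<open>k = 0\<close> along \<open>r\<close>, against the derivative along
  \<open>s\<close>.\<close>

lemma independent_no_common_prime:
  assumes "homog 1 l" "homog 1 l'" and g: "prime_elem g" "g dvd l" "g dvd l'"
    and "D r l = 1" "D r l' = 0" "D s l' = 1"
  shows False
proof -
  have "l \<noteq> 0" using \<open>D r l = 1\<close> D_constS[of r 0] by (auto simp: constS_hom)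
  then obtain k where k: "l' = constS k * l"
    using homog_1_common_divisor[OF assms(1,2) _ g(2,3)] g(1) by (auto simp: prime_elem_def)
  have "0 = constS k" using arg_cong[OF k, of "D r"] assms by (simp add: D_mult)
  with k assms(8) D_constS[of s 0] show False by (simp add: constS_hom)
qed

text \<open>For \<open>c^3 = -2\<close> this is the hyperosculating conic of
  \<open>X^3 + Y^3 + Z^3\<close> at \<open>(1 : 1 : c)\<close>. The form
  \<open>(X - Y)^2 + c Z (2 Z - c (X + Y))\<close> shows that it touches the line
  \<open>Z = 0\<close> at \<open>(1 : 1 : 0)\<close> and the tangent of the cubic at the contact
  point.\<close>

definition conic :: "S \<Rightarrow> S \<Rightarrow> S \<Rightarrow> complex \<Rightarrow> S" where
  "conic X Y Z c = (X - Y) ^ 2 + 2 * constS c * Z ^ 2 - constS c ^ 2 * Z * (X + Y)"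

lemma D_conic:
  "D r (conic X Y Z c) = 2 * (X - Y) * (D r X - D r Y) + 4 * constS c * Z * D r Z
    - constS c ^ 2 * (D r Z * (X + Y) + Z * (D r X + D r Y))"
proof -
  have "D r 2 = 0" "D r 4 = 0" using D_constS[of r 2] D_constS[of r 4] by (simp_all add: constS_hom)
  then show ?thesis
    unfolding conic_def by (simp add: D_add D_diff D_mult power2_eq_square algebra_simps)
qed

text \<open>For constant \<open>C\<close>, let \<open>p = (1 : 1 : C)\<close>, and let
  \<open>o = (1 : -1 : 0)\<close> be the flex with tangent \<open>X + Y\<close>. The linear form
  \<open>2 Z - C (X + Y)\<close> is, up to a factor, the tangent at \<open>p\<close>, and it passes
  through \<open>o\<close>. On the cubic its cube and \<open>X + Y\<close> times the conic both cut
  out \<open>6 p + 3 o\<close>, hence are proportional there.\<close>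

lemma cube_identity:
  fixes X Y Z C :: S
  assumes "C ^ 3 = -2"
  shows "8 * (X ^ 3 + Y ^ 3 + Z ^ 3) = (2 * Z - C * (X + Y)) ^ 3
    + 6 * (X + Y) * ((X - Y) ^ 2 + 2 * C * Z ^ 2 - C ^ 2 * Z * (X + Y))"
  using assms by algebra

lemma frameE:
  assumes "frame X Y Z"
  obtains r where "D r X = A" "D r Y = B" "D r Z = C"
  using assms unfolding frame_def by blast

lemma conic_smooth:
  assumes fr: "frame X Y Z" and c: "c \<noteq> 0" and g: "prime_elem g" and dvd: "\<And>r. g dvd D r (conic X Y Z c)"
  shows False
proof -
  obtain r where r: "D r X = 1" "D r Y = 1" "D r Z = 0" using frameE[OF fr] by metis
  from dvd[of r] have "g dvd constS c ^ 2 * Z * 2"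
    unfolding D_conic r by (simp add: mult.assoc)
  moreover have "constS c ^ 2 * Z * 2 = Z * constS (c ^ 2 * 2)"
    by (simp add: constS_hom)
  ultimately have Z: "g dvd Z"
    using is_unit_constS[of "c ^ 2 * 2"] c by (simp add: dvd_mult_unit_iff)
  obtain s where s: "D s X = 1" "D s Y = 0" "D s Z = 0" using frameE[OF fr] by metis
  have "g dvd D s (conic X Y Z c) + constS c ^ 2 * Z"
    using dvd[of s] Z by auto
  also have "D s (conic X Y Z c) + constS c ^ 2 * Z = (X - Y) * constS 2"
    unfolding D_conic s by (simp add: constS_hom)
  finally have XY: "g dvd X - Y"
    using is_unit_constS[of 2] by (simp add: dvd_mult_unit_iff)
  obtain t where t: "D t X = 0" "D t Y = 0" "D t Z = 1" using frameE[OF fr] by metis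
  show False
    by (rule independent_no_common_prime[OF _ _ g XY Z, of s t])
      (use fr s t in \<open>auto simp: frame_def D_diff intro: homog_diff\<close>)
qed

text \<open>By the cube identity a common prime divides the tangent \<open>l\<close>; modulo
  \<open>l\<close> the conic is \<open>(X - Y)^2\<close>, so the prime divides two independent
  linear forms.\<close>

lemma conic_cubic_coprime:
  assumes fr: "frame X Y Z" and c: "c ^ 3 = -2" and g: "prime_elem g"
    and "g dvd X ^ 3 + Y ^ 3 + Z ^ 3" "g dvd conic X Y Z c"
  shows False
proof -
  define l where "l = 2 * Z - constS c * (X + Y)"
  have C: "constS c ^ 3 = -2" using c by (simp flip: constS_hom)
  have "l ^ 3 = 8 * (X ^ 3 + Y ^ 3 + Z ^ 3) - 6 * (X + Y) * conic X Y Z c"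
    using cube_identity[OF C, of X Y Z] unfolding l_def conic_def by simp
  also have "g dvd \<dots>" using assms(4,5) by (intro dvd_diff dvd_mult)
  finally have "g dvd l ^ 3" .
  with g have l: "g dvd l" using prime_elem_dvd_power by blast
  have "(X - Y) ^ 2 = conic X Y Z c - constS c * Z * l"
    unfolding conic_def l_def by algebra
  also have "g dvd \<dots>" using assms(5) l by (intro dvd_diff dvd_mult)
  finally have "g dvd (X - Y) ^ 2" .
  with g have XY: "g dvd X - Y" using prime_elem_dvd_power by blast
  have D2: "D r 2 = 0" for r using D_constS[of r 2] by (simp add: constS_hom)
  obtain s where s: "D s X = 1" "D s Y = 0" "D s Z = constS (c / 2)" using frameE[OF fr] by metis
  obtain t where t: "D t X = 0" "D t Y = 0" "D t Z = constS (1 / 2)" using frameE[OF fr] by metis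
  \<comment> \<open>The third entries of \<open>s\<close> and \<open>t\<close> are halved so that
    \<open>l\<close>, with its coefficient 2 at \<open>Z\<close>, has derivatives 0 and 1 along
    them, while \<open>X - Y\<close> has derivatives 1 and 0.\<close>
  have half: "2 * constS (a / 2) = constS a" for a
    by (simp flip: constS_hom)
  show False
  proof (rule independent_no_common_prime[OF _ _ g XY l, of s t])
    have "homog 1 (constS 2 * Z - constS c * (X + Y))"
      using fr by (auto simp: frame_def intro!: homog_diff homog_add homog_constS_mult)
    then show "homog 1 l" unfolding l_def by (simp add: constS_hom)
  qed (use fr s t in \<open>auto simp: frame_def l_def D_diff D_add D_mult D2 half constS_hom(2) intro: homog_diff\<close>)
qed

lemma conic_no_linear_factor:
  assumes fr: "frame X Y Z" and c: "c ^ 3 = -2" and M: "M = constS a * X + constS b * Y + constS d * Z"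
    and nz: "M \<noteq> 0" and dvd: "M dvd conic X Y Z c"
  shows False
proof -
  have "c \<noteq> 0" using c by auto
  have point: "(x - y) ^ 2 + 2 * c * z ^ 2 - c ^ 2 * z * (x + y) = 0" if "a * x + b * y + d * z = 0" for x y z
  proof -
    obtain \<pi> where \<pi>: "unital_hom \<pi>" "\<forall>k. \<pi> (constS k) = k" "\<pi> X = x" "\<pi> Y = y" "\<pi> Z = z"
      using fr unfolding frame_def by metis
    have "\<pi> M = 0" using that by (simp add: M unital_homD[OF \<pi>(1)] \<pi>)
    moreover obtain s where "conic X Y Z c = M * s" using dvd by (elim dvdE)
    ultimately have "\<pi> (conic X Y Z c) = 0" by (simp add: unital_homD[OF \<pi>(1)])
    then show ?thesis unfolding conic_def by (simp add: unital_homD[OF \<pi>(1)] \<pi>)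
  qed
  show False
  proof (cases "a = 0 \<and> b = 0")
    case True
    then show False using point[of 1 0 0] by simp
  next
    case False
    from point[of b "- a" 0] have b: "b = - a" by (simp add: add_eq_0_iff)
    with False have "a \<noteq> 0" by simp
    \<comment> \<open>The points with \<open>x - y = - d\<close>, \<open>x + y = t\<close>,
      \<open>z = a\<close> lie on the line; on them the equation of the conic is linear in
      \<open>t\<close> with nonzero slope.\<close>
    have "d ^ 2 + 2 * c * a ^ 2 = c ^ 2 * a * t" for t
    proof -
      have "a * ((t - d) / 2) + b * ((t + d) / 2) + d * a = 0"
        by (simp add: b field_simps)
      from point[OF this] show ?thesis by (simp add: field_simps power2_eq_square)
    qed
    from this[of 0] this[of 1] show False using \<open>a \<noteq> 0\<close> \<open>c \<noteq> 0\<close> by simp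
  qed
qed

text \<open>Both conics give a representation \<open>8 F = l^3 + 6 u Q\<close>, so a common factor of the conics divides
  a difference of cubes of linear forms.\<close>

lemma conics_coprime:
  assumes fr: "frame X Y Z" "frame X' Y' Z'" and c: "c ^ 3 = -2" "c' ^ 3 = -2"
    and F: "X' ^ 3 + Y' ^ 3 + Z' ^ 3 = X ^ 3 + Y ^ 3 + Z ^ 3"
    and lin: "2 * Z' - constS c' * (X' + Y') = constS a * X + constS b * Y + constS d * Z"
    and neq: "\<And>\<zeta>. \<zeta> ^ 3 = 1 \<Longrightarrow> a \<noteq> - c * \<zeta> \<or> b \<noteq> - c * \<zeta> \<or> d \<noteq> 2 * \<zeta>"
    and g: "prime_elem g" "g dvd conic X Y Z c" "g dvd conic X' Y' Z' c'"
  shows False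
proof -
  define l where "l = 2 * Z - constS c * (X + Y)"
  define l' where "l' = 2 * Z' - constS c' * (X' + Y')"
  have C: "constS c ^ 3 = -2" "constS c' ^ 3 = -2" using c by (simp_all flip: constS_hom)
  have "l' ^ 3 - l ^ 3 = 6 * (X + Y) * conic X Y Z c - 6 * (X' + Y') * conic X' Y' Z' c'"
  proof -
    have "l ^ 3 + 6 * (X + Y) * conic X Y Z c = l' ^ 3 + 6 * (X' + Y') * conic X' Y' Z' c'"
      unfolding l_def l'_def conic_def cube_identity[OF C(1), symmetric] cube_identity[OF C(2), symmetric] F ..
    then show ?thesis by algebra
  qed
  also have "g dvd \<dots>" using g(2,3) by (intro dvd_diff dvd_mult)
  finally have "g dvd l' ^ 3 - l ^ 3" .
  moreover define w :: complex where "w = Complex (-1/2) (sqrt 3 / 2)"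
  have w: "w ^ 2 + w + 1 = 0" by (simp add: w_def power2_eq_square complex_eq_iff)
  then have W: "constS w ^ 2 + constS w + 1 = 0" by (simp flip: constS_hom)
  have "l' ^ 3 - l ^ 3 = (l' - constS 1 * l) * (l' - constS w * l) * (l' - constS (w ^ 2) * l)"
    using W unfolding constS_hom by algebra
  ultimately have "\<exists>\<zeta>\<in>{1, w, w ^ 2}. g dvd l' - constS \<zeta> * l"
    using g(1) by (auto simp: prime_elem_dvd_mult_iff)
  moreover have "w ^ 3 = 1" "(w ^ 2) ^ 3 = 1" using w by algebra+
  ultimately have "\<exists>\<zeta>. \<zeta> ^ 3 = 1 \<and> g dvd l' - constS \<zeta> * l" by (metis insertE power_one singletonD)
  then obtain \<zeta> where \<zeta>: "\<zeta> ^ 3 = 1" "g dvd l' - constS \<zeta> * l" by blast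
  define M where "M = l' - constS \<zeta> * l"
  have M: "M = constS (a + c * \<zeta>) * X + constS (b + c * \<zeta>) * Y + constS (d - 2 * \<zeta>) * Z"
    unfolding M_def l_def l'_def lin by (simp add: constS_hom algebra_simps)
  have nz: "M \<noteq> 0"
  proof
    assume "M = 0"
    have "(a + c * \<zeta>) * x + (b + c * \<zeta>) * y + (d - 2 * \<zeta>) * z = 0" for x y z
    proof -
      obtain \<pi> where \<pi>: "unital_hom \<pi>" "\<forall>k. \<pi> (constS k) = k" "\<pi> X = x" "\<pi> Y = y" "\<pi> Z = z"
        using fr(1) unfolding frame_def by metis
      from arg_cong[OF M, of \<pi>] \<open>M = 0\<close> show ?thesis
        by (simp add: unital_homD[OF \<pi>(1)] \<pi>)
    qed
    from this[of 1 0 0] this[of 0 1 0] this[of 0 0 1] neq[OF \<zeta>(1)] show False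
      by (auto simp: eq_neg_iff_add_eq_0)
  qed
  have hM: "homog 1 M" using fr(1) unfolding M frame_def by (auto intro!: homog_add homog_constS_mult)
  \<comment> \<open>A prime dividing a nonzero linear form is associate to it, so the conic would
    contain a line.\<close>
  have "M dvd g"
    using homog_1_divisor[OF hM nz] \<zeta>(2) g(1) by (auto simp: M_def prime_elem_def)
  then have "M dvd conic X Y Z c" using g(2) by (rule dvd_trans)
  with conic_no_linear_factor[OF fr(1) c(1) M nz] show False by blast
qed

text \<open>By Euler's formula a prime dividing all derivatives divides the product, hence one
  component; by the Leibniz rule it then divides all derivatives of that component, the other two
  factors being prime to it.\<close>

lemma coprime_gradient_product:
  assumes F: "\<And>g. prime_elem g \<Longrightarrow> (\<And>r. g dvd D r F) \<Longrightarrow> False"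
    and Q: "\<And>g. prime_elem g \<Longrightarrow> (\<And>r. g dvd D r Q) \<Longrightarrow> False"
    and Q': "\<And>g. prime_elem g \<Longrightarrow> (\<And>r. g dvd D r Q') \<Longrightarrow> False"
    and FQ: "\<And>g. prime_elem g \<Longrightarrow> g dvd F \<Longrightarrow> g dvd Q \<Longrightarrow> False"
    and FQ': "\<And>g. prime_elem g \<Longrightarrow> g dvd F \<Longrightarrow> g dvd Q' \<Longrightarrow> False"
    and QQ': "\<And>g. prime_elem g \<Longrightarrow> g dvd Q \<Longrightarrow> g dvd Q' \<Longrightarrow> False"
    and euler: "D euler_field (F * Q * Q') = constS d * (F * Q * Q')" and d: "d \<noteq> 0"
  shows "coprime_gradient (F * Q * Q')"
  unfolding coprime_gradient_def
proof (intro allI impI notI)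
  fix g assume g: "prime_elem g" and dvd: "\<forall>r. g dvd D r (F * Q * Q')"
  have "is_unit (constS d)" using d by (rule is_unit_constS)
  with dvd euler have "g dvd F * Q * Q'" by (metis dvd_mult_unit_iff mult.commute)
  with g consider "g dvd F" | "g dvd Q" | "g dvd Q'" by (auto simp: prime_elem_dvd_mult_iff)
  then show False
  proof cases
    case 1
    have "g dvd D r F" for r
    proof -
      have "D r (F * Q * Q') = F * D r (Q * Q') + D r F * (Q * Q')"
        by (simp add: D_mult algebra_simps)
      with dvd 1 have "g dvd D r F * (Q * Q')" by (metis dvd_add_right_iff dvd_mult2)
      with g 1 FQ[OF g] FQ'[OF g] show ?thesis by (auto simp: prime_elem_dvd_mult_iff)
    qed
    with F g show False by blast
  next
    case 2
    have "g dvd D r Q" for r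
    proof -
      have "D r (F * Q * Q') = Q * D r (F * Q') + D r Q * (F * Q')"
        by (simp add: D_mult algebra_simps)
      with dvd 2 have "g dvd D r Q * (F * Q')" by (metis dvd_add_right_iff dvd_mult2)
      with g 2 FQ[OF g] QQ'[OF g] show ?thesis by (auto simp: prime_elem_dvd_mult_iff)
    qed
    with Q g show False by blast
  next
    case 3
    have "g dvd D r Q'" for r
    proof -
      have "D r (F * Q * Q') = Q' * D r (F * Q) + D r Q' * (F * Q)"
        by (simp add: D_mult algebra_simps)
      with dvd 3 have "g dvd D r Q' * (F * Q)" by (metis dvd_add_right_iff dvd_mult2)
      with g 3 FQ'[OF g] QQ'[OF g] show ?thesis by (auto simp: prime_elem_dvd_mult_iff)
    qed
    with Q' g show False by blast
  qed
qed

lemma cubic_smooth: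
  assumes fr: "frame X Y Z" and g: "prime_elem g" and dvd: "\<And>r. g dvd D r (X ^ 3 + Y ^ 3 + Z ^ 3)"
  shows False
proof -
  have unit: "is_unit (constS 3)" by (simp add: is_unit_constS)
  obtain s where s: "D s X = 1" "D s Y = 0" "D s Z = 0" using frameE[OF fr] by metis
  obtain t where t: "D t X = 0" "D t Y = 1" "D t Z = 0" using frameE[OF fr] by metis
  have "g dvd X ^ 2 * constS 3" using dvd[of s] s by (simp add: D_add D_power constS_hom mult.commute)
  then have "g dvd X" using unit g by (simp add: dvd_mult_unit_iff) (metis prime_elem_dvd_power)
  moreover have "g dvd Y ^ 2 * constS 3" using dvd[of t] t by (simp add: D_add D_power constS_hom mult.commute)
  then have "g dvd Y" using unit g by (simp add: dvd_mult_unit_iff) (metis prime_elem_dvd_power)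
  ultimately show False
    by (intro independent_no_common_prime[OF _ _ g, of X Y s t]) (use fr s t in \<open>auto simp: frame_def\<close>)
qed

section \<open>Syzygies of a cubic together with two conics\<close>

text \<open>\<open>G\<close>, \<open>P\<close>, \<open>P'\<close> are the gradients of the cubic and of the conics in the coordinates
  \<open>X, Y, Z\<close>, the first one up to the factor \<open>\<kappa>\<close>. A vector \<open>u\<close> gives the field \<open>G \<times> u\<close>, which
  annihilates \<open>F\<close>.\<close>

locale cubic_conics = linear_coords +
  fixes F Q Q' G1 G2 G3 P1 P2 P3 P1' P2' P3' :: S and \<kappa> \<tau> :: complex
  assumes D_F: "\<And>A B C. D (field A B C) F = constS \<kappa> * (G1 * A + G2 * B + G3 * C)"
    and D_Q: "\<And>A B C. D (field A B C) Q = P1 * A + P2 * B + P3 * C"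
    and D_Q': "\<And>A B C. D (field A B C) Q' = P1' * A + P2' * B + P3' * C"
    and G_XYZ: "G1 * X + G2 * Y + G3 * Z = constS \<tau> * F"
    and P_XYZ: "P1 * X + P2 * Y + P3 * Z = 2 * Q" "P1' * X + P2' * Y + P3' * Z = 2 * Q'"
    and \<kappa>\<tau>: "\<kappa> * \<tau> = 3"
    and homog_G: "homog 2 G1" "homog 2 G2" "homog 2 G3"
    and homog_P: "homog 1 P1" "homog 1 P2" "homog 1 P3" "homog 1 P1'" "homog 1 P2'" "homog 1 P3'"
    and homog_FQ: "homog 3 F" "homog 2 Q" "homog 2 Q'"
    and nonzero: "F \<noteq> 0" "Q \<noteq> 0" "Q' \<noteq> 0"
begin

abbreviation "f \<equiv> F * Q * Q'"

abbreviation "corrected u1 u2 u3 e \<equiv>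
  field (G2 * u3 - G3 * u2 + e * X) (G3 * u1 - G1 * u3 + e * Y) (G1 * u2 - G2 * u1 + e * Z)"

lemma euler: "D euler_field f = constS 7 * f"
proof -
  have F: "D euler_field F = 3 * F"
  proof -
    have "D euler_field F = constS \<kappa> * constS \<tau> * F"
      unfolding field_XYZ[symmetric] D_F G_XYZ by (simp add: mult.assoc)
    also have "constS \<kappa> * constS \<tau> = 3" using \<kappa>\<tau> by (simp flip: constS_hom)
    finally show ?thesis .
  qed
  have Q: "D euler_field Q = 2 * Q" "D euler_field Q' = 2 * Q'"
    unfolding field_XYZ[symmetric] D_Q D_Q' P_XYZ by simp_all
  show ?thesis by (simp add: D_mult F Q constS_hom)
qed

lemma homog_vdet:
  assumes "homog i a1" "homog i a2" "homog i a3" "homog j b1" "homog j b2" "homog j b3"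
    "homog k c1" "homog k c2" "homog k c3"
  shows "homog (i + j + k) (vdet (a1, a2, a3) (b1, b2, b3) (c1, c2, c3))"
  unfolding vdet.simps add.assoc by (intro homog_add homog_mult homog_diff assms)

lemma tangent_syzygy:
  assumes u: "homog k u1" "homog k u2" "homog k u3"
    and B: "vdet (G1, G2, G3) (u1, u2, u3) (P1, P2, P3) = B * Q"
    and C: "vdet (G1, G2, G3) (u1, u2, u3) (P1', P2', P3') = C * Q'"
    and n: "n = k + 2"
  obtains e where "corrected u1 u2 u3 e \<in> AR f"
    "homog_triple n (corrected u1 u2 u3 e)"
proof -
  \<comment> \<open>The field \<open>?\<theta>\<close> annihilates \<open>F\<close> and scales the
    conics, so it multiplies \<open>f\<close> by \<open>B + C\<close>; the Euler field multiplies
    \<open>f\<close> by 7.\<close>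
  define e where "e = constS (- 1 / 7) * (B + C)"
  let ?\<theta> = "field (G2 * u3 - G3 * u2) (G3 * u1 - G1 * u3) (G1 * u2 - G2 * u1)"
  have "D ?\<theta> F = 0" unfolding D_F by algebra
  moreover have "D ?\<theta> Q = B * Q" unfolding B[symmetric] D_Q by (simp add: algebra_simps)
  moreover have "D ?\<theta> Q' = C * Q'" unfolding C[symmetric] D_Q' by (simp add: algebra_simps)
  ultimately have "D ?\<theta> f = (B + C) * f" by (simp add: D_mult algebra_simps)
  moreover have "constS (- 1 / 7) * constS 7 = -1" by (simp flip: constS_hom)
  then have "e * (constS 7 * f) = - ((B + C) * f)" unfolding e_def by algebra
  ultimately have "corrected u1 u2 u3 e \<in> AR f"
    unfolding AR_iff_D D_field_add field_XYZ euler by simp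
  moreover have "homog (k + 1) B" "homog (k + 1) C"
  proof -
    have "homog (2 + k + 1) (B * Q)" "homog (2 + k + 1) (C * Q')"
      unfolding B[symmetric] C[symmetric] by (intro homog_vdet homog_G homog_P u)+
    from this[THEN homog_cancel[rotated 2]] show "homog (k + 1) B" "homog (k + 1) C"
      using homog_FQ nonzero by fastforce+
  qed
  then have "homog (k + 1) e" unfolding e_def by (intro homog_constS_mult homog_add)
  have "homog_triple n (corrected u1 u2 u3 e)"
  proof -
    have Gu: "homog (k + 2) (g * v - g' * v')" if "homog 2 g" "homog 2 g'" "homog k v" "homog k v'" for g g' v v'
      using homog_diff[OF homog_mult[OF that(1,3)] homog_mult[OF that(2,4)]] by (simp add: add.commute)
    have eX: "homog (k + 2) (e * x)" if "homog 1 x" for x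
      using homog_mult[OF \<open>homog (k + 1) e\<close> that] by simp
    show ?thesis unfolding n by (intro homog_field homog_add Gu eX u homog_G homog_XYZ)
  qed
  ultimately show thesis using that by blast
qed

text \<open>\<open>(G x u) x (G x v)\<close> is \<open>det(G, u, v)\<close> times \<open>G\<close>,
  and \<open>G\<close> contracted with \<open>(X, Y, Z)\<close> is \<open>\<tau> * F\<close>. The
  Euler corrections are multiples of the first row and drop out.\<close>

lemma vdet_tangent:
  "vdet euler_field (corrected u1 u2 u3 e)
     (corrected v1 v2 v3 e')
   = constS (det_m * \<tau>) * F * vdet (G1, G2, G3) (u1, u2, u3) (v1, v2, v3)"
proof -
  have drop: "vdet (x, y, z) (a1 + e * x, a2 + e * y, a3 + e * z) (b1 + e' * x, b2 + e' * y, b3 + e' * z)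
      = vdet (x, y, z) (a1, a2, a3) (b1, b2, b3)" for x y z a1 a2 a3 b1 b2 b3 :: S
    unfolding vdet.simps by (simp add: algebra_simps)
  have "vdet (X, Y, Z) (G2 * u3 - G3 * u2, G3 * u1 - G1 * u3, G1 * u2 - G2 * u1)
      (G2 * v3 - G3 * v2, G3 * v1 - G1 * v3, G1 * v2 - G2 * v1)
    = (G1 * X + G2 * Y + G3 * Z) * vdet (G1, G2, G3) (u1, u2, u3) (v1, v2, v3)"
    unfolding vdet.simps by (simp add: algebra_simps)
  then show ?thesis
    unfolding field_XYZ[symmetric] vdet_field drop G_XYZ by (simp add: constS_hom mult_ac)
qed

theorem free:
  assumes cop: "coprime_gradient f"
    and u: "homog 1 u1" "homog 1 u2" "homog 1 u3"
    and v: "homog 1 v1" "homog 1 v2" "homog 1 v3"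
    and tu: "vdet (G1, G2, G3) (u1, u2, u3) (P1, P2, P3) = Bu * Q" "vdet (G1, G2, G3) (u1, u2, u3) (P1', P2', P3') = Cu * Q'"
    and tv: "vdet (G1, G2, G3) (v1, v2, v3) (P1, P2, P3) = Bv * Q" "vdet (G1, G2, G3) (v1, v2, v3) (P1', P2', P3') = Cv * Q'"
    and det: "vdet (G1, G2, G3) (u1, u2, u3) (v1, v2, v3) = constS k * Q * Q'" and k: "k \<noteq> 0"
  shows "m_syzygy f 2 [3, 3]"
proof -
  obtain e where e: "corrected u1 u2 u3 e \<in> AR f"
    "homog_triple 3 (corrected u1 u2 u3 e)"
    by (rule tangent_syzygy[OF u tu, where n = 3]) simp_all
  obtain e' where e': "corrected v1 v2 v3 e' \<in> AR f"
    "homog_triple 3 (corrected v1 v2 v3 e')"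
    by (rule tangent_syzygy[OF v tv, where n = 3]) simp_all
  have f: "f \<noteq> 0" using nonzero by simp
  have det': "vdet euler_field (corrected u1 u2 u3 e)
     (corrected v1 v2 v3 e')
    = constS (det_m * \<tau> * k) * f"
    unfolding vdet_tangent det by (simp add: constS_hom mult_ac)
  have k': "det_m * \<tau> * k \<noteq> 0" using det_m_nonzero k \<kappa>\<tau> by auto
  show ?thesis
    by (rule free_criterion[OF cop f euler _ e(1)[unfolded field_def] e'(1)[unfolded field_def]
        e(2)[unfolded field_def] e'(2)[unfolded field_def] _ det'[unfolded field_def] k']) simp_all
qed

text \<open>The relation among \<open>u\<close>, \<open>v\<close>, \<open>w\<close> is asked for
  only modulo \<open>G\<close>, because \<open>G x G = 0\<close>. The vector \<open>x\<close> is the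
  common zero of \<open>l\<close> and \<open>l'\<close>; that \<open>h\<close> does not vanish there
  makes \<open>h\<close>, \<open>l\<close>, \<open>l'\<close> a regular sequence.\<close>

theorem nearly_free:
  assumes cop: "coprime_gradient f"
    and u: "homog 1 u1" "homog 1 u2" "homog 1 u3"
    and v: "homog 2 v1" "homog 2 v2" "homog 2 v3"
    and w: "homog 2 w1" "homog 2 w2" "homog 2 w3"
    and tu: "vdet (G1, G2, G3) (u1, u2, u3) (P1, P2, P3) = Bu * Q" "vdet (G1, G2, G3) (u1, u2, u3) (P1', P2', P3') = Cu * Q'"
    and tv: "vdet (G1, G2, G3) (v1, v2, v3) (P1, P2, P3) = Bv * Q" "vdet (G1, G2, G3) (v1, v2, v3) (P1', P2', P3') = Cv * Q'"
    and tw: "vdet (G1, G2, G3) (w1, w2, w3) (P1, P2, P3) = Bw * Q" "vdet (G1, G2, G3) (w1, w2, w3) (P1', P2', P3') = Cw * Q'"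
    and det: "vdet (G1, G2, G3) (u1, u2, u3) (v1, v2, v3) = constS k * l' * Q * Q'" and k: "k \<noteq> 0"
    and rel: "h * u1 + l * v1 - l' * w1 = m * G1" "h * u2 + l * v2 - l' * w2 = m * G2" "h * u3 + l * v3 - l' * w3 = m * G3"
    and h: "h = constS h1 * X ^ 2 + constS h2 * (X * Y) + constS h3 * Y ^ 2 + constS h4 * (X * Z)
      + constS h5 * (Y * Z) + constS h6 * Z ^ 2"
    and l: "l = lin a b c" "l' = lin a' b' c'"
    and x: "x1 = b * c' - c * b'" "x2 = c * a' - a * c'" "x3 = a * b' - b * a'"
    and hx: "h1 * x1 ^ 2 + h2 * (x1 * x2) + h3 * x2 ^ 2 + h4 * (x1 * x3) + h5 * (x2 * x3) + h6 * x3 ^ 2 \<noteq> 0"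
  shows "m_syzygy f 3 [3, 4, 4]"
proof -
  obtain e where e: "corrected u1 u2 u3 e \<in> AR f"
    "homog_triple 3 (corrected u1 u2 u3 e)"
    by (rule tangent_syzygy[OF u tu, where n = 3]) simp_all
  obtain e' where e': "corrected v1 v2 v3 e' \<in> AR f"
    "homog_triple 4 (corrected v1 v2 v3 e')"
    by (rule tangent_syzygy[OF v tv, where n = 4]) simp_all
  obtain e'' where e'': "corrected w1 w2 w3 e'' \<in> AR f"
    "homog_triple 4 (corrected w1 w2 w3 e'')"
    by (rule tangent_syzygy[OF w tw, where n = 4]) simp_all
  have f: "f \<noteq> 0" using nonzero by simp
  have det': "vdet euler_field (corrected u1 u2 u3 e)
     (corrected v1 v2 v3 e')
    = constS (det_m * \<tau> * k) * l' * f"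
    unfolding vdet_tangent det by (simp add: constS_hom mult_ac)
  have k': "det_m * \<tau> * k \<noteq> 0" using det_m_nonzero k \<kappa>\<tau> by auto
  \<comment> \<open>The same combination of the three syzygies is \<open>E\<close> times the Euler
    field. It annihilates \<open>f\<close>, so \<open>7 * E * f = 0\<close> and \<open>E\<close>
    vanishes.\<close>
  define E where "E = h * e + l * e' - l' * e''"
  have comb: "h * (G2 * u3 - G3 * u2 + e * X) + l * (G2 * v3 - G3 * v2 + e' * X) - l' * (G2 * w3 - G3 * w2 + e'' * X) = E * X"
    "h * (G3 * u1 - G1 * u3 + e * Y) + l * (G3 * v1 - G1 * v3 + e' * Y) - l' * (G3 * w1 - G1 * w3 + e'' * Y) = E * Y"
    "h * (G1 * u2 - G2 * u1 + e * Z) + l * (G1 * v2 - G2 * v1 + e' * Z) - l' * (G1 * w2 - G2 * w1 + e'' * Z) = E * Z"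
  proof -
    have *: "h * (g * u - g' * u' + e * p) + l * (g * v - g' * v' + e' * p) - l' * (g * w - g' * w' + e'' * p)
      = g * (h * u + l * v - l' * w) - g' * (h * u' + l * v' - l' * w') + E * p" for g g' u u' v v' w w' p
      unfolding E_def by (simp add: algebra_simps)
    show "h * (G2 * u3 - G3 * u2 + e * X) + l * (G2 * v3 - G3 * v2 + e' * X) - l' * (G2 * w3 - G3 * w2 + e'' * X) = E * X"
      "h * (G3 * u1 - G1 * u3 + e * Y) + l * (G3 * v1 - G1 * v3 + e' * Y) - l' * (G3 * w1 - G1 * w3 + e'' * Y) = E * Y"
      "h * (G1 * u2 - G2 * u1 + e * Z) + l * (G1 * v2 - G2 * v1 + e' * Z) - l' * (G1 * w2 - G2 * w1 + e'' * Z) = E * Z"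
      unfolding * rel by (simp_all add: mult_ac)
  qed
  have field_comb: "D (field (h * A + l * A' - l' * A'') (h * B + l * B' - l' * B'') (h * C + l * C' - l' * C'')) p
    = h * D (field A B C) p + l * D (field A' B' C') p - l' * D (field A'' B'' C'') p" for A A' A'' B B' B'' C C' C'' p
    by (simp add: field_def D.simps algebra_simps)
  have "D (field (E * X) (E * Y) (E * Z)) f = 0"
    unfolding comb[symmetric] field_comb using e e' e'' by (simp add: AR_iff_D)
  moreover have "D (field (E * X) (E * Y) (E * Z)) f = E * D (field X Y Z) f"
    using D_field_add[of 0 E X 0 Y 0 Z f] by (simp add: field_def D.simps)
  ultimately have "E * (constS 7 * f) = 0" by (simp add: field_XYZ euler)
  then have "E = 0" using f by simp
  note comb0 = comb[unfolded this mult_zero_left]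
  have lin_field: "h * (p * A + q * B + r * C) + l * (p * A' + q * B' + r * C') - l' * (p * A'' + q * B'' + r * C'') = 0"
    if "h * A + l * A' - l' * A'' = 0" "h * B + l * B' - l' * B'' = 0" "h * C + l * C' - l' * C'' = 0"
    for p q r A A' A'' B B' B'' C C' C'' :: S
  proof -
    have "h * (p * A + q * B + r * C) + l * (p * A' + q * B' + r * C') - l' * (p * A'' + q * B'' + r * C'')
      = p * (h * A + l * A' - l' * A'') + q * (h * B + l * B' - l' * B'') + r * (h * C + l * C' - l' * C'')"
      by (simp add: algebra_simps)
    then show ?thesis unfolding that by simp
  qed
  have nz: "x1 \<noteq> 0 \<or> x2 \<noteq> 0 \<or> x3 \<noteq> 0" using hx by auto
  have unit: "is_unit g" if "g dvd l" "g dvd l'" for g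
    using is_unit_common_divisor_lin[of g a b c a' b' c'] that nz unfolding l x by blast
  obtain \<pi> T where \<pi>: "unital_hom \<pi>" "\<And>k. \<pi> (constS k) = constS k" "T \<noteq> 0"
    "\<pi> X = constS x1 * T" "\<pi> Y = constS x2 * T" "\<pi> Z = constS x3 * T"
    "\<And>p. \<exists>s t. p - \<pi> p = s * lin a b c + t * lin a' b' c'"
    using ideal_lin_lin[OF x nz] by blast
  note \<pi>h = unital_homD[OF \<pi>(1)]
  have "\<pi> l = constS (a * x1 + b * x2 + c * x3) * T" "\<pi> l' = constS (a' * x1 + b' * x2 + c' * x3) * T"
    unfolding l lin_def by (simp_all add: \<pi>h \<pi> constS_hom algebra_simps)
  moreover have "a * x1 + b * x2 + c * x3 = 0" "a' * x1 + b' * x2 + c' * x3 = 0"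
    unfolding x by algebra+
  ultimately have \<pi>l: "\<pi> l = 0" "\<pi> l' = 0" by (simp_all add: constS_hom)
  show ?thesis
  proof (rule nearly_free_criterion[OF cop f euler _ e(1)[unfolded field_def] e'(1)[unfolded field_def]
        e''(1)[unfolded field_def] e(2)[unfolded field_def] e'(2)[unfolded field_def] e''(2)[unfolded field_def]
        _ det'[unfolded field_def] k' lin_field[OF comb0] lin_field[OF comb0] lin_field[OF comb0]])
    show "l' \<noteq> 0"
    proof
      assume "l' = 0"
      then have "lin a' b' c' = lin 0 0 0" by (simp add: l lin_def constS_hom)
      with nz show False unfolding x lin_eq_iff by simp
    qed
    show "l' dvd s" if "l * s = l' * t" for s t
    proof -
      have "coprime l' l" using unit by (intro coprimeI) auto
      moreover have "l' dvd l * s" unfolding that by simp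
      ultimately show ?thesis by (simp add: coprime_dvd_mult_right_iff)
    qed
    show "\<exists>t w. s = l * t + l' * w" if "h * s = l * t + l' * w" for s t w
    proof -
      \<comment> \<open>Modulo \<open>l\<close> and \<open>l'\<close> a polynomial equals its
        restriction to the line through \<open>x\<close>. There \<open>h\<close> becomes a nonzero
        multiple of \<open>T ^ 2\<close>, so it can be cancelled.\<close>
      have "\<pi> h * \<pi> s = 0" using arg_cong[OF that, of \<pi>] by (simp add: \<pi>h \<pi>l)
      moreover have "\<pi> h = constS (h1 * x1 ^ 2 + h2 * (x1 * x2) + h3 * x2 ^ 2 + h4 * (x1 * x3) + h5 * (x2 * x3) + h6 * x3 ^ 2) * T ^ 2"
        unfolding h \<pi>h \<pi>(2,4-6) constS_hom by algebra
      with hx \<pi>(3) have "\<pi> h \<noteq> 0" by simp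
      ultimately have "\<pi> s = 0" by simp
      with \<pi>(7)[of s] show ?thesis by (auto simp: l mult.commute)
    qed
    have xyz: "eval0 X = 0" "eval0 Y = 0" "eval0 Z = 0" by (rule eval0_homog[OF _ zero_less_one], rule homog_XYZ)+
    show "eval0 l = 0" "eval0 l' = 0" "eval0 h = 0"
      unfolding l lin_def h by (simp_all add: eval0_hom xyz)
  qed simp_all
qed

end

section \<open>The explicit syzygies\<close>

lemma homog_0_numeral: "homog 0 (numeral k)"
  using homog_gens(4)[of "numeral k"] by (simp only: constS_hom)

lemma homog_0_one: "homog 0 1"
  using homog_gens(4)[of 1] by (simp only: constS_hom)

lemma homog_0_mult: "homog 0 p \<Longrightarrow> homog 0 q \<Longrightarrow> homog 0 (p * q)"
  using homog_mult[of 0 p 0 q] by simp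

lemma homog_0_power: "homog 0 p \<Longrightarrow> homog 0 (p ^ n)"
  using homog_power[of 0 p n] by simp

lemma homog_1_mult: "homog 0 k \<Longrightarrow> homog 1 p \<Longrightarrow> homog 1 (k * p)"
  using homog_mult[of 0 k 1 p] by simp

lemma homog_2_mult: "homog 0 k \<Longrightarrow> homog 1 p \<Longrightarrow> homog 1 q \<Longrightarrow> homog 2 (k * (p * q))"
  using homog_mult[of 0 k "1 + 1" "p * q"] homog_mult[of 1 p 1 q] by (simp add: numeral_2_eq_2)

lemma homog_2_power: "homog 1 p \<Longrightarrow> homog 2 (p ^ 2)"
  using homog_power[of 1 p 2] by simp

lemma homog_2_const: "homog 2 p \<Longrightarrow> homog 0 k \<Longrightarrow> homog 2 (p * k)"
  using homog_mult[of 2 p 0 k] by simp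

lemmas homog_0 = homog_0_numeral homog_0_one homog_0_mult homog_0_power homog_gens(4)
lemmas homog_sums = homog_add homog_diff homog_minus

lemma D_numeral [simp]: "D r (numeral k) = 0"
  using D_constS[of r "numeral k"] by (simp add: constS_hom)

context linear_coords
begin

lemma nonzero_by_evaluation:
  assumes "\<And>\<pi>. unital_hom \<pi> \<Longrightarrow> (\<And>k. \<pi> (constS k) = k) \<Longrightarrow> \<pi> X = a \<Longrightarrow> \<pi> Y = b \<Longrightarrow> \<pi> Z = c \<Longrightarrow> \<pi> p \<noteq> (0::complex)"
  shows "p \<noteq> 0"
proof -
  obtain \<pi> where \<pi>: "unital_hom \<pi>" "\<And>k. \<pi> (constS k) = k" "\<pi> X = a" "\<pi> Y = b" "\<pi> Z = c"
    using eval_coords[of a b c] by metis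
  from assms[OF this] unital_homD(1)[OF \<pi>(1)] show ?thesis by auto
qed

text \<open>\<open>Z\<close> has absorbed the square of a cube root of -2, whence the
  \<open>1 / 4\<close>; the factor \<open>3 / 4\<close> clears this denominator in the gradient. The
  pairs \<open>(1, v)\<close>, \<open>(\<omega>, 1)\<close> and \<open>(\<omega>, \<omega>)\<close>
  for \<open>(w, v)\<close> serve the three cases below.\<close>

lemma cubic_conics_same:
  fixes w v :: complex
  shows "cubic_conics n11 n12 n13 n21 n22 n23 n31 n32 n33 m11 m12 m13 m21 m22 m23 m31 m32 m33
    (X ^ 3 + Y ^ 3 + constS (1 / 4) * Z ^ 3) ((X - Y) ^ 2 - Z ^ 2 - Z * (X + Y))
    ((X - constS w * Y) ^ 2 - constS v * Z ^ 2 - constS v ^ 2 * Z * (X + constS w * Y))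
    (4 * X ^ 2) (4 * Y ^ 2) (Z ^ 2) (2 * (X - Y) - Z) (- 2 * (X - Y) - Z) (- 2 * Z - (X + Y))
    (2 * (X - constS w * Y) - constS v ^ 2 * Z) (constS w * (- 2 * (X - constS w * Y) - constS v ^ 2 * Z))
    (- 2 * constS v * Z - constS v ^ 2 * (X + constS w * Y)) (3 / 4) 4"
proof (intro cubic_conics.intro cubic_conics_axioms.intro linear_coords_axioms)
  define q where "q = constS (1 / 4)"
  have q: "4 * q = 1" "constS (3 / 4) = 3 * q" unfolding q_def by (simp_all flip: constS_hom)
  note D_rules = D_add D_diff D_mult D_power D_field
  show "D (field A B C) (X ^ 3 + Y ^ 3 + constS (1 / 4) * Z ^ 3) = constS (3 / 4) * (4 * X\<^sup>2 * A + 4 * Y\<^sup>2 * B + Z\<^sup>2 * C)" for A B C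
    unfolding q(2) unfolding q_def[symmetric] using q(1) by (simp add: D_rules) (simp add: q_def D_rules, algebra)
  show "D (field A B C) ((X - Y) ^ 2 - Z ^ 2 - Z * (X + Y)) =
      (2 * (X - Y) - Z) * A + (- 2 * (X - Y) - Z) * B + (- 2 * Z - (X + Y)) * C" for A B C
    by (simp add: D_rules algebra_simps)
  show "D (field A B C) ((X - constS w * Y) ^ 2 - constS v * Z ^ 2 - constS v ^ 2 * Z * (X + constS w * Y)) =
      (2 * (X - constS w * Y) - constS v ^ 2 * Z) * A + constS w * (- 2 * (X - constS w * Y) - constS v ^ 2 * Z) * B
      + (- 2 * constS v * Z - constS v ^ 2 * (X + constS w * Y)) * C" for A B C
    by (simp add: D_rules algebra_simps)
  show "4 * X ^ 2 * X + 4 * Y ^ 2 * Y + Z ^ 2 * Z = constS 4 * (X ^ 3 + Y ^ 3 + constS (1 / 4) * Z ^ 3)"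
    unfolding q_def[symmetric] constS_hom using q(1) by algebra
  show "(2 * (X - Y) - Z) * X + (- 2 * (X - Y) - Z) * Y + (- 2 * Z - (X + Y)) * Z = 2 * ((X - Y) ^ 2 - Z ^ 2 - Z * (X + Y))"
    by algebra
  show "(2 * (X - constS w * Y) - constS v ^ 2 * Z) * X + constS w * (- 2 * (X - constS w * Y) - constS v ^ 2 * Z) * Y
      + (- 2 * constS v * Z - constS v ^ 2 * (X + constS w * Y)) * Z
    = 2 * ((X - constS w * Y) ^ 2 - constS v * Z ^ 2 - constS v ^ 2 * Z * (X + constS w * Y))"
    by algebra
  have k2: "homog 2 (k * x ^ 2)" if "homog 0 k" "homog 1 x" for k x
    using homog_2_const[OF homog_2_power[OF that(2)] that(1)] by (simp add: mult.commute)
  have k11: "homog 2 (x * y)" if "homog 1 x" "homog 1 y" for x y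
    using homog_mult[OF that] by (simp add: numeral_2_eq_2)
  have k111: "homog 2 (k * x * y)" if "homog 0 k" "homog 1 x" "homog 1 y" for k x y
    using homog_2_mult[OF that] by (simp add: mult.assoc)
  show "homog 2 (4 * X ^ 2)" "homog 2 (4 * Y ^ 2)" "homog 2 (Z ^ 2)"
    by (intro k2 homog_2_power homog_0 homog_XYZ)+
  show "homog 1 (2 * (X - Y) - Z)" "homog 1 (- 2 * (X - Y) - Z)" "homog 1 (- 2 * Z - (X + Y))"
    by (intro homog_sums homog_1_mult homog_0 homog_XYZ)+
  show "homog 1 (2 * (X - constS w * Y) - constS v ^ 2 * Z)"
    "homog 1 (constS w * (- 2 * (X - constS w * Y) - constS v ^ 2 * Z))"
    "homog 1 (- 2 * constS v * Z - constS v ^ 2 * (X + constS w * Y))"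
    by (intro homog_sums homog_1_mult homog_0 homog_XYZ)+
  have k3: "homog 3 (x ^ 3)" if "homog 1 x" for x
    using homog_power[OF that, of 3] by simp
  show "homog 3 (X ^ 3 + Y ^ 3 + constS (1 / 4) * Z ^ 3)"
    by (intro homog_add homog_constS_mult k3 homog_XYZ)
  show "homog 2 ((X - Y) ^ 2 - Z ^ 2 - Z * (X + Y))"
    by (intro homog_sums homog_2_power k11 homog_XYZ)
  show "homog 2 ((X - constS w * Y) ^ 2 - constS v * Z ^ 2 - constS v ^ 2 * Z * (X + constS w * Y))"
    by (intro homog_sums k2 k111 homog_2_power homog_1_mult homog_0 homog_XYZ)
  show "X ^ 3 + Y ^ 3 + constS (1 / 4) * Z ^ 3 \<noteq> 0"
    by (rule nonzero_by_evaluation[of 1 0 0]) (simp add: unital_homD)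
  show "(X - Y) ^ 2 - Z ^ 2 - Z * (X + Y) \<noteq> 0"
    by (rule nonzero_by_evaluation[of 1 0 0]) (simp add: unital_homD)
  show "(X - constS w * Y) ^ 2 - constS v * Z ^ 2 - constS v ^ 2 * Z * (X + constS w * Y) \<noteq> 0"
    by (rule nonzero_by_evaluation[of 1 0 0]) (simp add: unital_homD)
qed simp

theorem free_same:
  fixes v :: complex
  assumes v: "v ^ 2 + v + 1 = 0"
    and F: "F = X ^ 3 + Y ^ 3 + constS (1 / 4) * Z ^ 3" and Q: "Q = (X - Y) ^ 2 - Z ^ 2 - Z * (X + Y)"
    and Q': "Q' = (X - Y) ^ 2 - constS v * Z ^ 2 - constS v ^ 2 * Z * (X + Y)"
    and cop: "coprime_gradient (F * Q * Q')"
  shows "m_syzygy (F * Q * Q') 2 [3, 3]"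
proof -
  define V where "V = constS v"
  have V: "V ^ 2 + V + 1 = 0" using v unfolding V_def by (simp flip: constS_hom)
  interpret cubic_conics n11 n12 n13 n21 n22 n23 n31 n32 n33 m11 m12 m13 m21 m22 m23 m31 m32 m33
    F Q Q' "4 * X ^ 2" "4 * Y ^ 2" "Z ^ 2" "2 * (X - Y) - Z" "- 2 * (X - Y) - Z" "- 2 * Z - (X + Y)"
    "2 * (X - Y) - V ^ 2 * Z" "- 2 * (X - Y) - V ^ 2 * Z" "- 2 * V * Z - V ^ 2 * (X + Y)" "3 / 4" 4
    using cubic_conics_same[of 1 v] unfolding F Q Q' V_def by (simp add: constS_hom)
  \<comment> \<open>\<open>?v\<close> does not involve \<open>V\<close>: its field is tangent to all
    three conics of the triple. Only \<open>?u\<close> depends on the pair.\<close>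
  let ?G = "(4 * X ^ 2, 4 * Y ^ 2, Z ^ 2)" and ?P = "(2 * (X - Y) - Z, - 2 * (X - Y) - Z, - 2 * Z - (X + Y))"
    and ?P' = "(2 * (X - Y) - V ^ 2 * Z, - 2 * (X - Y) - V ^ 2 * Z, - 2 * V * Z - V ^ 2 * (X + Y))"
    and ?u = "(- 3 * X + 1 * Y + V * Z, 1 * X - 3 * Y + V * Z, (1 + V) * Z)" and ?v = "(- 2 * Z, 2 * Z, 1 * X - 1 * Y)"
  show ?thesis
  proof (rule free[OF cop])
    show "vdet ?G ?u ?v = constS 4 * Q * Q'"
      unfolding vdet.simps Q Q' constS_hom V_def[symmetric] using V by algebra
    show "vdet ?G ?u ?P
      = (- 4 * X ^ 2 + (4 * V - 4) * (X * Z) + 4 * Y ^ 2 + (4 - 4 * V) * (Y * Z)) * Q"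
      unfolding vdet.simps Q by algebra
    show "vdet ?G ?u ?P'
      = ((4 + 4 * V) * X ^ 2 + (4 - 4 * V) * (X * Z) - (4 + 4 * V) * Y ^ 2 + (4 * V - 4) * (Y * Z)) * Q'"
      unfolding vdet.simps Q' V_def[symmetric] using V by algebra
    show "vdet ?G ?v ?P
      = (8 * X ^ 2 + 4 * X * Z + 8 * Y ^ 2 + 4 * Y * Z - 4 * Z ^ 2) * Q"
      unfolding vdet.simps Q by algebra
    show "vdet ?G ?v ?P'
      = (8 * X ^ 2 - (4 + 4 * V) * X * Z + 8 * Y ^ 2 - (4 + 4 * V) * Y * Z - 4 * V * Z ^ 2) * Q'"
      unfolding vdet.simps Q' V_def[symmetric] using V by algebra
    have "homog 0 V" by (simp add: V_def)
    then show "homog 1 (- 3 * X + 1 * Y + V * Z)" "homog 1 (1 * X - 3 * Y + V * Z)" "homog 1 ((1 + V) * Z)"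
      "homog 1 (- 2 * Z)" "homog 1 (2 * Z)" "homog 1 (1 * X - 1 * Y)"
      by (intro homog_sums homog_1_mult homog_0 homog_XYZ; assumption)+
  qed simp
qed

end

context linear_coords
begin

text \<open>For a sextactic point \<open>p\<close> of \<open>F\<close> with hyperosculating conic \<open>Q\<close>, the constant vector
  \<open>b = grad F(p)\<close> satisfies \<open>det(grad F, b, grad Q) \<in> (Q)\<close>. So two of the three vectors can often be
  taken to be multiples of such constants by the other conic; the remaining ones solve the linear
  systems \<open>det(grad F, u, grad Q) \<in> (Q)\<close>, \<open>det(grad F, u, grad Q') \<in> (Q')\<close>.\<close>

theorem nearly_free_same_1:
  fixes \<omega> :: complex
  assumes \<omega>: "\<omega> ^ 2 + \<omega> + 1 = 0"
    and F: "F = X ^ 3 + Y ^ 3 + constS (1 / 4) * Z ^ 3" and Q: "Q = (X - Y) ^ 2 - Z ^ 2 - Z * (X + Y)"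
    and Q': "Q' = (X - constS \<omega> * Y) ^ 2 - Z ^ 2 - Z * (X + constS \<omega> * Y)"
    and cop: "coprime_gradient (F * Q * Q')"
  shows "m_syzygy (F * Q * Q') 3 [3, 4, 4]"
proof -
  define w where "w = constS \<omega>"
  have w: "w ^ 2 + w + 1 = 0" using \<omega> unfolding w_def by (simp flip: constS_hom)
  interpret cubic_conics n11 n12 n13 n21 n22 n23 n31 n32 n33 m11 m12 m13 m21 m22 m23 m31 m32 m33
    F Q Q' "4 * X ^ 2" "4 * Y ^ 2" "Z ^ 2" "2 * (X - Y) - Z" "- 2 * (X - Y) - Z" "- 2 * Z - (X + Y)"
    "2 * (X - w * Y) - Z" "w * (- 2 * (X - w * Y) - Z)"
    "- 2 * Z - (X + w * Y)" "3 / 4" 4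
    using cubic_conics_same[of \<omega> 1] unfolding F Q Q' w_def by (simp add: constS_hom)
  note Q' = Q'[unfolded constS_hom, folded w_def]
  let ?G = "(4 * X ^ 2, 4 * Y ^ 2, Z ^ 2)" and ?P = "(2 * (X - Y) - Z, - 2 * (X - Y) - Z, - 2 * Z - (X + Y))"
    and ?P' = "(2 * (X - w * Y) - Z, w * (- 2 * (X - w * Y) - Z), - 2 * Z - (X + w * Y))"
  define u1 :: S where "u1 = 4 * w * X + 4 * Y - 4 * w * Z"
  define u2 :: S where "u2 = (4 + 4 * w) * Y"
  define u3 :: S where "u3 = 2 * w * X + 4 * Y - 3 * w * Z"
  \<comment> \<open>In this case \<open>v\<close> and \<open>w\<close> are quadratic solutions of
    the tangency systems that are not constant vectors multiplied by a conic.\<close>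
  define v1 :: S where "v1 = 2 * w * (X * Y) + 1 * (Y * Y) + w * (Y * Z)"
  define v2 :: S where "v2 = w * (X * X) - w * (X * Z) + (1 + w) * (Y * Y) - w * (Z * Z)"
  define v3 :: S where "v3 = 2 * w * (X * Y) + 1 * (Y * Y) + w * (Y * Z)"
  define w1 :: S where "w1 = 2 * (X * Y) + 4 * w * (X * Z) + (1 + w) * (Y * Y) + 3 * (Y * Z) + 4 * w * (Z * Z)"
  define w2 :: S where "w2 = - 1 * (X * X) + (4 + 4 * w) * (X * Y) + 1 * (X * Z) - 3 * w * (Y * Y) + 1 * (Z * Z)"
  define w3 :: S where "w3 = w * (X * X) + 1 * (X * Y) - w * (X * Z) + (2 + 2 * w) * (Y * Y) + 1 * (Y * Z)"
  note uvw = u1_def u2_def u3_def v1_def v2_def v3_def w1_def w2_def w3_def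
  define m :: S where "m = - 1 * X + 3 * Z"
  define h1 :: complex where "h1 = 1 + \<omega>"
  define h2 :: complex where "h2 = - \<omega>"
  define h3 :: complex where "h3 = - 1"
  define h4 :: complex where "h4 = 0"
  define h5 :: complex where "h5 = - 2 * \<omega>"
  define h6 :: complex where "h6 = 1 + \<omega>"
  note h_defs = h1_def h2_def h3_def h4_def h5_def h6_def
  define a :: complex where "a = 2 * \<omega>"
  define b :: complex where "b = 4"
  define e :: complex where "e = - \<omega>"
  define a' :: complex where "a' = 2 + 2 * \<omega>"
  define b' :: complex where "b' = 0"
  define e' :: complex where "e' = - 1 - \<omega>"
  note l_defs = a_def b_def e_def a'_def b'_def e'_def
  define x1 :: complex where "x1 = - 4 - 4 * \<omega>"
  define x2 :: complex where "x2 = 0"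
  define x3 :: complex where "x3 = - 8 - 8 * \<omega>"
  have x: "x1 = b * e' - e * b'" "x2 = e * a' - a * e'" "x3 = a * b' - b * a'"
    unfolding x1_def x2_def x3_def l_defs by (algebra | use \<omega> in algebra)+
  have "(h1 * x1 ^ 2 + h2 * (x1 * x2) + h3 * x2 ^ 2 + h4 * (x1 * x3) + h5 * (x2 * x3) + h6 * x3 ^ 2) * (- 1) = 80"
    unfolding h_defs x1_def x2_def x3_def using \<omega> by (simp only: mult_zero_left mult_zero_right power_zero_numeral) algebra
  then have hx: "h1 * x1 ^ 2 + h2 * (x1 * x2) + h3 * x2 ^ 2 + h4 * (x1 * x3) + h5 * (x2 * x3) + h6 * x3 ^ 2 \<noteq> 0" by (metis mult_zero_left zero_neq_numeral)
  have tu0: "vdet ?G (u1, u2, u3) ?P = (16 * w * (X * X) + 16 * (X * Y) - 16 * (Y * Y) + 8 * w * (Y * Z) - 4 * w * (Z * Z)) * Q"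
    and tu1: "vdet ?G (u1, u2, u3) ?P' = (- (16 + 16 * w) * (X * X) + 16 * w * (X * Y) + (16 + 16 * w) * (Y * Y) + 8 * (Y * Z) + (4 + 4 * w) * (Z * Z)) * Q'"
    and tv0: "vdet ?G (v1, v2, v3) ?P = (- 4 * w * (X * X * X) + 4 * w * (X * X * Y) - 8 * w * (X * X * Z) + (4 - 8 * w) * (X * Y * Y) + 4 * w * (X * Y * Z) - 2 * w * (X * Z * Z) - 4 * (Y * Y * Y) - 4 * w * (Y * Y * Z) + 2 * w * (Y * Z * Z) + w * (Z * Z * Z)) * Q"
    and tv1: "vdet ?G (v1, v2, v3) ?P' = (- 4 * w * (X * X * X) - (4 + 4 * w) * (X * X * Y) - 8 * w * (X * X * Z) - (8 - 4 * w) * (X * Y * Y) - (4 + 4 * w) * (X * Y * Z) - 2 * w * (X * Z * Z) + (4 + 4 * w) * (Y * Y * Y) - 4 * (Y * Y * Z) - (2 + 2 * w) * (Y * Z * Z) + w * (Z * Z * Z)) * Q'"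
    and tw0: "vdet ?G (w1, w2, w3) ?P = ((4 + 8 * w) * (X * X * X) + (4 - 8 * w) * (X * X * Y) + (8 + 4 * w) * (X * X * Z) - (4 + 4 * w) * (X * Y * Y) - 16 * w * (X * Y * Z) + (2 + 8 * w) * (X * Z * Z) - (12 + 12 * w) * (Y * Y * Y) - (8 + 12 * w) * (Y * Y * Z) + (2 - 12 * w) * (Y * Z * Z) - (1 - 4 * w) * (Z * Z * Z)) * Q"
    and tw1: "vdet ?G (w1, w2, w3) ?P' = (- (4 + 8 * w) * (X * X * X) - (8 - 4 * w) * (X * X * Y) + (4 - 4 * w) * (X * X * Z) + 4 * (X * Y * Y) - 16 * (X * Y * Z) - (6 + 8 * w) * (X * Z * Z) + 12 * w * (Y * Y * Y) + (8 - 4 * w) * (Y * Y * Z) - (12 - 2 * w) * (Y * Z * Z) - (5 + 4 * w) * (Z * Z * Z)) * Q'"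
    unfolding uvw vdet.simps Q Q' by (algebra | use w in algebra)+
  have l: "lin a b e = 2 * w * X + 4 * Y - w * Z" and l': "lin a' b' e' = (2 + 2 * w) * X - (1 + w) * Z"
    unfolding lin_def l_defs constS_hom w_def[symmetric] by algebra+
  have det: "vdet ?G (u1, u2, u3) (v1, v2, v3) = constS 4 * lin a' b' e' * Q * Q'"
    unfolding l' uvw vdet.simps Q Q' constS_hom by (algebra | use w in algebra)
  define h where "h = constS h1 * X ^ 2 + constS h2 * (X * Y) + constS h3 * Y ^ 2 + constS h4 * (X * Z)
    + constS h5 * (Y * Z) + constS h6 * Z ^ 2"
  have rel: "h * u1 + lin a b e * v1 - lin a' b' e' * w1 = m * (4 * X ^ 2)" "h * u2 + lin a b e * v2 - lin a' b' e' * w2 = m * (4 * Y ^ 2)" "h * u3 + lin a b e * v3 - lin a' b' e' * w3 = m * (Z ^ 2)"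
    unfolding l l' uvw h_def m_def h_defs Q Q' constS_hom w_def[symmetric] by (algebra | use w in algebra)+
  have const: "homog 0 w"
    by (simp_all add: w_def)
  have homog_u: "homog 1 u1" "homog 1 u2" "homog 1 u3"
    unfolding uvw by (intro homog_sums homog_1_mult homog_0 const homog_XYZ)+
  have homog_vw: "homog 2 v1" "homog 2 v2" "homog 2 v3" "homog 2 w1" "homog 2 w2" "homog 2 w3"
    unfolding uvw by (intro homog_sums homog_2_mult homog_0 const homog_XYZ)+
  show ?thesis
    by (rule nearly_free[OF cop homog_u homog_vw tu0 tu1 tv0 tv1 tw0 tw1 det _ rel h_def _ _ x hx]) simp_all
qed

theorem nearly_free_same_w:
  fixes \<omega> :: complex
  assumes \<omega>: "\<omega> ^ 2 + \<omega> + 1 = 0"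
    and F: "F = X ^ 3 + Y ^ 3 + constS (1 / 4) * Z ^ 3" and Q: "Q = (X - Y) ^ 2 - Z ^ 2 - Z * (X + Y)"
    and Q': "Q' = (X - constS \<omega> * Y) ^ 2 - constS \<omega> * Z ^ 2 - constS \<omega> ^ 2 * Z * (X + constS \<omega> * Y)"
    and cop: "coprime_gradient (F * Q * Q')"
  shows "m_syzygy (F * Q * Q') 3 [3, 4, 4]"
proof -
  define w where "w = constS \<omega>"
  have w: "w ^ 2 + w + 1 = 0" using \<omega> unfolding w_def by (simp flip: constS_hom)
  interpret cubic_conics n11 n12 n13 n21 n22 n23 n31 n32 n33 m11 m12 m13 m21 m22 m23 m31 m32 m33
    F Q Q' "4 * X ^ 2" "4 * Y ^ 2" "Z ^ 2" "2 * (X - Y) - Z" "- 2 * (X - Y) - Z" "- 2 * Z - (X + Y)"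
    "2 * (X - w * Y) - w ^ 2 * Z" "w * (- 2 * (X - w * Y) - w ^ 2 * Z)"
    "- 2 * w * Z - w ^ 2 * (X + w * Y)" "3 / 4" 4
    using cubic_conics_same[of \<omega> \<omega>] unfolding F Q Q' w_def by (simp add: constS_hom)
  note Q' = Q'[unfolded constS_hom, folded w_def]
  let ?G = "(4 * X ^ 2, 4 * Y ^ 2, Z ^ 2)" and ?P = "(2 * (X - Y) - Z, - 2 * (X - Y) - Z, - 2 * Z - (X + Y))"
    and ?P' = "(2 * (X - w * Y) - w ^ 2 * Z, w * (- 2 * (X - w * Y) - w ^ 2 * Z), - 2 * w * Z - w ^ 2 * (X + w * Y))"
  define u1 :: S where "u1 = - 4 * Y + (12 + 12 * w) * Z"
  define u2 :: S where "u2 = - 4 * X - 12 * w * Z"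
  define u3 :: S where "u3 = - (6 + 6 * w) * X + 6 * w * Y + 5 * Z"
  \<comment> \<open>\<open>(1, w, w^2)\<close> is, up to a scalar, the gradient of the cubic at the
    contact point \<open>(1 : w^2 : - 2 w)\<close> of \<open>Q'\<close>, and
    \<open>(1, 1, 1)\<close> below the one at the contact point \<open>(1 : 1 : - 2)\<close> of
    \<open>Q\<close>. The factor \<open>Q\<close> or \<open>Q'\<close> makes the field tangent to
    the other conic too.\<close>
  define v1 :: S where "v1 = Q * 1"
  define v2 :: S where "v2 = Q * w"
  define v3 :: S where "v3 = Q * w ^ 2"
  define w1 :: S where "w1 = Q' * 1"
  define w2 :: S where "w2 = Q' * 1"
  define w3 :: S where "w3 = Q' * 1"
  note uvw = u1_def u2_def u3_def v1_def v2_def v3_def w1_def w2_def w3_def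
  define m :: S where "m = (4 + 2 * w) * X - (2 + 4 * w) * Y + (19 - 19 * w) * Z"
  define h1 :: complex where "h1 = - 4 - 8 * \<omega>"
  define h2 :: complex where "h2 = 0"
  define h3 :: complex where "h3 = 8 + 4 * \<omega>"
  define h4 :: complex where "h4 = 0"
  define h5 :: complex where "h5 = 0"
  define h6 :: complex where "h6 = - 1 + \<omega>"
  note h_defs = h1_def h2_def h3_def h4_def h5_def h6_def
  define a :: complex where "a = 8 + 24 * \<omega>"
  define b :: complex where "b = 16 + 24 * \<omega>"
  define e :: complex where "e = - 12 - 24 * \<omega>"
  define a' :: complex where "a' = - 8 + 16 * \<omega>"
  define b' :: complex where "b' = - 8 - 24 * \<omega>"
  define e' :: complex where "e' = - 24 - 12 * \<omega>"
  note l_defs = a_def b_def e_def a'_def b'_def e'_def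
  define x1 :: complex where "x1 = 384 - 384 * \<omega>"
  define x2 :: complex where "x2 = 384 + 768 * \<omega>"
  define x3 :: complex where "x3 = 1024 + 512 * \<omega>"
  have x: "x1 = b * e' - e * b'" "x2 = e * a' - a * e'" "x3 = a * b' - b * a'"
    unfolding x1_def x2_def x3_def l_defs by (algebra | use \<omega> in algebra)+
  have "(h1 * x1 ^ 2 + h2 * (x1 * x2) + h3 * x2 ^ 2 + h4 * (x1 * x3) + h5 * (x2 * x3) + h6 * x3 ^ 2) * (- 1 + \<omega>) = 12976128"
    unfolding h_defs x1_def x2_def x3_def by (algebra | use \<omega> in algebra)
  then have hx: "h1 * x1 ^ 2 + h2 * (x1 * x2) + h3 * x2 ^ 2 + h4 * (x1 * x3) + h5 * (x2 * x3) + h6 * x3 ^ 2 \<noteq> 0" by (metis mult_zero_left zero_neq_numeral)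
  have tu0: "vdet ?G (u1, u2, u3) ?P = (- (32 + 48 * w) * (X * X) + (16 - 24 * w) * (X * Z) - (16 + 48 * w) * (Y * Y) - (40 + 24 * w) * (Y * Z) + (12 + 24 * w) * (Z * Z)) * Q"
    and tu1: "vdet ?G (u1, u2, u3) ?P' = ((32 - 16 * w) * (X * X) - (24 - 16 * w) * (X * Z) - (48 + 16 * w) * (Y * Y) + (40 + 16 * w) * (Y * Z) - (12 + 24 * w) * (Z * Z)) * Q'"
    and tv0: "vdet ?G (v1, v2, v3) ?P = (vdet ?G (1, w, w ^ 2) ?P) * Q"
    and tv1: "vdet ?G (v1, v2, v3) ?P' = ((4 * X - 4 * w * Y) * Q) * Q'"
    and tw0: "vdet ?G (w1, w2, w3) ?P = ((4 * X - 4 * Y) * Q') * Q"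
    and tw1: "vdet ?G (w1, w2, w3) ?P' = (vdet ?G (1, 1, 1) ?P') * Q'"
    unfolding uvw vdet.simps Q Q' by (algebra | use w in algebra)+
  have l: "lin a b e = (8 + 24 * w) * X + (16 + 24 * w) * Y - (12 + 24 * w) * Z" and l': "lin a' b' e' = - (8 - 16 * w) * X - (8 + 24 * w) * Y - (24 + 12 * w) * Z"
    unfolding lin_def l_defs constS_hom w_def[symmetric] by algebra+
  have det: "vdet ?G (u1, u2, u3) (v1, v2, v3) = constS 1 * lin a' b' e' * Q * Q'"
    unfolding l' uvw vdet.simps Q Q' constS_hom by (algebra | use w in algebra)
  define h where "h = constS h1 * X ^ 2 + constS h2 * (X * Y) + constS h3 * Y ^ 2 + constS h4 * (X * Z)
    + constS h5 * (Y * Z) + constS h6 * Z ^ 2"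
  have rel: "h * u1 + lin a b e * v1 - lin a' b' e' * w1 = m * (4 * X ^ 2)" "h * u2 + lin a b e * v2 - lin a' b' e' * w2 = m * (4 * Y ^ 2)" "h * u3 + lin a b e * v3 - lin a' b' e' * w3 = m * (Z ^ 2)"
    unfolding l l' uvw h_def m_def h_defs Q Q' constS_hom w_def[symmetric] by (algebra | use w in algebra)+
  have const: "homog 0 w"
    by (simp_all add: w_def)
  have homog_u: "homog 1 u1" "homog 1 u2" "homog 1 u3"
    unfolding uvw by (intro homog_sums homog_1_mult homog_0 const homog_XYZ)+
  have homog_vw: "homog 2 v1" "homog 2 v2" "homog 2 v3" "homog 2 w1" "homog 2 w2" "homog 2 w3"
    unfolding uvw by (intro homog_2_const homog_FQ homog_0 const)+
  show ?thesis
    by (rule nearly_free[OF cop homog_u homog_vw tu0 tu1 tv0 tv1 tw0 tw1 det _ rel h_def _ _ x hx]) simp_all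
qed

lemma cubic_conics_next:
  shows "cubic_conics n11 n12 n13 n21 n22 n23 n31 n32 n33 m11 m12 m13 m21 m22 m23 m31 m32 m33
    (X ^ 3 + Y ^ 3 + Z ^ 3) ((X - Y) ^ 2 + 2 * constS c * Z ^ 2 - constS c ^ 2 * Z * (X + Y))
    ((Y - Z) ^ 2 + 2 * constS d * X ^ 2 - constS d ^ 2 * X * (Y + Z)) (X ^ 2) (Y ^ 2) (Z ^ 2)
    (2 * (X - Y) - constS c ^ 2 * Z) (- 2 * (X - Y) - constS c ^ 2 * Z) (4 * constS c * Z - constS c ^ 2 * (X + Y))
    (4 * constS d * X - constS d ^ 2 * (Y + Z)) (2 * (Y - Z) - constS d ^ 2 * X) (- 2 * (Y - Z) - constS d ^ 2 * X) 3 1"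
proof (intro cubic_conics.intro cubic_conics_axioms.intro linear_coords_axioms)
  note D_rules = D_add D_diff D_mult D_power D_field
  show "D (field A B C) (X ^ 3 + Y ^ 3 + Z ^ 3) = constS 3 * (X\<^sup>2 * A + Y\<^sup>2 * B + Z\<^sup>2 * C)" for A B C
    by (simp add: D_rules constS_hom algebra_simps)
  show "D (field A B C) ((X - Y) ^ 2 + 2 * constS c * Z ^ 2 - constS c ^ 2 * Z * (X + Y)) =
      (2 * (X - Y) - constS c ^ 2 * Z) * A + (- 2 * (X - Y) - constS c ^ 2 * Z) * B
      + (4 * constS c * Z - constS c ^ 2 * (X + Y)) * C" for A B C
    by (simp add: D_rules algebra_simps)
  show "D (field A B C) ((Y - Z) ^ 2 + 2 * constS d * X ^ 2 - constS d ^ 2 * X * (Y + Z)) =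
      (4 * constS d * X - constS d ^ 2 * (Y + Z)) * A + (2 * (Y - Z) - constS d ^ 2 * X) * B
      + (- 2 * (Y - Z) - constS d ^ 2 * X) * C" for A B C
    by (simp add: D_rules algebra_simps)
  show "X ^ 2 * X + Y ^ 2 * Y + Z ^ 2 * Z = constS 1 * (X ^ 3 + Y ^ 3 + Z ^ 3)"
    unfolding constS_hom by algebra
  show "(2 * (X - Y) - constS c ^ 2 * Z) * X + (- 2 * (X - Y) - constS c ^ 2 * Z) * Y
      + (4 * constS c * Z - constS c ^ 2 * (X + Y)) * Z
    = 2 * ((X - Y) ^ 2 + 2 * constS c * Z ^ 2 - constS c ^ 2 * Z * (X + Y))"
    by algebra
  show "(4 * constS d * X - constS d ^ 2 * (Y + Z)) * X + (2 * (Y - Z) - constS d ^ 2 * X) * Y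
      + (- 2 * (Y - Z) - constS d ^ 2 * X) * Z
    = 2 * ((Y - Z) ^ 2 + 2 * constS d * X ^ 2 - constS d ^ 2 * X * (Y + Z))"
    by algebra
  have k2: "homog 2 (k * x ^ 2)" if "homog 0 k" "homog 1 x" for k x
    using homog_2_const[OF homog_2_power[OF that(2)] that(1)] by (simp add: mult.commute)
  have k111: "homog 2 (k * x * y)" if "homog 0 k" "homog 1 x" "homog 1 y" for k x y
    using homog_2_mult[OF that] by (simp add: mult.assoc)
  show "homog 2 (X ^ 2)" "homog 2 (Y ^ 2)" "homog 2 (Z ^ 2)"
    by (intro homog_2_power homog_XYZ)+
  show "homog 1 (2 * (X - Y) - constS c ^ 2 * Z)" "homog 1 (- 2 * (X - Y) - constS c ^ 2 * Z)"
    "homog 1 (4 * constS c * Z - constS c ^ 2 * (X + Y))" "homog 1 (4 * constS d * X - constS d ^ 2 * (Y + Z))"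
    "homog 1 (2 * (Y - Z) - constS d ^ 2 * X)" "homog 1 (- 2 * (Y - Z) - constS d ^ 2 * X)"
    by (intro homog_sums homog_1_mult homog_0 homog_XYZ)+
  show "homog 3 (X ^ 3 + Y ^ 3 + Z ^ 3)"
    using homog_power[OF homog_XYZ(1), of 3] homog_power[OF homog_XYZ(2), of 3] homog_power[OF homog_XYZ(3), of 3]
    by (simp add: homog_add)
  show "homog 2 ((X - Y) ^ 2 + 2 * constS c * Z ^ 2 - constS c ^ 2 * Z * (X + Y))"
    "homog 2 ((Y - Z) ^ 2 + 2 * constS d * X ^ 2 - constS d ^ 2 * X * (Y + Z))"
    by (intro homog_sums k2 k111 homog_2_power homog_1_mult homog_0 homog_XYZ)+
  show "X ^ 3 + Y ^ 3 + Z ^ 3 \<noteq> 0"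
    by (rule nonzero_by_evaluation[of 1 0 0]) (simp add: unital_homD)
  show "(X - Y) ^ 2 + 2 * constS c * Z ^ 2 - constS c ^ 2 * Z * (X + Y) \<noteq> 0"
    by (rule nonzero_by_evaluation[of 1 0 0]) (simp add: unital_homD)
  show "(Y - Z) ^ 2 + 2 * constS d * X ^ 2 - constS d ^ 2 * X * (Y + Z) \<noteq> 0"
    by (rule nonzero_by_evaluation[of 0 1 0]) (simp add: unital_homD)
qed simp

theorem nearly_free_next:
  fixes \<gamma> \<delta> :: complex
  assumes \<gamma>: "\<gamma> ^ 3 = -2" and \<delta>: "\<delta> ^ 3 = -2"
    and F: "F = X ^ 3 + Y ^ 3 + Z ^ 3" and Q: "Q = conic X Y Z \<gamma>" and Q': "Q' = conic Y Z X \<delta>"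
    and cop: "coprime_gradient (F * Q * Q')"
  shows "m_syzygy (F * Q * Q') 3 [3, 4, 4]"
proof -
  define c where "c = constS \<gamma>"
  define d where "d = constS \<delta>"
  have c: "c ^ 3 = -2" and d: "d ^ 3 = -2" using \<gamma> \<delta> unfolding c_def d_def by (simp_all flip: constS_hom)
  note Q = Q[unfolded conic_def, folded c_def] and Q' = Q'[unfolded conic_def, folded d_def]
  interpret cubic_conics n11 n12 n13 n21 n22 n23 n31 n32 n33 m11 m12 m13 m21 m22 m23 m31 m32 m33
    F Q Q' "X ^ 2" "Y ^ 2" "Z ^ 2" "2 * (X - Y) - c ^ 2 * Z" "- 2 * (X - Y) - c ^ 2 * Z"
    "4 * c * Z - c ^ 2 * (X + Y)" "4 * d * X - d ^ 2 * (Y + Z)"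
    "2 * (Y - Z) - d ^ 2 * X" "- 2 * (Y - Z) - d ^ 2 * X" 3 1
    using cubic_conics_next[of \<gamma> \<delta>] unfolding F Q Q' c_def d_def .
  let ?G = "(X ^ 2, Y ^ 2, Z ^ 2)" and ?P = "(2 * (X - Y) - c ^ 2 * Z, - 2 * (X - Y) - c ^ 2 * Z, 4 * c * Z - c ^ 2 * (X + Y))"
    and ?P' = "(4 * d * X - d ^ 2 * (Y + Z), 2 * (Y - Z) - d ^ 2 * X, - 2 * (Y - Z) - d ^ 2 * X)"
  \<comment> \<open>The coefficients are expanded in the monomials \<open>c^i d^j\<close> with
    \<open>i, j < 3\<close>. Only \<open>c^3 = d^3 = -2\<close> enters the identities.\<close>
  define u1 :: S where "u1 = - (4 + d + 6 * d^2 - 10 * c + 3 * c * d + 5 * c * d^2 - 3 * c^2 - 3 * c^2 * d + c^2 * d^2) * X + (d + 4 * d^2 - 6 * c + 2 * c * d^2 - c^2 - 3 * c^2 * d - c^2 * d^2) * Y - (4 - 3 * d + d^2 - 4 * c + 2 * c * d - c * d^2 + 3 * c^2 - 2 * c^2 * d - 2 * c^2 * d^2) * Z"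
  define u2 :: S where "u2 = - (4 - 3 * d + c * d - 3 * c * d^2 - c^2) * X - (3 * d + 2 * d^2 - 4 * c + 2 * c * d + 6 * c * d^2 - c^2 + 2 * c^2 * d^2) * Y + (3 * d - d^2 + 3 * c * d^2 + c^2 + 2 * c^2 * d) * Z"
  define u3 :: S where "u3 = - (4 - 3 * d + 2 * d^2 + 4 * c + c * d - c * d^2 + 3 * c^2 - 2 * c^2 * d + 2 * c^2 * d^2) * X + (6 + d + 2 * c + 4 * c * d + 2 * c * d^2 - c^2 + 3 * c^2 * d^2) * Y - (6 + d + 3 * d^2 - 2 * c + 6 * c * d + 5 * c * d^2 - 3 * c^2 - 2 * c^2 * d + 5 * c^2 * d^2) * Z"
  \<comment> \<open>The constant vectors are the gradients at the contact points
    \<open>(d : 1 : 1)\<close> of \<open>Q'\<close> and, for \<open>w\<close>,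
    \<open>(1 : 1 : c)\<close> of \<open>Q\<close>.\<close>
  define v1 :: S where "v1 = Q * d ^ 2"
  define v2 :: S where "v2 = Q * 1"
  define v3 :: S where "v3 = Q * 1"
  define w1 :: S where "w1 = Q' * 1"
  define w2 :: S where "w2 = Q' * 1"
  define w3 :: S where "w3 = Q' * c ^ 2"
  note uvw = u1_def u2_def u3_def v1_def v2_def v3_def w1_def w2_def w3_def
  define m :: S where "m = (18 + d - 14 * d^2 + 10 * c + 5 * c * d - 7 * c * d^2 + c^2 + 2 * c^2 * d + 2 * c^2 * d^2) * X - (12 + 19 * d + 4 * d^2 + 2 * c + 4 * c * d - 4 * c * d^2 - 3 * c^2 - 6 * c^2 * d - c^2 * d^2) * Y - (4 - d - 5 * d^2 + 4 * c + 14 * c * d + 7 * c * d^2 - c^2 + 9 * c^2 * d + 5 * c^2 * d^2) * Z"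
  define h1 :: complex where "h1 = 1 - \<gamma>^2"
  define h2 :: complex where "h2 = 0"
  define h3 :: complex where "h3 = - 1 + \<gamma>^2 * \<delta>^2"
  define h4 :: complex where "h4 = 0"
  define h5 :: complex where "h5 = 0"
  define h6 :: complex where "h6 = 1 - \<delta>^2"
  note h_defs = h1_def h2_def h3_def h4_def h5_def h6_def
  define a :: complex where "a = 4 - \<delta> - 4 * \<delta>^2 + 2 * \<gamma> + \<gamma> * \<delta> - \<gamma> * \<delta>^2 - \<gamma>^2 + \<gamma>^2 * \<delta> + 2 * \<gamma>^2 * \<delta>^2"
  define b :: complex where "b = - 6 + \<delta> + 4 * \<delta>^2 - 2 * \<gamma> * \<delta> - \<gamma>^2 - \<gamma>^2 * \<delta> - \<gamma>^2 * \<delta>^2"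
  define e :: complex where "e = 2 - \<delta> - \<delta>^2 - 2 * \<gamma> + \<gamma> * \<delta>^2 + \<gamma>^2"
  define a' :: complex where "a' = \<delta> + \<gamma> * \<delta> - \<gamma> * \<delta>^2 - \<gamma>^2 + \<gamma>^2 * \<delta> - \<gamma>^2 * \<delta>^2"
  define b' :: complex where "b' = - 2 - \<delta> + 2 * \<delta>^2 - 2 * \<gamma> - 4 * \<gamma> * \<delta> + \<gamma>^2 - 3 * \<gamma>^2 * \<delta>"
  define e' :: complex where "e' = 2 + \<delta> - \<delta>^2 + 4 * \<gamma> + 4 * \<gamma> * \<delta> + \<gamma> * \<delta>^2 + \<gamma>^2 + 2 * \<gamma>^2 * \<delta> + \<gamma>^2 * \<delta>^2"
  note l_defs = a_def b_def e_def a'_def b'_def e'_def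
  define x1 :: complex where "x1 = - 32 + 20 * \<delta> + 36 * \<delta>^2 - 64 * \<gamma> - 28 * \<gamma> * \<delta> + 20 * \<gamma> * \<delta>^2 - 28 * \<gamma>^2 - 32 * \<gamma>^2 * \<delta> - 12 * \<gamma>^2 * \<delta>^2"
  define x2 :: complex where "x2 = - 48 + 12 * \<delta> + 40 * \<delta>^2 - 80 * \<gamma> - 36 * \<gamma> * \<delta> + 24 * \<gamma> * \<delta>^2 - 36 * \<gamma>^2 - 32 * \<gamma>^2 * \<delta> - 6 * \<gamma>^2 * \<delta>^2"
  define x3 :: complex where "x3 = - 40 + 24 * \<delta> + 36 * \<delta>^2 - 64 * \<gamma> - 28 * \<gamma> * \<delta> + 16 * \<gamma> * \<delta>^2 - 28 * \<gamma>^2 - 32 * \<gamma>^2 * \<delta> - 10 * \<gamma>^2 * \<delta>^2"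
  have x: "x1 = b * e' - e * b'" "x2 = e * a' - a * e'" "x3 = a * b' - b * a'"
    unfolding x1_def x2_def x3_def l_defs by (algebra | use \<gamma> \<delta> in algebra)+
  \<comment> \<open>The second factor is, up to an integer, an inverse of the value of
    \<open>h\<close> at \<open>x\<close> modulo the equations of \<open>\<gamma>\<close> and
    \<open>\<delta>\<close>; it certifies that the value is nonzero.\<close>
  have "(h1 * x1 ^ 2 + h2 * (x1 * x2) + h3 * x2 ^ 2 + h4 * (x1 * x3) + h5 * (x2 * x3) + h6 * x3 ^ 2) * (- 452668 + 266520 * \<delta> - 305940 * \<delta>^2 + 334071 * \<gamma> - 191331 * \<gamma> * \<delta> + 226334 * \<gamma> * \<delta>^2 - 191331 * \<gamma>^2 + 92750 * \<gamma>^2 * \<delta> - 133260 * \<gamma>^2 * \<delta>^2) = 68637888"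
    unfolding h_defs x1_def x2_def x3_def by (algebra | use \<gamma> \<delta> in algebra)
  then have hx: "h1 * x1 ^ 2 + h2 * (x1 * x2) + h3 * x2 ^ 2 + h4 * (x1 * x3) + h5 * (x2 * x3) + h6 * x3 ^ 2 \<noteq> 0" by (metis mult_zero_left zero_neq_numeral)
  have tu0: "vdet ?G (u1, u2, u3) ?P = (- (8 - 4 * d - 2 * d^2 + 6 * c + 2 * c * d - 2 * c * d^2 + 2 * c^2 - c^2 * d + 4 * c^2 * d^2) * (X * X) + (12 - 2 * d + 2 * d^2 + 4 * c + 6 * c * d + 2 * c * d^2 + 4 * c^2 - 2 * c^2 * d + 4 * c^2 * d^2) * (X * Y) + (4 * d - 6 * d^2 - 2 * c * d + 2 * c * d^2 - 6 * c^2 + 4 * c^2 * d + 3 * c^2 * d^2) * (X * Z) - (2 * d + 4 * d^2 + 2 * c + 2 * c * d + 2 * c * d^2 - 2 * c^2 - c^2 * d + 2 * c^2 * d^2) * (Y * Y) + (4 - 6 * d + 4 * d^2 - 4 * c + 2 * c * d + 8 * c^2 - 4 * c^2 * d - 3 * c^2 * d^2) * (Y * Z) - (4 - 2 * d^2 - 2 * c + 2 * c^2 - c^2 * d - c^2 * d^2) * (Z * Z)) * Q"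
    and tu1: "vdet ?G (u1, u2, u3) ?P' = ((2 + 2 * c - 2 * c * d + 2 * c^2 - 2 * c^2 * d + c^2 * d^2) * (X * X) - (8 - 6 * d + 2 * d^2 + 6 * c + 4 * c * d + 8 * c^2 - 2 * c^2 * d + 2 * c^2 * d^2) * (X * Y) + (8 - 4 * d + 2 * d^2 + 6 * c + 6 * c * d - 2 * c * d^2 + 6 * c^2) * (X * Z) + (2 + 2 * d + 2 * d^2 - 4 * c + 4 * c * d + 2 * c * d^2 - 2 * c^2 - c^2 * d^2) * (Y * Y) - (4 - 2 * d + 6 * d^2 - 8 * c + 2 * c * d + 2 * c * d^2 + 4 * c^2 - 6 * c^2 * d - 2 * c^2 * d^2) * (Y * Z) + (2 - 4 * d + 2 * d^2 - 8 * c - 2 * c * d - 2 * c * d^2 + 2 * c^2 - 4 * c^2 * d - 3 * c^2 * d^2) * (Z * Z)) * Q'"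
    and tv0: "vdet ?G (v1, v2, v3) ?P = (vdet ?G (d ^ 2, 1, 1) ?P) * Q"
    and tv1: "vdet ?G (v1, v2, v3) ?P' = ((d ^ 2 * Y - d ^ 2 * Z) * Q) * Q'"
    and tw0: "vdet ?G (w1, w2, w3) ?P = ((c ^ 2 * X - c ^ 2 * Y) * Q') * Q"
    and tw1: "vdet ?G (w1, w2, w3) ?P' = (vdet ?G (1, 1, c ^ 2) ?P') * Q'"
    unfolding uvw vdet.simps Q Q' by (algebra | use c d in algebra)+
  have l: "lin a b e = (4 - d - 4 * d^2 + 2 * c + c * d - c * d^2 - c^2 + c^2 * d + 2 * c^2 * d^2) * X - (6 - d - 4 * d^2 + 2 * c * d + c^2 + c^2 * d + c^2 * d^2) * Y + (2 - d - d^2 - 2 * c + c * d^2 + c^2) * Z" and l': "lin a' b' e' = (d + c * d - c * d^2 - c^2 + c^2 * d - c^2 * d^2) * X - (2 + d - 2 * d^2 + 2 * c + 4 * c * d - c^2 + 3 * c^2 * d) * Y + (2 + d - d^2 + 4 * c + 4 * c * d + c * d^2 + c^2 + 2 * c^2 * d + c^2 * d^2) * Z"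
    unfolding lin_def l_defs constS_hom c_def[symmetric] d_def[symmetric] by algebra+
  have det: "vdet ?G (u1, u2, u3) (v1, v2, v3) = constS 1 * lin a' b' e' * Q * Q'"
    unfolding l' uvw vdet.simps Q Q' constS_hom by (algebra | use c d in algebra)
  define h where "h = constS h1 * X ^ 2 + constS h2 * (X * Y) + constS h3 * Y ^ 2 + constS h4 * (X * Z)
    + constS h5 * (Y * Z) + constS h6 * Z ^ 2"
  have rel: "h * u1 + lin a b e * v1 - lin a' b' e' * w1 = m * (X ^ 2)" "h * u2 + lin a b e * v2 - lin a' b' e' * w2 = m * (Y ^ 2)" "h * u3 + lin a b e * v3 - lin a' b' e' * w3 = m * (Z ^ 2)"
    unfolding l l' uvw h_def m_def h_defs Q Q' constS_hom c_def[symmetric] d_def[symmetric] by (algebra | use c d in algebra)+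
  have const: "homog 0 c" "homog 0 d"
    by (simp_all add: c_def d_def)
  have homog_u: "homog 1 u1" "homog 1 u2" "homog 1 u3"
    unfolding uvw by (intro homog_sums homog_1_mult homog_0 const homog_XYZ)+
  have homog_vw: "homog 2 v1" "homog 2 v2" "homog 2 v3" "homog 2 w1" "homog 2 w2" "homog 2 w3"
    unfolding uvw by (intro homog_2_const homog_FQ homog_0 const)+
  show ?thesis
    by (rule nearly_free[OF cop homog_u homog_vw tu0 tu1 tv0 tv1 tw0 tw1 det _ rel h_def _ _ x hx]) simp_all
qed

end

unbundle fps_syntax

section \<open>Hyperosculating conics of the Fermat cubic\<close>

text \<open>Contact of order 6 with the branch \<open>(g0, g1, g2)\<close> of the Fermat cubic at \<open>(a, b, c)\<close> of the conic
  \<open>q1 x^2 + q2 x y + q3 y^2 + q4 x z + q5 y z + q6 z^2\<close>.\<close>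

definition contact6 :: "complex \<Rightarrow> complex \<Rightarrow> complex \<Rightarrow> complex \<Rightarrow> complex \<Rightarrow> complex \<Rightarrow> complex \<Rightarrow> complex \<Rightarrow> complex \<Rightarrow> bool" where
  "contact6 q1 q2 q3 q4 q5 q6 a b c \<longleftrightarrow> (\<exists>g0 g1 g2 :: complex fps.
     g0 $ 0 = a \<and> g1 $ 0 = b \<and> g2 $ 0 = c \<and> g0 ^ 3 + g1 ^ 3 + g2 ^ 3 = 0 \<and>
     (a * g1 $ 1 - b * g0 $ 1 \<noteq> 0 \<or> a * g2 $ 1 - c * g0 $ 1 \<noteq> 0 \<or> b * g2 $ 1 - c * g1 $ 1 \<noteq> 0) \<and>
     (\<forall>k<6. (fps_const q1 * g0 ^ 2 + fps_const q2 * (g0 * g1) + fps_const q3 * g1 ^ 2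
       + fps_const q4 * (g0 * g2) + fps_const q5 * (g1 * g2) + fps_const q6 * g2 ^ 2) $ k = 0))"

text \<open>The cyclic symmetry of the cubic lets the classification assume that the first two
  coordinates have equal cubes.\<close>

lemma contact6_rotate:
  assumes "contact6 q1 q2 q3 q4 q5 q6 a b c"
  shows "contact6 q3 q5 q6 q2 q4 q1 b c a"
proof -
  obtain g0 g1 g2 where g: "g0 $ 0 = a" "g1 $ 0 = b" "g2 $ 0 = c" "g0 ^ 3 + g1 ^ 3 + g2 ^ 3 = 0"
    "a * g1 $ 1 - b * g0 $ 1 \<noteq> 0 \<or> a * g2 $ 1 - c * g0 $ 1 \<noteq> 0 \<or> b * g2 $ 1 - c * g1 $ 1 \<noteq> 0"
    "\<forall>k<6. (fps_const q1 * g0 ^ 2 + fps_const q2 * (g0 * g1) + fps_const q3 * g1 ^ 2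
       + fps_const q4 * (g0 * g2) + fps_const q5 * (g1 * g2) + fps_const q6 * g2 ^ 2) $ k = 0"
    using assms unfolding contact6_def by blast
  have f: "g1 ^ 3 + g2 ^ 3 + g0 ^ 3 = 0" using g(4) by (simp add: add_ac)
  have f': "b * g2 $ 1 - c * g1 $ 1 \<noteq> 0 \<or> b * g0 $ 1 - a * g1 $ 1 \<noteq> 0 \<or> c * g0 $ 1 - a * g2 $ 1 \<noteq> 0"
    using g(5) by auto
  have sum: "fps_const q3 * g1 ^ 2 + fps_const q5 * (g1 * g2) + fps_const q6 * g2 ^ 2
       + fps_const q2 * (g1 * g0) + fps_const q4 * (g2 * g0) + fps_const q1 * g0 ^ 2
     = fps_const q1 * g0 ^ 2 + fps_const q2 * (g0 * g1) + fps_const q3 * g1 ^ 2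
       + fps_const q4 * (g0 * g2) + fps_const q5 * (g1 * g2) + fps_const q6 * g2 ^ 2"
    by (simp add: algebra_simps)
  show ?thesis unfolding contact6_def
    by (rule exI[of _ g1], rule exI[of _ g2], rule exI[of _ g0], unfold sum, intro conjI) (fact g f f')+
qed

definition vanishes :: "nat \<Rightarrow> complex fps \<Rightarrow> bool" where
  "vanishes n G \<longleftrightarrow> (\<forall>k<n. G $ k = 0)"

lemma vanishes_mult: "vanishes n G \<Longrightarrow> vanishes n (G * H)"
  unfolding vanishes_def by (auto simp: fps_mult_nth intro!: sum.neutral)

text \<open>\<open>s\<close> is a unit, so no order of vanishing is lost beyond the one taken by
  differentiation.\<close>

lemma vanishes_deriv:
  assumes "vanishes (Suc n) G" and d: "fps_deriv G = s * G'" and s: "s $ 0 \<noteq> 0"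
  shows "vanishes n G'"
proof -
  have "vanishes n (fps_deriv G)" using assms(1) unfolding vanishes_def by auto
  then have "vanishes n (fps_deriv G * inverse s)" by (rule vanishes_mult)
  also have "fps_deriv G * inverse s = G' * (inverse s * s)" unfolding d by (simp add: mult_ac)
  also have "\<dots> = G'" using s by (simp add: inverse_mult_eq_1)
  finally show ?thesis .
qed

text \<open>In the affine chart the derivation \<open>y^2 d/dx - x^2 d/dy\<close> of the cubic \<open>x^3 + y^3 + 1 = 0\<close> is, up
  to a unit, differentiation along the branch; applying it to the conic lowers the order of contact by
  one. The polynomials \<open>osc1\<close>, ..., \<open>osc5\<close> are its iterates on \<open>osc0\<close>, reduced by the equation of
  the cubic.\<close>

definition osc0 :: "'a \<Rightarrow> 'a \<Rightarrow> 'a \<Rightarrow> 'a \<Rightarrow> 'a \<Rightarrow> 'a \<Rightarrow> 'a \<Rightarrow> 'a \<Rightarrow> 'a :: comm_ring_1" where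
  "osc0 q1 q2 q3 q4 q5 q6 x y =
    q1 * x ^ 2 + q2 * (x * y) + q3 * y ^ 2 + q4 * x + q5 * y + q6"

definition osc1 :: "'a \<Rightarrow> 'a \<Rightarrow> 'a \<Rightarrow> 'a \<Rightarrow> 'a \<Rightarrow> 'a \<Rightarrow> 'a \<Rightarrow> 'a :: comm_ring_1" where
  "osc1 q1 q2 q3 q4 q5 x y =
    q1 * (2 * x * y ^ 2) + q2 * (- 1 - 2 * x ^ 3) + q3 * (- 2 * x ^ 2 * y) + q4 * y ^ 2 + q5 * (- (x ^ 2))"

definition osc2 :: "'a \<Rightarrow> 'a \<Rightarrow> 'a \<Rightarrow> 'a \<Rightarrow> 'a \<Rightarrow> 'a \<Rightarrow> 'a \<Rightarrow> 'a :: comm_ring_1" where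
  "osc2 q1 q2 q3 q4 q5 x y =
    q1 * (- 2 * y - 6 * x ^ 3 * y) + q2 * (- 6 * x ^ 2 * y ^ 2) + q3 * (4 * x + 6 * x ^ 4) + q4 * (- 2 * x ^ 2 * y) + q5 * (- 2 * x * y ^ 2)"

definition osc3 :: "'a \<Rightarrow> 'a \<Rightarrow> 'a \<Rightarrow> 'a \<Rightarrow> 'a \<Rightarrow> 'a \<Rightarrow> 'a \<Rightarrow> 'a :: comm_ring_1" where
  "osc3 q1 q2 q3 q4 q5 x y =
    q1 * (20 * x ^ 2 + 24 * x ^ 5) + q2 * (12 * x * y + 24 * x ^ 4 * y) + q3 * (4 * y ^ 2 + 24 * x ^ 3 * y ^ 2) + q4 * (4 * x + 6 * x ^ 4) + q5 * (2 * y + 6 * x ^ 3 * y)"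

definition osc4 :: "'a \<Rightarrow> 'a \<Rightarrow> 'a \<Rightarrow> 'a \<Rightarrow> 'a \<Rightarrow> 'a \<Rightarrow> 'a \<Rightarrow> 'a :: comm_ring_1" where
  "osc4 q1 q2 q3 q4 q5 x y =
    q1 * (40 * x * y ^ 2 + 120 * x ^ 4 * y ^ 2) + q2 * (- 12 - 120 * x ^ 3 - 120 * x ^ 6) + q3 * (- 80 * x ^ 2 * y - 120 * x ^ 5 * y) + q4 * (4 * y ^ 2 + 24 * x ^ 3 * y ^ 2) + q5 * (- 20 * x ^ 2 - 24 * x ^ 5)"

definition osc5 :: "'a \<Rightarrow> 'a \<Rightarrow> 'a \<Rightarrow> 'a \<Rightarrow> 'a \<Rightarrow> 'a \<Rightarrow> 'a \<Rightarrow> 'a :: comm_ring_1" where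
  "osc5 q1 q2 q3 q4 q5 x y =
    q1 * (- 40 * y - 600 * x ^ 3 * y - 720 * x ^ 6 * y) + q2 * (- 360 * x ^ 2 * y ^ 2 - 720 * x ^ 5 * y ^ 2) + q3 * (160 * x + 840 * x ^ 4 + 720 * x ^ 7) + q4 * (- 80 * x ^ 2 * y - 120 * x ^ 5 * y) + q5 * (- 40 * x * y ^ 2 - 120 * x ^ 4 * y ^ 2)"

lemmas osc_defs = osc0_def osc1_def osc2_def osc3_def osc4_def osc5_def

lemma contact6_equations:
  assumes "contact6 q1 q2 q3 q4 q5 q6 a b c" "a \<noteq> 0" "b \<noteq> 0" "c \<noteq> 0"
  defines "x \<equiv> a / c" and "y \<equiv> b / c"
  shows "x ^ 3 + y ^ 3 + 1 = 0"
    and "osc0 q1 q2 q3 q4 q5 q6 x y = 0"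
    and "osc1 q1 q2 q3 q4 q5 x y = 0"
    and "osc2 q1 q2 q3 q4 q5 x y = 0"
    and "osc3 q1 q2 q3 q4 q5 x y = 0"
    and "osc4 q1 q2 q3 q4 q5 x y = 0"
    and "osc5 q1 q2 q3 q4 q5 x y = 0"
proof -
  obtain g0 g1 g2 where g: "g0 $ 0 = a" "g1 $ 0 = b" "g2 $ 0 = c" "g0 ^ 3 + g1 ^ 3 + g2 ^ 3 = 0"
    "a * g1 $ 1 - b * g0 $ 1 \<noteq> 0 \<or> a * g2 $ 1 - c * g0 $ 1 \<noteq> 0 \<or> b * g2 $ 1 - c * g1 $ 1 \<noteq> 0"
    "vanishes 6 (fps_const q1 * g0 ^ 2 + fps_const q2 * (g0 * g1) + fps_const q3 * g1 ^ 2
       + fps_const q4 * (g0 * g2) + fps_const q5 * (g1 * g2) + fps_const q6 * g2 ^ 2)"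
    using assms(1) unfolding contact6_def vanishes_def by blast
  define i where "i = inverse g2"
  have i: "i * g2 = 1" unfolding i_def using g(3) assms(4) by (simp add: inverse_mult_eq_1)
  define X where "X = g0 * i"
  define Y where "Y = g1 * i"
  have g0: "g0 = X * g2" and g1: "g1 = Y * g2"
    using i unfolding X_def Y_def by (simp_all add: mult.assoc)
  have XY: "X ^ 3 + Y ^ 3 + 1 = 0"
  proof -
    have "X ^ 3 + Y ^ 3 + 1 = (g0 ^ 3 + g1 ^ 3 + g2 ^ 3) * i ^ 3"
      using i unfolding X_def Y_def by algebra
    then show ?thesis using g(4) by simp
  qed
  have X0: "X $ 0 = x" and Y0: "Y $ 0 = y"
    using g(1-3) assms(4) unfolding X_def Y_def i_def x_def y_def by (simp_all add: fps_mult_nth_0 field_simps)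
  have xy: "x \<noteq> 0" "y \<noteq> 0" using assms(2-4) by (auto simp: x_def y_def)
  \<comment> \<open>Differentiating the cubic gives \<open>X^2 X' + Y^2 Y' = 0\<close>, so
    \<open>(X', Y')\<close> is \<open>s\<close> times the Hamiltonian direction
    \<open>(Y^2, - X^2)\<close>. Since \<open>y\<close> is nonzero, \<open>Y ^ 2\<close> is
    invertible.\<close>
  define s where "s = fps_deriv X * inverse (Y ^ 2)"
  have Y2: "inverse (Y ^ 2) * Y ^ 2 = 1"
    using Y0 xy by (intro inverse_mult_eq_1) (simp add: fps_power_zeroth)
  then have dX: "fps_deriv X = s * Y ^ 2" unfolding s_def by (simp add: mult.assoc)
  have "fps_deriv (X ^ 3 + Y ^ 3 + 1) = 0" unfolding XY by simp
  then have "3 * X ^ 2 * fps_deriv X + 3 * Y ^ 2 * fps_deriv Y = 0"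
    by (simp add: fps_deriv_power numeral_3_eq_3 power2_eq_square algebra_simps)
  then have "3 * (X ^ 2 * fps_deriv X + Y ^ 2 * fps_deriv Y) = 0" by (simp add: algebra_simps)
  then have "X ^ 2 * fps_deriv X + Y ^ 2 * fps_deriv Y = 0" by (simp only: mult_eq_0_iff) simp
  then have "fps_deriv Y = - (s * X ^ 2)" using dX Y2 by algebra
  then have dY: "fps_deriv Y = s * (- (X ^ 2))" by simp
  \<comment> \<open>A zero of \<open>s\<close> would make the branch stationary in the affine chart,
    against the immersion condition.\<close>
  have s0: "s $ 0 \<noteq> 0"
  proof
    assume "s $ 0 = 0"
    then have "fps_deriv X $ 0 = 0" "fps_deriv Y $ 0 = 0" unfolding dX dY by (simp_all add: fps_mult_nth_0)
    then have "X $ 1 = 0" "Y $ 1 = 0" by simp_all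
    then have "g0 $ 1 = x * g2 $ 1" "g1 $ 1 = y * g2 $ 1"
      unfolding g0 g1 by (simp_all add: fps_mult_nth_1 X0 Y0)
    moreover have "a = x * c" "b = y * c" using assms(4) by (simp_all add: x_def y_def)
    ultimately show False using g(5) by (simp add: algebra_simps)
  qed
  show rel: "x ^ 3 + y ^ 3 + 1 = 0"
    using arg_cong[OF XY, of "\<lambda>f. f $ 0"] by (simp add: fps_power_zeroth X0 Y0)
  define c1 c2 c3 c4 c5 c6 where "c1 = fps_const q1" and "c2 = fps_const q2"
    and "c3 = fps_const q3" and "c4 = fps_const q4" and "c5 = fps_const q5" and "c6 = fps_const q6"
  define E0 E1 E2 E3 E4 E5 where
    "E0 = osc0 c1 c2 c3 c4 c5 c6 X Y" and
    "E1 = osc1 c1 c2 c3 c4 c5 X Y" and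
    "E2 = osc2 c1 c2 c3 c4 c5 X Y" and
    "E3 = osc3 c1 c2 c3 c4 c5 X Y" and
    "E4 = osc4 c1 c2 c3 c4 c5 X Y" and
    "E5 = osc5 c1 c2 c3 c4 c5 X Y"
  note c_defs = c1_def c2_def c3_def c4_def c5_def c6_def
  note E_defs = E0_def E1_def E2_def E3_def E4_def E5_def osc_defs
  have dc: "fps_deriv c1 = 0" "fps_deriv c2 = 0" "fps_deriv c3 = 0" "fps_deriv c4 = 0" "fps_deriv c5 = 0" "fps_deriv c6 = 0"
    by (simp_all add: c_defs)
  have dpow: "fps_deriv (f ^ n) = of_nat n * f ^ (n - 1) * fps_deriv f" for f :: "complex fps" and n
    by (simp add: fps_deriv_power fps_of_nat mult_ac)
  note d_rules = fps_deriv_mult fps_deriv_add fps_deriv_sub fps_deriv_neg dpow fps_deriv_numeral dX dY dc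
  have "vanishes 6 ((c1 * g0 ^ 2 + c2 * (g0 * g1) + c3 * g1 ^ 2 + c4 * (g0 * g2) + c5 * (g1 * g2) + c6 * g2 ^ 2) * i ^ 2)"
    using g(6) unfolding c_defs by (rule vanishes_mult)
  also have "(c1 * g0 ^ 2 + c2 * (g0 * g1) + c3 * g1 ^ 2 + c4 * (g0 * g2) + c5 * (g1 * g2) + c6 * g2 ^ 2) * i ^ 2 = E0"
    unfolding E_defs g0 g1 using i by algebra
  finally have E0: "vanishes (Suc 5) E0" by simp
  have "fps_deriv E0 = s * E1"
    unfolding E_defs d_rules using XY by (simp add: d_rules, algebra)
  from vanishes_deriv[OF E0 this s0] have E1: "vanishes (Suc 4) E1" by (simp add: eval_nat_numeral)
  have "fps_deriv E1 = s * E2"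
    unfolding E_defs d_rules using XY by (simp add: d_rules, algebra)
  from vanishes_deriv[OF E1 this s0] have E2: "vanishes (Suc 3) E2" by (simp add: eval_nat_numeral)
  have "fps_deriv E2 = s * E3"
    unfolding E_defs d_rules using XY by (simp add: d_rules, algebra)
  from vanishes_deriv[OF E2 this s0] have E3: "vanishes (Suc 2) E3" by (simp add: eval_nat_numeral)
  have "fps_deriv E3 = s * E4"
    unfolding E_defs d_rules using XY by (simp add: d_rules, algebra)
  from vanishes_deriv[OF E3 this s0] have E4: "vanishes (Suc 1) E4" by (simp add: eval_nat_numeral)
  have "fps_deriv E4 = s * E5"
    unfolding E_defs d_rules using XY by (simp add: d_rules, algebra)
  from vanishes_deriv[OF E4 this s0] have E5: "vanishes 1 E5" by simp
  have zero: "E $ 0 = 0" if "vanishes (Suc n) E" for E n using that by (simp add: vanishes_def)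
  note nth0 = fps_mult_nth_0 fps_power_zeroth X0 Y0 c_defs
  show "osc0 q1 q2 q3 q4 q5 q6 x y = 0" using zero[OF E0] unfolding E_defs by (simp add: nth0)
  show "osc1 q1 q2 q3 q4 q5 x y = 0" using zero[OF E1] unfolding E_defs by (simp add: nth0)
  show "osc2 q1 q2 q3 q4 q5 x y = 0" using zero[OF E2] unfolding E_defs by (simp add: nth0)
  show "osc3 q1 q2 q3 q4 q5 x y = 0" using zero[OF E3] unfolding E_defs by (simp add: nth0)
  show "osc4 q1 q2 q3 q4 q5 x y = 0" using zero[OF E4] unfolding E_defs by (simp add: nth0)
  show "osc5 q1 q2 q3 q4 q5 x y = 0" using zero[of 0 E5] E5 unfolding E_defs by (simp add: nth0)
qed

lemma contact6_sextactic:
  assumes "contact6 q1 q2 q3 q4 q5 q6 a b c" "a \<noteq> 0" "b \<noteq> 0" "c \<noteq> 0"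
    and nz: "q1 \<noteq> 0 \<or> q2 \<noteq> 0 \<or> q3 \<noteq> 0 \<or> q4 \<noteq> 0 \<or> q5 \<noteq> 0 \<or> q6 \<noteq> 0"
  shows "a ^ 3 = b ^ 3 \<or> b ^ 3 = c ^ 3 \<or> c ^ 3 = a ^ 3"
proof (rule ccontr)
  assume neq: "\<not> ?thesis"
  define x y where "x = a / c" and "y = b / c"
  note eqs = contact6_equations[OF assms(1-4), folded x_def y_def]
  note rel = eqs(1)
  define g0 where "g0 = osc0 q1 q2 q3 q4 q5 q6 x y"
  define g1 where "g1 = osc1 q1 q2 q3 q4 q5 x y"
  define g2 where "g2 = osc2 q1 q2 q3 q4 q5 x y"
  define g3 where "g3 = osc3 q1 q2 q3 q4 q5 x y"
  define g4 where "g4 = osc4 q1 q2 q3 q4 q5 x y"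
  define g5 where "g5 = osc5 q1 q2 q3 q4 q5 x y"
  note gdefs = g0_def g1_def g2_def g3_def g4_def g5_def osc_defs
  have g: "g0 = 0" "g1 = 0" "g2 = 0" "g3 = 0" "g4 = 0" "g5 = 0" unfolding g0_def g1_def g2_def g3_def g4_def g5_def by (fact eqs)+
  have "x \<noteq> 0" "y \<noteq> 0" using assms(2-4) by (auto simp: x_def y_def)
  moreover have "x ^ 3 \<noteq> 1" "x ^ 3 \<noteq> y ^ 3" "y ^ 3 \<noteq> 1"
    using neq assms(4) by (auto simp: x_def y_def power_divide field_simps)
  \<comment> \<open>On the affine cubic this product vanishes only at flexes, where
    \<open>x y = 0\<close>, and where two coordinates have equal cubes. It is the factor up to which
    the linear system for the conic is inverted.\<close>
  ultimately have "1280 * x * y * (x ^ 3 - 1) * (x ^ 3 - y ^ 3) * (1 - y ^ 3) \<noteq> 0" by simp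
  moreover have "1280 * x * y * (x ^ 3 - 1) * (x ^ 3 - y ^ 3) * (1 - y ^ 3) = - 2560 * x * y - 3840 * x ^ 4 * y + 3840 * x ^ 7 * y + 2560 * x ^ 10 * y"
    using rel by algebra
  ultimately have det: "- 2560 * x * y - 3840 * x ^ 4 * y + 3840 * x ^ 7 * y + 2560 * x ^ 10 * y \<noteq> 0" by simp
  \<comment> \<open>The six identities solve the system for \<open>q1\<close>, ...,
    \<open>q6\<close> up to that factor, modulo the equation of the cubic.\<close>
  have e1: "(- 2560 * x * y - 3840 * x ^ 4 * y + 3840 * x ^ 7 * y + 2560 * x ^ 10 * y) * q1 = (- 1920 * x ^ 6 * y ^ 2 - 3840 * x ^ 9 * y ^ 2) * g1 + (1280 * x + 1280 * x ^ 4 - 4480 * x ^ 7 - 3840 * x ^ 10) * g2 + (1280 * x ^ 2 * y + 640 * x ^ 5 * y - 1280 * x ^ 8 * y - 640 * x ^ 11 * y) * g3 + (640 * x ^ 3 * y ^ 2 + 1120 * x ^ 6 * y ^ 2 - 320 * x ^ 9 * y ^ 2) * g4 + (- 160 * x ^ 4 - 160 * x ^ 7 + 32 * x ^ 10) * g5"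
    unfolding gdefs using rel by algebra
  have e2: "(- 2560 * x * y - 3840 * x ^ 4 * y + 3840 * x ^ 7 * y + 2560 * x ^ 10 * y) * q2 = (- 1280 * x * y - 5120 * x ^ 4 * y - 5120 * x ^ 7 * y) * g1 + (1920 * x ^ 2 * y ^ 2 + 3840 * x ^ 5 * y ^ 2) * g2 + (- 2560 * x ^ 3 - 1280 * x ^ 6 + 2560 * x ^ 9 + 1280 * x ^ 12) * g3 + (320 * x * y + 960 * x ^ 4 * y + 960 * x ^ 7 * y + 640 * x ^ 10 * y) * g4 + (160 * x ^ 2 * y ^ 2 + 64 * x ^ 5 * y ^ 2 + 64 * x ^ 8 * y ^ 2) * g5"
    unfolding gdefs using rel by algebra
  have e3: "(- 2560 * x * y - 3840 * x ^ 4 * y + 3840 * x ^ 7 * y + 2560 * x ^ 10 * y) * q3 = (1920 * x ^ 2 + 7680 * x ^ 5 + 9600 * x ^ 8 + 3840 * x ^ 11) * g1 + (640 * y - 1280 * x ^ 3 * y - 7040 * x ^ 6 * y - 3840 * x ^ 9 * y) * g2 + (- 1280 * x ^ 4 * y ^ 2 + 640 * x ^ 7 * y ^ 2 + 640 * x ^ 10 * y ^ 2) * g3 + (- 800 * x ^ 2 - 2560 * x ^ 5 - 2080 * x ^ 8 - 320 * x ^ 11) * g4 + (- 32 * y - 256 * x ^ 3 * y - 256 * x ^ 6 * y - 32 * x ^ 9 * y) * g5"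
    unfolding gdefs using rel by algebra
  have e4: "(- 2560 * x * y - 3840 * x ^ 4 * y + 3840 * x ^ 7 * y + 2560 * x ^ 10 * y) * q4 = (3840 * x * y ^ 2 + 7680 * x ^ 4 * y ^ 2) * g1 + (- 640 * x ^ 2 + 1280 * x ^ 5 + 7040 * x ^ 8 + 3840 * x ^ 11) * g2 + (1280 * x ^ 3 * y - 640 * x ^ 6 * y - 640 * x ^ 9 * y) * g3 + (- 320 * x * y ^ 2 - 1280 * x ^ 4 * y ^ 2 - 1280 * x ^ 7 * y ^ 2) * g4 + (160 * x ^ 2 + 256 * x ^ 5 + 160 * x ^ 8) * g5"
    unfolding gdefs using rel by algebra
  have e5: "(- 2560 * x * y - 3840 * x ^ 4 * y + 3840 * x ^ 7 * y + 2560 * x ^ 10 * y) * q5 = (- 3840 * x ^ 2 * y - 7680 * x ^ 5 * y) * g1 + (- 1280 * y ^ 2 - 1280 * x ^ 3 * y ^ 2 + 4480 * x ^ 6 * y ^ 2 + 3840 * x ^ 9 * y ^ 2) * g2 + (- 1280 * x - 640 * x ^ 4 + 1280 * x ^ 7 + 640 * x ^ 10) * g3 + (320 * x ^ 2 * y + 1280 * x ^ 5 * y + 1280 * x ^ 8 * y) * g4 + (64 * y ^ 2 + 64 * x ^ 3 * y ^ 2 + 160 * x ^ 6 * y ^ 2) * g5"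
    unfolding gdefs using rel by algebra
  have e6: "(- 2560 * x * y - 3840 * x ^ 4 * y + 3840 * x ^ 7 * y + 2560 * x ^ 10 * y) * q6 = (- 2560 * x * y - 3840 * x ^ 4 * y + 3840 * x ^ 7 * y + 2560 * x ^ 10 * y) * g0 + (- 640 * x ^ 2 * y ^ 2 - 2560 * x ^ 5 * y ^ 2 - 2560 * x ^ 8 * y ^ 2) * g1 + (- 640 - 1920 * x ^ 3 - 1920 * x ^ 6 - 1280 * x ^ 9) * g2 + (1280 * x * y - 640 * x ^ 4 * y - 640 * x ^ 7 * y) * g3 + (480 * x ^ 2 * y ^ 2 + 960 * x ^ 5 * y ^ 2) * g4 + (32 - 160 * x ^ 3 - 160 * x ^ 6) * g5"
    unfolding gdefs using rel by algebra
  have "q1 = 0" "q2 = 0" "q3 = 0" "q4 = 0" "q5 = 0" "q6 = 0"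
    using e1 e2 e3 e4 e5 e6 det unfolding g mult_zero_right add_0_right mult_eq_0_iff by blast+
  with nz show False by simp
qed

text \<open>Contact of order 5, expressed by \<open>osc0\<close> to \<open>osc4\<close>, pins down
  the osculating conic. Subtracting \<open>q1\<close> times the expected conic leaves a remainder
  without \<open>X ^ 2\<close> term, and the five equations force it to vanish.\<close>

lemma contact6_conic:
  assumes "contact6 q1 q2 q3 q4 q5 q6 a b c" "a \<noteq> 0" "b \<noteq> 0" "c \<noteq> 0" and ab: "a ^ 3 = b ^ 3"
  obtains \<beta> \<gamma> where "\<beta> ^ 3 = 1" "\<gamma> ^ 3 = -2" "q2 = - 2 * \<beta> ^ 2 * q1" "q3 = \<beta> * q1" "q4 = - (\<gamma> ^ 2) * q1"
    "q5 = - (\<gamma> ^ 2) * \<beta> ^ 2 * q1" "q6 = 2 * \<gamma> * q1"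
proof -
  define x y where "x = a / c" and "y = b / c"
  note eqs = contact6_equations[OF assms(1-4), folded x_def y_def]
  have "x \<noteq> 0" using assms(2-4) by (auto simp: x_def y_def)
  have "x ^ 3 = y ^ 3" using ab by (simp add: x_def y_def power_divide)
  with eqs(1) have xy: "2 * x ^ 3 + 1 = 0" "2 * y ^ 3 + 1 = 0" by algebra+
  \<comment> \<open>As \<open>x^3 = - 1 / 2\<close>, these are \<open>y / x\<close> and
    \<open>1 / x\<close>, so the contact point is \<open>(1 : \<beta> : \<gamma>)\<close>.\<close>
  define \<beta> \<gamma> where "\<beta> = - 2 * x ^ 2 * y" and "\<gamma> = - 2 * x ^ 2"
  have \<beta>\<gamma>: "\<beta> ^ 3 = 1" "\<gamma> ^ 3 = -2" unfolding \<beta>_def \<gamma>_def using xy by algebra+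
  define r2 where "r2 = q2 + 2 * \<beta> ^ 2 * q1"
  define r3 where "r3 = q3 - \<beta> * q1"
  define r4 where "r4 = q4 + \<gamma> ^ 2 * q1"
  define r5 where "r5 = q5 + \<gamma> ^ 2 * \<beta> ^ 2 * q1"
  define r6 where "r6 = q6 - 2 * \<gamma> * q1"
  note rdefs = r2_def r3_def r4_def r5_def r6_def \<beta>_def \<gamma>_def
  have s0: "osc0 0 r2 r3 r4 r5 r6 x y = 0"
    unfolding rdefs osc_defs using eqs(2)[unfolded osc_defs] xy by algebra
  have s1: "osc1 0 r2 r3 r4 r5 x y = 0"
    unfolding rdefs osc_defs using eqs(3)[unfolded osc_defs] xy by algebra
  have s2: "osc2 0 r2 r3 r4 r5 x y = 0"
    unfolding rdefs osc_defs using eqs(4)[unfolded osc_defs] xy by algebra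
  have s3: "osc3 0 r2 r3 r4 r5 x y = 0"
    unfolding rdefs osc_defs using eqs(5)[unfolded osc_defs] xy by algebra
  have s4: "osc4 0 r2 r3 r4 r5 x y = 0"
    unfolding rdefs osc_defs using eqs(6)[unfolded osc_defs] xy by algebra
  note s = s0[unfolded osc_defs] s1[unfolded osc_defs] s2[unfolded osc_defs] s3[unfolded osc_defs] s4[unfolded osc_defs]
  have "36 * x * r2 = 0"
    using s(2,3,4,5) xy by algebra
  then have r2: "r2 = 0" using \<open>x \<noteq> 0\<close> by simp
  have "36 * x * r3 = 0"
    using s(2,4) xy by algebra
  then have r3: "r3 = 0" using \<open>x \<noteq> 0\<close> by simp
  have "36 * x * r4 = 0"
    using s(2,3,4,5) xy by algebra
  then have r4: "r4 = 0" using \<open>x \<noteq> 0\<close> by simp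
  have "36 * x * r5 = 0"
    using s(2,3,5) xy by algebra
  then have r5: "r5 = 0" using \<open>x \<noteq> 0\<close> by simp
  have "36 * x * r6 = 0"
    using s(1,2,3,4,5) xy by algebra
  then have r6: "r6 = 0" using \<open>x \<noteq> 0\<close> by simp
  show thesis
    using that[OF \<beta>\<gamma>] r2 r3 r4 r5 r6 unfolding r2_def r3_def r4_def r5_def r6_def
    by (simp add: eq_neg_iff_add_eq_0)
qed

section \<open>From conics in \<open>S\<close> to contact conditions on their coefficients\<close>

lemma unital_hom_fps_const: "unital_hom (fps_const :: complex \<Rightarrow> complex fps)"
  by (simp add: unital_hom_def)

lemmas evalF_hom = unital_homD[OF unital_hom_evalG[OF unital_hom_fps_const], folded evalF_def]
lemmas evalF_gens = evalG_gens[OF unital_hom_fps_const, folded evalF_def]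

lemma unital_hom_id: "unital_hom (id :: complex \<Rightarrow> complex)"
  by (simp add: unital_hom_def)

lemma unital_hom_evalS: "unital_hom (\<lambda>p. evalS p v)"
  unfolding evalS_def by (intro unital_hom_evalG unital_hom_id)

lemmas evalS_hom = unital_homD[OF unital_hom_evalS]

lemma evalS_gens: "evalS varX (a, b, c) = a" "evalS varY (a, b, c) = b" "evalS varZ (a, b, c) = c"
  "evalS (constS k) v = k"
  by (simp_all add: evalS_def evalG_gens[OF unital_hom_id])

definition quadric :: "complex \<Rightarrow> complex \<Rightarrow> complex \<Rightarrow> complex \<Rightarrow> complex \<Rightarrow> complex \<Rightarrow> S" where
  "quadric q1 q2 q3 q4 q5 q6 = constS q1 * varX ^ 2 + constS q2 * (varX * varY) + constS q3 * varY ^ 2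
     + constS q4 * (varX * varZ) + constS q5 * (varY * varZ) + constS q6 * varZ ^ 2"

lemma mcoeff_mono3: "mcoeff (mono3 c a b d) i j k = (if i = a \<and> j = b \<and> k = d then c else 0)"
  by (auto simp: mono3_eq mcoeff_def)

lemma homog_2_quadric:
  assumes "homog 2 q"
  obtains q1 q2 q3 q4 q5 q6 where "q = quadric q1 q2 q3 q4 q5 q6"
proof -
  have "q = mono3 (mcoeff q 2 0 0) 2 0 0 + mono3 (mcoeff q 1 1 0) 1 1 0 + mono3 (mcoeff q 0 2 0) 0 2 0
    + mono3 (mcoeff q 1 0 1) 1 0 1 + mono3 (mcoeff q 0 1 1) 0 1 1 + mono3 (mcoeff q 0 0 2) 0 0 2" (is "_ = ?r")
  proof (rule S_eqI)
    fix i j k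
    show "mcoeff q i j k = mcoeff ?r i j k"
    proof (cases "i + j + k = 2")
      case True
      then have "(i, j, k) \<in> {(2, 0, 0), (1, 1, 0), (0, 2, 0), (1, 0, 1), (0, 1, 1), (0, 0, 2)}"
        by auto
      then show ?thesis unfolding mcoeff_add mcoeff_mono3 by auto
    next
      case False
      then have "mcoeff q i j k = 0" using assms unfolding homog_def by blast
      with False show ?thesis unfolding mcoeff_add mcoeff_mono3 by auto
    qed
  qed
  then show thesis by (intro that) (simp add: quadric_def mult.assoc)
qed

lemma fps_cube_nth:
  fixes g :: "complex fps"
  shows "(g ^ 3) $ 0 = (g $ 0) ^ 3" "(g ^ 3) $ 1 = 3 * (g $ 0) ^ 2 * g $ 1"
    "(g ^ 3) $ 2 = 3 * (g $ 0) ^ 2 * g $ 2 + 3 * g $ 0 * (g $ 1) ^ 2"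
  by (simp_all add: power3_eq_cube fps_mult_nth numeral_2_eq_2 algebra_simps power2_eq_square)

text \<open>At a point with a vanishing coordinate the tangent line has contact of order 3.\<close>

lemma inflection_fermat:
  assumes smooth: "smooth_pt fermat (a, b, c)"
    and g: "g0 $ 0 = a" "g1 $ 0 = b" "g2 $ 0 = c" "g0 ^ 3 + g1 ^ 3 + g2 ^ 3 = 0"
      "a * g1 $ 1 - b * g0 $ 1 \<noteq> 0 \<or> a * g2 $ 1 - c * g0 $ 1 \<noteq> 0 \<or> b * g2 $ 1 - c * g1 $ 1 \<noteq> 0"
    and zero: "a = 0 \<or> b = 0 \<or> c = 0"
  shows "inflection_pt fermat (a, b, c)"
proof -
  define l where "l = constS (a ^ 2) * varX + constS (b ^ 2) * varY + constS (c ^ 2) * varZ"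
  have "homog 1 l" unfolding l_def by (intro homog_add homog_constS_mult homog_gens)
  moreover have "l \<noteq> 0"
  proof
    assume "l = 0"
    then have "evalS l (x, y, z) = 0" for x y z by (simp add: evalS_hom)
    then have "a ^ 2 * x + b ^ 2 * y + c ^ 2 * z = 0" for x y z
      unfolding l_def by (simp add: evalS_hom evalS_gens)
    from this[of 1 0 0] this[of 0 1 0] this[of 0 0 1] smooth show False by (simp add: smooth_pt_def)
  qed
  moreover have "int_mult_ge fermat l (a, b, c) 3"
  proof -
    let ?L = "evalF l g0 g1 g2"
    have L: "?L $ n = a ^ 2 * g0 $ n + b ^ 2 * g1 $ n + c ^ 2 * g2 $ n" for n
      unfolding l_def by (simp add: evalF_hom evalF_gens)
    have F0: "a ^ 3 + b ^ 3 + c ^ 3 = 0"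
      using arg_cong[OF g(4), of "\<lambda>f. f $ 0"] by (simp add: fps_cube_nth(1) g(1-3))
    have F1: "a ^ 2 * g0 $ 1 + b ^ 2 * g1 $ 1 + c ^ 2 * g2 $ 1 = 0"
    proof -
      have "(g0 ^ 3) $ 1 + (g1 ^ 3) $ 1 + (g2 ^ 3) $ 1 = 0"
        using arg_cong[OF g(4), of "\<lambda>f. f $ 1"] by simp
      then have "3 * (a ^ 2 * g0 $ 1 + b ^ 2 * g1 $ 1 + c ^ 2 * g2 $ 1) = 0"
        unfolding fps_cube_nth g(1-3) by (simp add: algebra_simps)
      then show ?thesis by (simp only: mult_eq_0_iff) simp
    qed
    \<comment> \<open>The second-order coefficient of the tangent form is minus a quadratic form in
      the velocity of the branch, so contact of order 3 means that this form vanishes.\<close>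
    have F2: "a ^ 2 * g0 $ 2 + b ^ 2 * g1 $ 2 + c ^ 2 * g2 $ 2
      + (a * (g0 $ 1) ^ 2 + b * (g1 $ 1) ^ 2 + c * (g2 $ 1) ^ 2) = 0"
    proof -
      have "(g0 ^ 3) $ 2 + (g1 ^ 3) $ 2 + (g2 ^ 3) $ 2 = 0"
        using arg_cong[OF g(4), of "\<lambda>f. f $ 2"] by simp
      then have "3 * (a ^ 2 * g0 $ 2 + b ^ 2 * g1 $ 2 + c ^ 2 * g2 $ 2
        + (a * (g0 $ 1) ^ 2 + b * (g1 $ 1) ^ 2 + c * (g2 $ 1) ^ 2)) = 0"
        unfolding fps_cube_nth g(1-3) by (simp add: algebra_simps)
      then show ?thesis by (simp only: mult_eq_0_iff) simp
    qed
    \<comment> \<open>Since \<open>u^3 = - v^3\<close>, tangency makes \<open>(r, t)\<close>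
      proportional to \<open>(u, v)\<close>, and the form becomes a multiple of
      \<open>u^3 + v^3\<close>.\<close>
    have two: "u * r ^ 2 + v * t ^ 2 = 0" if "u ^ 3 + v ^ 3 = 0" "u ^ 2 * r + v ^ 2 * t = 0" "u \<noteq> 0 \<or> v \<noteq> 0"
      for u v r t :: complex
    proof -
      have "u ^ 3 * (u * r ^ 2 + v * t ^ 2) = 0" "v ^ 3 * (u * r ^ 2 + v * t ^ 2) = 0"
        using that(1,2) by algebra+
      with that(3) show ?thesis by auto
    qed
    have nz: "(a, b, c) \<noteq> (0, 0, 0)" using smooth by (simp add: smooth_pt_def)
    have "a * (g0 $ 1) ^ 2 + b * (g1 $ 1) ^ 2 + c * (g2 $ 1) ^ 2 = 0"
      using zero
    proof (elim disjE)
      assume "a = 0" then show ?thesis using two[of b c "g1 $ 1" "g2 $ 1"] F0 F1 nz by simp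
    next
      assume "b = 0" then show ?thesis using two[of a c "g0 $ 1" "g2 $ 1"] F0 F1 nz by simp
    next
      assume "c = 0" then show ?thesis using two[of a b "g0 $ 1" "g1 $ 1"] F0 F1 nz by simp
    qed
    with F2 have F2': "a ^ 2 * g0 $ 2 + b ^ 2 * g1 $ 2 + c ^ 2 * g2 $ 2 = 0" by simp
    have "?L $ n = 0" if "n < 3" for n
    proof -
      have "n = 0 \<or> n = 1 \<or> n = 2" using that by auto
      then show ?thesis
      proof (elim disjE)
        assume "n = 0"
        then show ?thesis using F0 by (simp add: L g(1-3) power2_eq_square power3_eq_cube)
      qed (use F1 F2' L in simp_all)
    qed
    then have "?L = 0 \<or> 3 \<le> subdegree ?L" by (auto intro: subdegree_geI)
    moreover have "evalF fermat g0 g1 g2 = 0"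
      using g(4) by (simp add: fermat_def evalF_hom evalF_gens)
    ultimately show ?thesis
      unfolding int_mult_ge_def using g(1-3,5)
      by - (rule exI[of _ g0], rule exI[of _ g1], rule exI[of _ g2], simp)
  qed
  ultimately show ?thesis unfolding inflection_pt_def using smooth by blast
qed

text \<open>A sextactic point is not a flex, so none of its coordinates vanishes; this permits the
  affine computation.\<close>

lemma hyperosc_contact6:
  assumes "hyperosc_conic fermat q"
  obtains q1 q2 q3 q4 q5 q6 a b c where "q = quadric q1 q2 q3 q4 q5 q6" "contact6 q1 q2 q3 q4 q5 q6 a b c"
    "a \<noteq> 0" "b \<noteq> 0" "c \<noteq> 0" "q1 \<noteq> 0 \<or> q2 \<noteq> 0 \<or> q3 \<noteq> 0 \<or> q4 \<noteq> 0 \<or> q5 \<noteq> 0 \<or> q6 \<noteq> 0"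
proof -
  obtain p where q: "homog 2 q" "q \<noteq> 0" and p: "sextactic_pt fermat p" "int_mult_ge fermat q p 6"
    using assms unfolding hyperosc_conic_def by blast
  obtain q1 q2 q3 q4 q5 q6 where qq: "q = quadric q1 q2 q3 q4 q5 q6" using homog_2_quadric[OF q(1)] by blast
  obtain a b c where abc: "p = (a, b, c)" by (cases p) auto
  obtain g0 g1 g2 where g: "g0 $ 0 = a" "g1 $ 0 = b" "g2 $ 0 = c" "evalF fermat g0 g1 g2 = 0"
    "a * g1 $ 1 - b * g0 $ 1 \<noteq> 0 \<or> a * g2 $ 1 - c * g0 $ 1 \<noteq> 0 \<or> b * g2 $ 1 - c * g1 $ 1 \<noteq> 0"
    "evalF q g0 g1 g2 = 0 \<or> subdegree (evalF q g0 g1 g2) \<ge> 6"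
    using p(2) unfolding int_mult_ge_def abc by auto
  have F: "g0 ^ 3 + g1 ^ 3 + g2 ^ 3 = 0"
    using g(4) by (simp add: fermat_def evalF_hom evalF_gens)
  have "a \<noteq> 0 \<and> b \<noteq> 0 \<and> c \<noteq> 0"
    using p(1) inflection_fermat[OF _ g(1-3) F g(5)] unfolding sextactic_pt_def abc by blast
  moreover have "evalF q g0 g1 g2 $ k = 0" if "k < 6" for k
    using g(6) that nth_less_subdegree_zero[of k "evalF q g0 g1 g2"] by auto
  then have "contact6 q1 q2 q3 q4 q5 q6 a b c"
    unfolding contact6_def using g(1-3,5) F
    by - (rule exI[of _ g0], rule exI[of _ g1], rule exI[of _ g2], simp add: qq quadric_def evalF_hom evalF_gens)
  moreover have "q1 \<noteq> 0 \<or> q2 \<noteq> 0 \<or> q3 \<noteq> 0 \<or> q4 \<noteq> 0 \<or> q5 \<noteq> 0 \<or> q6 \<noteq> 0"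
    using q(2) by (auto simp: qq quadric_def constS_hom)
  ultimately show thesis using that qq by blast
qed

text \<open>The hyperosculating conic at the cyclic shift by \<open>t\<close> of the point \<open>(1 : \<beta> : \<gamma>)\<close>, and the
  corresponding point among the \<open>p\<^sub>j\<close>.\<close>

definition tconic :: "nat \<Rightarrow> complex \<Rightarrow> complex \<Rightarrow> S" where
  "tconic t \<beta> \<gamma> = (if t = 0 then conic varX (constS (\<beta> ^ 2) * varY) varZ \<gamma>
     else if t = 1 then conic varY (constS (\<beta> ^ 2) * varZ) varX \<gamma>
     else conic varZ (constS (\<beta> ^ 2) * varX) varY \<gamma>)"

definition tpoint :: "nat \<Rightarrow> complex \<Rightarrow> complex \<times> complex \<times> complex" where
  "tpoint t \<beta> = (if t = 0 then (1, \<beta>, 0) else if t = 1 then (0, 1, \<beta>) else (\<beta>, 0, 1))"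

text \<open>\<open>X\<close>, \<open>Y\<close>, \<open>Z\<close> are arbitrary elements of
  \<open>S\<close>, so that the identity can be used with the variables permuted cyclically.\<close>

lemma contact6_tconic:
  assumes "contact6 q1 q2 q3 q4 q5 q6 a b c" "a \<noteq> 0" "b \<noteq> 0" "c \<noteq> 0" "a ^ 3 = b ^ 3"
    and nz: "q1 \<noteq> 0 \<or> q2 \<noteq> 0 \<or> q3 \<noteq> 0 \<or> q4 \<noteq> 0 \<or> q5 \<noteq> 0 \<or> q6 \<noteq> 0"
  obtains \<beta> \<gamma> where "q1 \<noteq> 0" "\<beta> ^ 3 = 1" "\<gamma> ^ 3 = -2"
    "\<And>X Y Z. constS q1 * X ^ 2 + constS q2 * (X * Y) + constS q3 * Y ^ 2 + constS q4 * (X * Z)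
       + constS q5 * (Y * Z) + constS q6 * Z ^ 2 = constS q1 * conic X (constS (\<beta> ^ 2) * Y) Z \<gamma>"
proof -
  obtain \<beta> \<gamma> where b: "\<beta> ^ 3 = 1" "\<gamma> ^ 3 = -2" and q: "q2 = - 2 * \<beta> ^ 2 * q1" "q3 = \<beta> * q1"
    "q4 = - (\<gamma> ^ 2) * q1" "q5 = - (\<gamma> ^ 2) * \<beta> ^ 2 * q1" "q6 = 2 * \<gamma> * q1"
    using contact6_conic[OF assms(1-5)] by metis
  have "q1 \<noteq> 0" using nz by (auto simp: q)
  moreover have B: "constS \<beta> ^ 3 = 1" using b(1) by (simp flip: constS_hom)
  have "constS q1 * X ^ 2 + constS q2 * (X * Y) + constS q3 * Y ^ 2 + constS q4 * (X * Z)
       + constS q5 * (Y * Z) + constS q6 * Z ^ 2 = constS q1 * conic X (constS (\<beta> ^ 2) * Y) Z \<gamma>" for X Y Z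
    unfolding conic_def q constS_hom using B by algebra
  ultimately show thesis using that b by blast
qed

lemma hyperosc_tconic:
  assumes "hyperosc_conic fermat q"
  obtains k t \<beta> \<gamma> where "k \<noteq> 0" "t < 3" "\<beta> ^ 3 = 1" "\<gamma> ^ 3 = -2" "q = constS k * tconic t \<beta> \<gamma>"
proof -
  obtain q1 q2 q3 q4 q5 q6 a b c where q: "q = quadric q1 q2 q3 q4 q5 q6" and
    c6: "contact6 q1 q2 q3 q4 q5 q6 a b c" and abc: "a \<noteq> 0" "b \<noteq> 0" "c \<noteq> 0" and
    nz: "q1 \<noteq> 0 \<or> q2 \<noteq> 0 \<or> q3 \<noteq> 0 \<or> q4 \<noteq> 0 \<or> q5 \<noteq> 0 \<or> q6 \<noteq> 0"
    using hyperosc_contact6[OF assms] by metis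
  consider "a ^ 3 = b ^ 3" | "b ^ 3 = c ^ 3" | "c ^ 3 = a ^ 3"
    using contact6_sextactic[OF c6 abc nz] by blast
  then show thesis
  proof cases
    case 1
    obtain \<beta> \<gamma> where "q1 \<noteq> 0" "\<beta> ^ 3 = 1" "\<gamma> ^ 3 = -2"
      and eq: "\<And>X Y Z. constS q1 * X ^ 2 + constS q2 * (X * Y) + constS q3 * Y ^ 2 + constS q4 * (X * Z)
       + constS q5 * (Y * Z) + constS q6 * Z ^ 2 = constS q1 * conic X (constS (\<beta> ^ 2) * Y) Z \<gamma>"
      using contact6_tconic[OF c6 abc 1 nz] by blast
    moreover have "q = constS q1 * tconic 0 \<beta> \<gamma>"
      using eq[of varX varY varZ] by (simp add: q quadric_def tconic_def)
    ultimately show thesis by (intro that[of q1 0 \<beta> \<gamma>]) auto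
  next
    case 2
    have nz': "q3 \<noteq> 0 \<or> q5 \<noteq> 0 \<or> q6 \<noteq> 0 \<or> q2 \<noteq> 0 \<or> q4 \<noteq> 0 \<or> q1 \<noteq> 0" using nz by blast
    obtain \<beta> \<gamma> where "q3 \<noteq> 0" "\<beta> ^ 3 = 1" "\<gamma> ^ 3 = -2"
      and eq: "\<And>X Y Z. constS q3 * X ^ 2 + constS q5 * (X * Y) + constS q6 * Y ^ 2 + constS q2 * (X * Z)
       + constS q4 * (Y * Z) + constS q1 * Z ^ 2 = constS q3 * conic X (constS (\<beta> ^ 2) * Y) Z \<gamma>"
      using contact6_tconic[OF contact6_rotate[OF c6] abc(2,3,1) 2 nz'] by blast
    moreover have "q = constS q3 * tconic 1 \<beta> \<gamma>"
      using eq[of varY varZ varX] by (simp add: q quadric_def tconic_def algebra_simps)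
    ultimately show thesis by (intro that[of q3 1 \<beta> \<gamma>]) auto
  next
    case 3
    have nz': "q6 \<noteq> 0 \<or> q4 \<noteq> 0 \<or> q1 \<noteq> 0 \<or> q5 \<noteq> 0 \<or> q2 \<noteq> 0 \<or> q3 \<noteq> 0" using nz by blast
    obtain \<beta> \<gamma> where "q6 \<noteq> 0" "\<beta> ^ 3 = 1" "\<gamma> ^ 3 = -2"
      and eq: "\<And>X Y Z. constS q6 * X ^ 2 + constS q4 * (X * Y) + constS q1 * Y ^ 2 + constS q5 * (X * Z)
       + constS q2 * (Y * Z) + constS q3 * Z ^ 2 = constS q6 * conic X (constS (\<beta> ^ 2) * Y) Z \<gamma>"
      using contact6_tconic[OF contact6_rotate[OF contact6_rotate[OF c6]] abc(3,1,2) 3 nz'] by blast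
    moreover have "q = constS q6 * tconic 2 \<beta> \<gamma>"
      using eq[of varZ varX varY] by (simp add: q quadric_def tconic_def algebra_simps)
    ultimately show thesis by (intro that[of q6 2 \<beta> \<gamma>]) auto
  qed
qed

section \<open>Incidence of the conics with the nine points\<close>

text \<open>At a point of its own type the conic takes the value
  \<open>(1 - \<beta>^2 \<beta>')^2\<close>. At the other points the value is a root of unity times
  \<open>1 + 2 d - d^2\<close> for some cube root \<open>d\<close> of -2, hence nonzero.\<close>

lemma tconic_at_tpoint:
  assumes t: "t < 3" "t' < 3" and b: "\<beta> ^ 3 = 1" "\<beta>' ^ 3 = 1" and g: "\<gamma> ^ 3 = -2"
  shows "evalS (tconic t \<beta> \<gamma>) (tpoint t' \<beta>') = 0 \<longleftrightarrow> t = t' \<and> \<beta> = \<beta>'"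
proof -
  have no_root: "1 + 2 * d - d ^ 2 \<noteq> 0" if "d ^ 3 = -2" for d :: complex
  proof
    assume *: "1 + 2 * d - d ^ 2 = 0"
    \<comment> \<open>The two equations force \<open>d = - 4 / 5\<close>, which satisfies neither;
      the false numerical identity is a consequence.\<close>
    have "25 * (1::complex) = 41" using that * by algebra
    then show False by simp
  qed
  have same: "(1 - \<beta> ^ 2 * \<beta>') ^ 2 = 0 \<longleftrightarrow> \<beta> = \<beta>'"
  proof
    assume "(1 - \<beta> ^ 2 * \<beta>') ^ 2 = 0"
    then have "1 - \<beta> ^ 2 * \<beta>' = 0" by simp
    with b(1) show "\<beta> = \<beta>'" by algebra
  next
    assume "\<beta> = \<beta>'"
    with b(1) show "(1 - \<beta> ^ 2 * \<beta>') ^ 2 = 0" by algebra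
  qed
  have n1: "(\<beta> ^ 2) ^ 2 + 2 * \<gamma> * \<beta>' ^ 2 - \<gamma> ^ 2 * \<beta>' * \<beta> ^ 2 \<noteq> 0"
  proof -
    have "(\<gamma> * \<beta>' ^ 2 * \<beta> ^ 2) ^ 3 = -2" using b g by algebra
    from no_root[OF this] have "\<beta> * (1 + 2 * (\<gamma> * \<beta>' ^ 2 * \<beta> ^ 2) - (\<gamma> * \<beta>' ^ 2 * \<beta> ^ 2) ^ 2) \<noteq> 0"
      using b(1) by auto
    moreover have "\<beta> * (1 + 2 * (\<gamma> * \<beta>' ^ 2 * \<beta> ^ 2) - (\<gamma> * \<beta>' ^ 2 * \<beta> ^ 2) ^ 2)
      = (\<beta> ^ 2) ^ 2 + 2 * \<gamma> * \<beta>' ^ 2 - \<gamma> ^ 2 * \<beta>' * \<beta> ^ 2" using b by algebra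
    ultimately show ?thesis by simp
  qed
  have n2: "\<beta>' ^ 2 + 2 * \<gamma> - \<gamma> ^ 2 * \<beta>' \<noteq> 0"
  proof -
    have "(\<gamma> * \<beta>') ^ 3 = -2" using b g by algebra
    from no_root[OF this] have "\<beta>' ^ 2 * (1 + 2 * (\<gamma> * \<beta>') - (\<gamma> * \<beta>') ^ 2) \<noteq> 0"
      using b(2) by auto
    moreover have "\<beta>' ^ 2 * (1 + 2 * (\<gamma> * \<beta>') - (\<gamma> * \<beta>') ^ 2) = \<beta>' ^ 2 + 2 * \<gamma> - \<gamma> ^ 2 * \<beta>'" using b by algebra
    ultimately show ?thesis by simp
  qed
  have three: "s = 0 \<or> s = 1 \<or> s = 2" if "s < 3" for s :: nat using that by auto
  show ?thesis
    using three[OF t(1)] three[OF t(2)] same n1 n2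
    by (elim disjE) (simp_all add: tconic_def tpoint_def conic_def evalS_hom evalS_gens)
qed

lemma omega_cube: "omega ^ 3 = 1"
proof -
  have "omega ^ 3 = exp (of_nat 3 * (2 * pi * \<i> / 3))" unfolding omega_def by (rule exp_of_nat_mult[symmetric])
  also have "of_nat 3 * (2 * pi * \<i> / 3) = 2 * pi * \<i>" by simp
  finally show ?thesis by (simp add: exp_two_pi_i)
qed

lemma omega_neq_1: "omega \<noteq> 1"
proof
  assume "omega = 1"
  moreover have "omega = cis (2 * pi / 3)"
    unfolding omega_def cis_conv_exp by (simp add: mult_ac)
  ultimately have "sin (2 * pi / 3) = 0" by (metis cis.simps(2) one_complex.simps(2))
  moreover have "sin (2 * pi / 3) > 0" by (rule sin_gt_zero) (simp_all add: field_simps)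
  ultimately show False by simp
qed

lemma cube_roots_of_unity:
  fixes \<omega> :: complex
  assumes "\<omega> ^ 3 = 1" "\<omega> \<noteq> 1" "\<beta> ^ 3 = 1"
  shows "\<omega> ^ 2 + \<omega> + 1 = 0" "\<beta> = 1 \<or> \<beta> = \<omega> \<or> \<beta> = \<omega> ^ 2"
proof -
  have "(\<omega> - 1) * (\<omega> ^ 2 + \<omega> + 1) = 0" using assms(1) by algebra
  with assms(2) show *: "\<omega> ^ 2 + \<omega> + 1 = 0" by simp
  have "(\<beta> - 1) * (\<beta> - \<omega>) * (\<beta> - \<omega> ^ 2) = 0" using assms(3) * by algebra
  then show "\<beta> = 1 \<or> \<beta> = \<omega> \<or> \<beta> = \<omega> ^ 2" by auto
qed

lemma ptj_eq_tpoint: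
  assumes "t < 3" "i < 3"
  shows "ptj (3 * t + i + 1) = tpoint t (omega ^ i)"
proof -
  have "t = 0 \<or> t = 1 \<or> t = 2" "i = 0 \<or> i = 1 \<or> i = 2" using assms by auto
  then show ?thesis by (elim disjE) (simp_all add: ptj_def tpoint_def)
qed

lemma ptj_tpoint:
  assumes "j \<in> {1..9}"
  obtains t \<beta> where "t < 3" "\<beta> ^ 3 = 1" "ptj j = tpoint t \<beta>"
proof (rule that)
  let ?t = "(j - 1) div 3" and ?i = "(j - 1) mod 3"
  show t: "?t < 3" using assms by auto
  show "(omega ^ ?i) ^ 3 = 1" by (metis omega_cube power_commutes power_mult power_one mult.commute)
  have "3 * ?t + ?i + 1 = j" using assms by simp
  with ptj_eq_tpoint[OF t, of ?i] show "ptj j = tpoint ?t (omega ^ ?i)" by simp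
qed

lemma tpoint_ptj:
  assumes "t < 3" "\<beta> ^ 3 = 1"
  obtains j where "j \<in> {1..9}" "ptj j = tpoint t \<beta>"
proof -
  note found = that
  have *: thesis if i: "i < 3" "\<beta> = omega ^ i" for i
    by (rule found[of "3 * t + i + 1"]) (use assms(1) i ptj_eq_tpoint[of t i] in auto)
  show thesis
    using cube_roots_of_unity(2)[OF omega_cube omega_neq_1 assms(2)] *[of 0] *[of 1] *[of 2] by auto
qed

lemma common_Pset_iff:
  assumes q: "hyperosc_conic fermat q" "q = constS k * tconic t \<beta> \<gamma>" "k \<noteq> 0" "t < 3" "\<beta> ^ 3 = 1" "\<gamma> ^ 3 = -2"
    and q': "hyperosc_conic fermat q'" "q' = constS k' * tconic t' \<beta>' \<gamma>'" "k' \<noteq> 0" "t' < 3" "\<beta>' ^ 3 = 1" "\<gamma>' ^ 3 = -2"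
  shows "(\<exists>j\<in>{1..9}. q \<in> Pset j \<and> q' \<in> Pset j) \<longleftrightarrow> t = t' \<and> \<beta> = \<beta>'"
proof -
  have mem: "q \<in> Pset j \<longleftrightarrow> t = s \<and> \<beta> = \<delta>" "q' \<in> Pset j \<longleftrightarrow> t' = s \<and> \<beta>' = \<delta>"
    if "s < 3" "\<delta> ^ 3 = 1" "ptj j = tpoint s \<delta>" for s \<delta> j
    using tconic_at_tpoint[OF q(4) that(1) q(5) that(2) q(6)] tconic_at_tpoint[OF q'(4) that(1) q'(5) that(2) q'(6)]
      q(1,3) q'(1,3) unfolding Pset_def that(3) by (simp_all add: q(2) q'(2) evalS_hom evalS_gens)
  show ?thesis
  proof
    assume "\<exists>j\<in>{1..9}. q \<in> Pset j \<and> q' \<in> Pset j"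
    then obtain j where j: "j \<in> {1..9}" "q \<in> Pset j" "q' \<in> Pset j" by blast
    obtain s \<delta> where s: "s < 3" "\<delta> ^ 3 = 1" "ptj j = tpoint s \<delta>" using ptj_tpoint[OF j(1)] by blast
    with mem[OF s] j show "t = t' \<and> \<beta> = \<beta>'" by simp
  next
    assume *: "t = t' \<and> \<beta> = \<beta>'"
    obtain j where "j \<in> {1..9}" "ptj j = tpoint t \<beta>" using tpoint_ptj[OF q(4,5)] by blast
    with mem[OF q(4,5)] * show "\<exists>j\<in>{1..9}. q \<in> Pset j \<and> q' \<in> Pset j" by blast
  qed
qed

section \<open>Classification of the pairs of conics\<close>

text \<open>Both sides are the derivative of \<open>p(t x, t y, t z)\<close> at
  \<open>t = 1\<close>, once by the chain rule and once from \<open>p t^d\<close>.\<close>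

lemma euler_homog:
  assumes "homog d p"
  shows "D euler_field p = of_nat d * p"
proof -
  have *: "poly (pderiv (graded p)) 1 = D euler_field p" for p
  proof (induction p rule: S_induct)
    case (add p q)
    then show ?case by (simp add: graded_hom pderiv_add D_add)
  next
    case (mult p q)
    then show ?case by (simp add: graded_hom pderiv_mult D_mult poly_graded_1)
  qed (simp_all add: pderiv_pCons)
  have "D euler_field p = poly (pderiv (monom p d)) 1"
    using *[of p] assms by (simp add: homog_iff_graded)
  then show ?thesis by (simp add: pderiv_monom poly_monom mult.commute)
qed

lemma m_syzygy_scale:
  assumes "k \<noteq> 0"
  shows "m_syzygy (constS k * f) = m_syzygy f"
proof -
  have "AR (constS k * f) = AR f"
  proof (rule set_eqI)
    fix r show "r \<in> AR (constS k * f) \<longleftrightarrow> r \<in> AR f"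
      unfolding AR_iff_D using assms by (simp add: D_mult)
  qed
  then have "homog_gens (constS k * f) = homog_gens f" by (intro ext) (simp add: homog_gens_def)
  then show ?thesis by (intro ext) (simp add: m_syzygy_def)
qed

section \<open>Normal forms of pairs of conics\<close>

text \<open>Hiding the matrices turns rotation, exchange and rescaling of coordinates into closure
  properties, while results of \<open>linear_coords\<close> can still be instantiated.\<close>

definition coords :: "S \<Rightarrow> S \<Rightarrow> S \<Rightarrow> bool" where
  "coords X Y Z \<longleftrightarrow> (\<exists>n11 n12 n13 n21 n22 n23 n31 n32 n33 m11 m12 m13 m21 m22 m23 m31 m32 m33.
    linear_coords n11 n12 n13 n21 n22 n23 n31 n32 n33 m11 m12 m13 m21 m22 m23 m31 m32 m33
    \<and> X = constS n11 * varX + constS n12 * varY + constS n13 * varZ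
    \<and> Y = constS n21 * varX + constS n22 * varY + constS n23 * varZ
    \<and> Z = constS n31 * varX + constS n32 * varY + constS n33 * varZ)"

lemma coordsE:
  assumes "coords X Y Z"
  obtains n11 n12 n13 n21 n22 n23 n31 n32 n33 m11 m12 m13 m21 m22 m23 m31 m32 m33 where
    "linear_coords n11 n12 n13 n21 n22 n23 n31 n32 n33 m11 m12 m13 m21 m22 m23 m31 m32 m33"
    "X = linear_coords.X n11 n12 n13" "Y = linear_coords.Y n21 n22 n23" "Z = linear_coords.Z n31 n32 n33"
proof -
  from assms obtain n11 n12 n13 n21 n22 n23 n31 n32 n33 m11 m12 m13 m21 m22 m23 m31 m32 m33 where
    l: "linear_coords n11 n12 n13 n21 n22 n23 n31 n32 n33 m11 m12 m13 m21 m22 m23 m31 m32 m33"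
    and XYZ: "X = constS n11 * varX + constS n12 * varY + constS n13 * varZ"
      "Y = constS n21 * varX + constS n22 * varY + constS n23 * varZ"
      "Z = constS n31 * varX + constS n32 * varY + constS n33 * varZ"
    unfolding coords_def by blast
  show thesis
    by (rule that[OF l]) (simp_all add: XYZ linear_coords.X_def[OF l] linear_coords.Y_def[OF l] linear_coords.Z_def[OF l])
qed

lemma coordsI:
  assumes "linear_coords n11 n12 n13 n21 n22 n23 n31 n32 n33 m11 m12 m13 m21 m22 m23 m31 m32 m33"
    "X = constS n11 * varX + constS n12 * varY + constS n13 * varZ"
    "Y = constS n21 * varX + constS n22 * varY + constS n23 * varZ"
    "Z = constS n31 * varX + constS n32 * varY + constS n33 * varZ"
  shows "coords X Y Z"
  unfolding coords_def using assms by blast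

lemma coords_var: "coords varX varY varZ"
  by (rule coordsI[of 1 0 0 0 1 0 0 0 1 1 0 0 0 1 0 0 0 1]) (auto simp: linear_coords_def constS_hom)

lemma coords_rotate:
  assumes "coords X Y Z"
  shows "coords Y Z X"
proof -
  from assms obtain n11 n12 n13 n21 n22 n23 n31 n32 n33 m11 m12 m13 m21 m22 m23 m31 m32 m33 where
    l: "linear_coords n11 n12 n13 n21 n22 n23 n31 n32 n33 m11 m12 m13 m21 m22 m23 m31 m32 m33"
    and XYZ: "X = constS n11 * varX + constS n12 * varY + constS n13 * varZ"
      "Y = constS n21 * varX + constS n22 * varY + constS n23 * varZ"
      "Z = constS n31 * varX + constS n32 * varY + constS n33 * varZ"
    unfolding coords_def by blast
  have "linear_coords n21 n22 n23 n31 n32 n33 n11 n12 n13 m12 m13 m11 m22 m23 m21 m32 m33 m31"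
    using l unfolding linear_coords_def by (simp add: add_ac)
  then show ?thesis using XYZ(2,3,1) by (rule coordsI)
qed

lemma coords_swap:
  assumes "coords X Y Z"
  shows "coords Y X Z"
proof -
  from assms obtain n11 n12 n13 n21 n22 n23 n31 n32 n33 m11 m12 m13 m21 m22 m23 m31 m32 m33 where
    l: "linear_coords n11 n12 n13 n21 n22 n23 n31 n32 n33 m11 m12 m13 m21 m22 m23 m31 m32 m33"
    and XYZ: "X = constS n11 * varX + constS n12 * varY + constS n13 * varZ"
      "Y = constS n21 * varX + constS n22 * varY + constS n23 * varZ"
      "Z = constS n31 * varX + constS n32 * varY + constS n33 * varZ"
    unfolding coords_def by blast
  have "linear_coords n21 n22 n23 n11 n12 n13 n31 n32 n33 m12 m11 m13 m22 m21 m23 m32 m31 m33"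
    using l unfolding linear_coords_def by (simp add: add_ac)
  then show ?thesis using XYZ(2,1,3) by (rule coordsI)
qed

lemma coords_scale:
  assumes "coords X Y Z" and nz: "a \<noteq> 0" "b \<noteq> 0" "c \<noteq> 0"
  shows "coords (constS a * X) (constS b * Y) (constS c * Z)"
proof -
  from assms(1) obtain n11 n12 n13 n21 n22 n23 n31 n32 n33 m11 m12 m13 m21 m22 m23 m31 m32 m33 where
    l: "linear_coords n11 n12 n13 n21 n22 n23 n31 n32 n33 m11 m12 m13 m21 m22 m23 m31 m32 m33"
    and XYZ: "X = constS n11 * varX + constS n12 * varY + constS n13 * varZ"
      "Y = constS n21 * varX + constS n22 * varY + constS n23 * varZ"
      "Z = constS n31 * varX + constS n32 * varY + constS n33 * varZ"
    unfolding coords_def by blast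
  have sum: "k * n * m + k * n' * m' + k * n'' * m'' = k * (n * m + n' * m' + n'' * m'')" for k n m n' m' n'' m'' :: complex
    by (simp add: algebra_simps)
  have "linear_coords (a * n11) (a * n12) (a * n13) (b * n21) (b * n22) (b * n23) (c * n31) (c * n32) (c * n33)
    (m11 / a) (m12 / b) (m13 / c) (m21 / a) (m22 / b) (m23 / c) (m31 / a) (m32 / b) (m33 / c)"
    using l nz unfolding linear_coords_def times_divide_eq_right add_divide_distrib[symmetric] sum by simp
  then show ?thesis
    by (rule coordsI) (simp_all add: XYZ constS_hom algebra_simps)
qed

lemma coords_frame: "coords X Y Z \<Longrightarrow> frame X Y Z"
  by (elim coordsE) (simp add: linear_coords.frame_XYZ)

lemma coords_free_same:
  assumes "coords X Y Z" "v ^ 2 + v + 1 = 0"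
    "F = X ^ 3 + Y ^ 3 + constS (1 / 4) * Z ^ 3" "Q = (X - Y) ^ 2 - Z ^ 2 - Z * (X + Y)"
    "Q' = (X - Y) ^ 2 - constS v * Z ^ 2 - constS v ^ 2 * Z * (X + Y)"
    "coprime_gradient (F * Q * Q')"
  shows "m_syzygy (F * Q * Q') 2 [3, 3]"
  using assms by (elim coordsE, hypsubst) (rule linear_coords.free_same; (assumption | rule refl))

lemma coords_nearly_free_same_1:
  assumes "coords X Y Z" "\<omega> ^ 2 + \<omega> + 1 = 0"
    "F = X ^ 3 + Y ^ 3 + constS (1 / 4) * Z ^ 3" "Q = (X - Y) ^ 2 - Z ^ 2 - Z * (X + Y)"
    "Q' = (X - constS \<omega> * Y) ^ 2 - Z ^ 2 - Z * (X + constS \<omega> * Y)"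
    "coprime_gradient (F * Q * Q')"
  shows "m_syzygy (F * Q * Q') 3 [3, 4, 4]"
  using assms by (elim coordsE, hypsubst) (rule linear_coords.nearly_free_same_1; (assumption | rule refl))

lemma coords_nearly_free_same_w:
  assumes "coords X Y Z" "\<omega> ^ 2 + \<omega> + 1 = 0"
    "F = X ^ 3 + Y ^ 3 + constS (1 / 4) * Z ^ 3" "Q = (X - Y) ^ 2 - Z ^ 2 - Z * (X + Y)"
    "Q' = (X - constS \<omega> * Y) ^ 2 - constS \<omega> * Z ^ 2 - constS \<omega> ^ 2 * Z * (X + constS \<omega> * Y)"
    "coprime_gradient (F * Q * Q')"
  shows "m_syzygy (F * Q * Q') 3 [3, 4, 4]"
  using assms by (elim coordsE, hypsubst) (rule linear_coords.nearly_free_same_w; (assumption | rule refl))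

lemma coords_nearly_free_next:
  assumes "coords X Y Z" "\<gamma> ^ 3 = -2" "\<delta> ^ 3 = -2"
    "F = X ^ 3 + Y ^ 3 + Z ^ 3" "Q = conic X Y Z \<gamma>"
    "Q' = conic Y Z X \<delta>"
    "coprime_gradient (F * Q * Q')"
  shows "m_syzygy (F * Q * Q') 3 [3, 4, 4]"
  using assms by (elim coordsE, hypsubst) (rule linear_coords.nearly_free_next; (assumption | rule refl))

lemma coprime_gradient_conics:
  assumes fr: "frame X Y Z" "frame X' Y' Z'" and c: "c ^ 3 = -2" "c' ^ 3 = -2"
    and F: "F = X ^ 3 + Y ^ 3 + Z ^ 3" "F = X' ^ 3 + Y' ^ 3 + Z' ^ 3"
    and lin: "2 * Z' - constS c' * (X' + Y') = constS a * X + constS b * Y + constS d * Z"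
    and neq: "\<And>\<zeta>. \<zeta> ^ 3 = 1 \<Longrightarrow> a \<noteq> - c * \<zeta> \<or> b \<noteq> - c * \<zeta> \<or> d \<noteq> 2 * \<zeta>"
  shows "coprime_gradient (F * conic X Y Z c * conic X' Y' Z' c')"
proof (rule coprime_gradient_product)
  have nz: "c \<noteq> 0" "c' \<noteq> 0" using c by auto
  fix g :: S
  assume g: "prime_elem g"
  show False if "\<And>r. g dvd D r F"
    using cubic_smooth[OF fr(1) g] that by (simp add: F(1))
  show False if "\<And>r. g dvd D r (conic X Y Z c)"
    using conic_smooth[OF fr(1) nz(1) g that] .
  show False if "\<And>r. g dvd D r (conic X' Y' Z' c')"
    using conic_smooth[OF fr(2) nz(2) g that] .
  show False if "g dvd F" "g dvd conic X Y Z c"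
    using conic_cubic_coprime[OF fr(1) c(1) g] that by (simp add: F(1))
  show False if "g dvd F" "g dvd conic X' Y' Z' c'"
    using conic_cubic_coprime[OF fr(2) c(2) g] that by (simp add: F(2))
  show False if "g dvd conic X Y Z c" "g dvd conic X' Y' Z' c'"
    using conics_coprime[OF fr c _ lin neq g that] F by simp
next
  have cube: "homog 3 (x ^ 3)" if "homog 1 x" for x using homog_power[OF that, of 3] by simp
  have hF: "homog 3 F"
    using fr(1) unfolding F(1) frame_def by (auto intro!: homog_add cube)
  have hQ: "homog 2 (conic x y z k)" if "frame x y z" for x y z k
  proof -
    have "homog 2 (constS k ^ 2 * z * (x + y))"
      using homog_2_mult[of "constS k ^ 2" z "x + y"] that
      by (simp add: frame_def mult.assoc homog_add homog_0_power)
    moreover have "homog 2 (2 * constS k * z ^ 2)"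
      using homog_2_const[OF homog_2_power[of z], of "2 * constS k"] that
      by (simp add: frame_def mult.commute homog_0_mult homog_0_numeral)
    ultimately show ?thesis
      using that unfolding conic_def frame_def by (intro homog_diff homog_add homog_2_power) auto
  qed
  have "homog (3 + 2 + 2) (F * conic X Y Z c * conic X' Y' Z' c')"
    by (intro homog_mult hF hQ fr)
  from euler_homog[OF this]
  show "D euler_field (F * conic X Y Z c * conic X' Y' Z' c') = constS 7 * (F * conic X Y Z c * conic X' Y' Z' c')"
    by (simp add: constS_hom)
qed simp

lemma same_type:
  assumes co: "coords X Y Z" and F: "F = X ^ 3 + Y ^ 3 + Z ^ 3"
    and \<omega>: "\<omega> ^ 3 = 1" and \<gamma>: "\<gamma> ^ 3 = -2" "\<gamma>' ^ 3 = -2"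
  shows "\<omega> = 1 \<Longrightarrow> \<gamma> \<noteq> \<gamma>' \<Longrightarrow> m_syzygy (F * conic X Y Z \<gamma> * conic X (constS \<omega> * Y) Z \<gamma>') 2 [3, 3]"
    and "\<omega> \<noteq> 1 \<Longrightarrow> m_syzygy (F * conic X Y Z \<gamma> * conic X (constS \<omega> * Y) Z \<gamma>') 3 [3, 4, 4]"
proof -
  have nz: "\<gamma> \<noteq> 0" "\<omega> \<noteq> 0" using \<gamma> \<omega> by auto
  define v where "v = \<gamma>' / \<gamma>"
  have v: "v ^ 3 = 1" "\<gamma>' = \<gamma> * v" using \<gamma> nz by (simp_all add: v_def power_divide)
  have W: "constS \<omega> ^ 3 = 1" and C: "constS \<gamma> ^ 3 = -2" and V: "constS v ^ 3 = 1"
    using \<omega> \<gamma> v by (simp_all flip: constS_hom)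
  \<comment> \<open>\<open>Z2^3 = 4 Z^3\<close> and \<open>Z2^2 = - 2 \<gamma> Z^2\<close>: the cube
    root of -2 disappears and only the ratio \<open>v\<close> of the two roots remains.\<close>
  define Z2 where "Z2 = constS (\<gamma> ^ 2) * Z"
  have co2: "coords X Y Z2"
    using coords_scale[OF co, of 1 1 "\<gamma> ^ 2"] nz unfolding Z2_def by (simp add: constS_hom)
  have F2: "F = X ^ 3 + Y ^ 3 + constS (1 / 4) * Z2 ^ 3"
  proof -
    have "constS (1 / 4) * 4 = 1" by (simp flip: constS_hom)
    then have "constS (1 / 4) * Z2 ^ 3 = Z ^ 3" unfolding Z2_def constS_hom using C by algebra
    then show ?thesis by (simp add: F)
  qed
  have Q2: "conic X Y Z \<gamma> = (X - Y) ^ 2 - Z2 ^ 2 - Z2 * (X + Y)"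
    unfolding conic_def Z2_def constS_hom using C by algebra
  have Q2': "conic X (constS \<omega> * Y) Z \<gamma>' = (X - constS \<omega> * Y) ^ 2 - constS v * Z2 ^ 2 - constS v ^ 2 * Z2 * (X + constS \<omega> * Y)"
    unfolding conic_def Z2_def v(2) constS_hom using C by algebra
  have frames: "frame X Y Z" "frame X (constS \<omega> * Y) Z"
    using coords_frame[OF co] frame_scale[OF coords_frame[OF co], of 1 \<omega> 1] nz by (simp_all add: constS_hom)
  have F': "F = X ^ 3 + (constS \<omega> * Y) ^ 3 + Z ^ 3" unfolding F power_mult_distrib W by simp
  have cop: "coprime_gradient (F * conic X Y Z \<gamma> * conic X (constS \<omega> * Y) Z \<gamma>')" if neq: "\<omega> \<noteq> 1 \<or> \<gamma> \<noteq> \<gamma>'"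
  proof (rule coprime_gradient_conics[OF frames \<gamma> F F'])
    show "2 * Z - constS \<gamma>' * (X + constS \<omega> * Y) = constS (- \<gamma>') * X + constS (- \<gamma>' * \<omega>) * Y + constS 2 * Z"
      by (simp add: constS_hom algebra_simps)
    show "- \<gamma>' \<noteq> - \<gamma> * \<zeta> \<or> - \<gamma>' * \<omega> \<noteq> - \<gamma> * \<zeta> \<or> 2 \<noteq> 2 * \<zeta>" for \<zeta>
      using neq nz by auto
  qed
  show "m_syzygy (F * conic X Y Z \<gamma> * conic X (constS \<omega> * Y) Z \<gamma>') 2 [3, 3]" if "\<omega> = 1" "\<gamma> \<noteq> \<gamma>'"
  proof -
    have "v \<noteq> 1" using that(2) v(2) by auto
    then have v1: "v ^ 2 + v + 1 = 0" using cube_roots_of_unity(1)[OF v(1) _ v(1)] by simp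
    have Q2'': "conic X (constS \<omega> * Y) Z \<gamma>' = (X - Y) ^ 2 - constS v * Z2 ^ 2 - constS v ^ 2 * Z2 * (X + Y)"
      using Q2' unfolding that(1) by (simp add: constS_hom)
    show ?thesis
      by (rule coords_free_same[OF co2 v1 F2 Q2 Q2'' cop]) (use that in simp)
  qed
  show "m_syzygy (F * conic X Y Z \<gamma> * conic X (constS \<omega> * Y) Z \<gamma>') 3 [3, 4, 4]" if w1: "\<omega> \<noteq> 1"
  proof -
    have w: "\<omega> ^ 2 + \<omega> + 1 = 0" using cube_roots_of_unity(1)[OF \<omega> w1 \<omega>] .
    consider "v = 1" | "v = \<omega>" | "v = \<omega> ^ 2" using cube_roots_of_unity(2)[OF \<omega> w1 v(1)] by blast
    then show ?thesis
    proof cases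
      case 1
      have Q2'': "conic X (constS \<omega> * Y) Z \<gamma>' = (X - constS \<omega> * Y) ^ 2 - Z2 ^ 2 - Z2 * (X + constS \<omega> * Y)"
        unfolding Q2' 1 by (simp add: constS_hom)
      show ?thesis
        by (rule coords_nearly_free_same_1[OF co2 w F2 Q2 Q2'' cop]) (use w1 in simp)
    next
      case 2
      show ?thesis
        by (rule coords_nearly_free_same_w[OF co2 w F2 Q2 Q2'[unfolded 2] cop]) (use w1 in simp)
    next
      case 3
      text \<open>Exchanging \<open>X\<close> and \<open>Y\<close> leads back to the first case.\<close>
      define Q' where "Q' = (Y - constS (\<omega> ^ 2) * X) ^ 2 - Z2 ^ 2 - Z2 * (Y + constS (\<omega> ^ 2) * X)"
      have Q2'': "conic X (constS \<omega> * Y) Z \<gamma>' = constS (\<omega> ^ 2) * Q'"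
        unfolding Q2' 3 Q'_def constS_hom using W by algebra
      have inv: "constS \<omega> * constS (\<omega> ^ 2) = 1" using W unfolding constS_hom by algebra
      have swap: "F = Y ^ 3 + X ^ 3 + constS (1 / 4) * Z2 ^ 3" "conic X Y Z \<gamma> = (Y - X) ^ 2 - Z2 ^ 2 - Z2 * (Y + X)"
        using F2 Q2 by (simp_all add: power2_commute add_ac)
      have f: "F * conic X Y Z \<gamma> * conic X (constS \<omega> * Y) Z \<gamma>' = constS (\<omega> ^ 2) * (F * conic X Y Z \<gamma> * Q')"
        unfolding Q2'' by (simp add: mult_ac)
      have cop': "coprime_gradient (F * conic X Y Z \<gamma> * Q')"
        unfolding coprime_gradient_def
      proof (intro allI impI notI)
        fix g assume g: "prime_elem g" "\<forall>r. g dvd D r (F * conic X Y Z \<gamma> * Q')"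
        then have "\<forall>r. g dvd D r (F * conic X Y Z \<gamma> * conic X (constS \<omega> * Y) Z \<gamma>')"
          unfolding f by (simp add: D_mult)
        with cop w1 g(1) show False unfolding coprime_gradient_def by blast
      qed
      have w2: "(\<omega> ^ 2) ^ 2 + \<omega> ^ 2 + 1 = 0" using w by algebra
      have "m_syzygy (F * conic X Y Z \<gamma> * Q') 3 [3, 4, 4]"
        by (rule coords_nearly_free_same_1[OF coords_swap[OF co2] w2 swap(1) swap(2) Q'_def cop'])
      then show ?thesis unfolding f using m_syzygy_scale[of "\<omega> ^ 2"] nz by simp
    qed
  qed
qed

lemma next_type:
  assumes co: "coords X Y Z" and F: "F = X ^ 3 + Y ^ 3 + Z ^ 3" and \<gamma>: "\<gamma> ^ 3 = -2" "\<delta> ^ 3 = -2"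
  shows "m_syzygy (F * conic X Y Z \<gamma> * conic Y Z X \<delta>) 3 [3, 4, 4]"
proof -
  have frames: "frame X Y Z" "frame Y Z X"
    using coords_frame[OF co] coords_frame[OF coords_rotate[OF co]] by auto
  have F': "F = Y ^ 3 + Z ^ 3 + X ^ 3" by (simp add: F add_ac)
  have cop: "coprime_gradient (F * conic X Y Z \<gamma> * conic Y Z X \<delta>)"
  proof (rule coprime_gradient_conics[OF frames \<gamma> F F'])
    show "2 * X - constS \<delta> * (Y + Z) = constS 2 * X + constS (- \<delta>) * Y + constS (- \<delta>) * Z"
      by (simp add: constS_hom algebra_simps)
    show "2 \<noteq> - \<gamma> * \<zeta> \<or> - \<delta> \<noteq> - \<gamma> * \<zeta> \<or> - \<delta> \<noteq> 2 * \<zeta>" if "\<zeta> ^ 3 = 1" for \<zeta>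
    proof -
      have "2 \<noteq> - \<gamma> * \<zeta>"
      proof
        assume "2 = - \<gamma> * \<zeta>"
        then have "(8 :: complex) = 2" using that \<gamma>(1) by algebra
        then show False by simp
      qed
      then show ?thesis by blast
    qed
  qed
  show ?thesis
    by (rule coords_nearly_free_next[OF co \<gamma> F refl refl cop])
qed

text \<open>Replacing \<open>Y\<close> by \<open>\<beta>^2 Y\<close> normalises the first conic; the
  second one then carries the ratio \<open>\<beta>'^2 \<beta>\<close>.\<close>

lemma same_type_pair:
  assumes co: "coords X Y Z" and F: "F = X ^ 3 + Y ^ 3 + Z ^ 3"
    and \<beta>: "\<beta> ^ 3 = 1" "\<beta>' ^ 3 = 1" and \<gamma>: "\<gamma> ^ 3 = -2" "\<gamma>' ^ 3 = -2"
  shows "\<beta> = \<beta>' \<Longrightarrow> \<gamma> \<noteq> \<gamma>' \<Longrightarrow> m_syzygy (F * conic X (constS (\<beta> ^ 2) * Y) Z \<gamma> * conic X (constS (\<beta>' ^ 2) * Y) Z \<gamma>') 2 [3, 3]"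
    and "\<beta> \<noteq> \<beta>' \<Longrightarrow> m_syzygy (F * conic X (constS (\<beta> ^ 2) * Y) Z \<gamma> * conic X (constS (\<beta>' ^ 2) * Y) Z \<gamma>') 3 [3, 4, 4]"
proof -
  have nz: "\<beta> \<noteq> 0" using \<beta> by auto
  have B: "constS \<beta> ^ 3 = 1" using \<beta> by (simp flip: constS_hom)
  have co': "coords X (constS (\<beta> ^ 2) * Y) Z"
    using coords_scale[OF co, of 1 "\<beta> ^ 2" 1] nz by (simp add: constS_hom)
  have F': "F = X ^ 3 + (constS (\<beta> ^ 2) * Y) ^ 3 + Z ^ 3"
    unfolding F constS_hom using B by algebra
  have w: "(\<beta>' ^ 2 * \<beta>) ^ 3 = 1" using \<beta> by algebra
  have Y': "constS (\<beta>' ^ 2) * Y = constS (\<beta>' ^ 2 * \<beta>) * (constS (\<beta> ^ 2) * Y)"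
    unfolding constS_hom using B by algebra
  have "\<beta>' ^ 2 * \<beta> = 1 \<longleftrightarrow> \<beta> = \<beta>'"
  proof
    assume "\<beta>' ^ 2 * \<beta> = 1"
    with \<beta> show "\<beta> = \<beta>'" by algebra
  next
    assume "\<beta> = \<beta>'"
    with \<beta> show "\<beta>' ^ 2 * \<beta> = 1" by algebra
  qed
  with same_type[OF co' F' w \<gamma>] show
    "\<beta> = \<beta>' \<Longrightarrow> \<gamma> \<noteq> \<gamma>' \<Longrightarrow> m_syzygy (F * conic X (constS (\<beta> ^ 2) * Y) Z \<gamma> * conic X (constS (\<beta>' ^ 2) * Y) Z \<gamma>') 2 [3, 3]"
    "\<beta> \<noteq> \<beta>' \<Longrightarrow> m_syzygy (F * conic X (constS (\<beta> ^ 2) * Y) Z \<gamma> * conic X (constS (\<beta>' ^ 2) * Y) Z \<gamma>') 3 [3, 4, 4]"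
    unfolding Y' by blast+
qed

lemma next_type_pair:
  assumes co: "coords X Y Z" and F: "F = X ^ 3 + Y ^ 3 + Z ^ 3"
    and \<beta>: "\<beta> ^ 3 = 1" "\<beta>' ^ 3 = 1" and \<gamma>: "\<gamma> ^ 3 = -2" "\<gamma>' ^ 3 = -2"
  shows "m_syzygy (F * conic X (constS (\<beta> ^ 2) * Y) Z \<gamma> * conic Y (constS (\<beta>' ^ 2) * Z) X \<gamma>') 3 [3, 4, 4]"
proof -
  have nz: "\<beta> \<noteq> 0" "\<beta>' \<noteq> 0" using \<beta> by auto
  have B: "constS \<beta> ^ 3 = 1" "constS \<beta>' ^ 3 = 1" using \<beta> by (simp_all flip: constS_hom)
  define Y1 where "Y1 = constS (\<beta> ^ 2) * Y"
  \<comment> \<open>\<open>Y1\<close> normalises the first conic; the second forces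
    \<open>Z1\<close>, since its first two arguments must be scaled by the same
    \<open>\<beta>^2\<close>. The cube roots of -2 absorb the remaining roots of unity.\<close>
  define Z1 where "Z1 = constS (\<beta>' ^ 2 * \<beta> ^ 2) * Z"
  have co': "coords X Y1 Z1"
    using coords_scale[OF co, of 1 "\<beta> ^ 2" "\<beta>' ^ 2 * \<beta> ^ 2"] nz unfolding Y1_def Z1_def by (simp add: constS_hom)
  have F': "F = X ^ 3 + Y1 ^ 3 + Z1 ^ 3"
    unfolding F Y1_def Z1_def constS_hom using B by algebra
  have g: "(\<gamma> * (\<beta>' * \<beta>) ^ 2) ^ 3 = -2" "(\<gamma>' * \<beta>) ^ 3 = -2" using \<beta> \<gamma> by algebra+
  have "conic X (constS (\<beta> ^ 2) * Y) Z \<gamma> = conic X Y1 Z1 (\<gamma> * (\<beta>' * \<beta>) ^ 2)"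
    unfolding conic_def Y1_def Z1_def constS_hom using B by algebra
  moreover have "conic Y (constS (\<beta>' ^ 2) * Z) X \<gamma>' = constS (\<beta> ^ 2) * conic Y1 Z1 X (\<gamma>' * \<beta>)"
    unfolding conic_def Y1_def Z1_def constS_hom using B by algebra
  ultimately have f: "F * conic X (constS (\<beta> ^ 2) * Y) Z \<gamma> * conic Y (constS (\<beta>' ^ 2) * Z) X \<gamma>'
    = constS (\<beta> ^ 2) * (F * conic X Y1 Z1 (\<gamma> * (\<beta>' * \<beta>) ^ 2) * conic Y1 Z1 X (\<gamma>' * \<beta>))"
    by (simp add: mult_ac)
  have "\<beta> ^ 2 \<noteq> 0" using nz by simp
  then show ?thesis
    unfolding f m_syzygy_scale[OF \<open>\<beta> ^ 2 \<noteq> 0\<close>] by (intro next_type[OF co' F' g])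
qed

lemma tconic_pair:
  assumes t: "t < 3" "t' < 3" and \<beta>: "\<beta> ^ 3 = 1" "\<beta>' ^ 3 = 1" and \<gamma>: "\<gamma> ^ 3 = -2" "\<gamma>' ^ 3 = -2"
  shows "t = t' \<Longrightarrow> \<beta> = \<beta>' \<Longrightarrow> \<gamma> \<noteq> \<gamma>' \<Longrightarrow> m_syzygy (fermat * tconic t \<beta> \<gamma> * tconic t' \<beta>' \<gamma>') 2 [3, 3]"
    and "\<not> (t = t' \<and> \<beta> = \<beta>') \<Longrightarrow> m_syzygy (fermat * tconic t \<beta> \<gamma> * tconic t' \<beta>' \<gamma>') 3 [3, 4, 4]"
proof -
  note c0 = coords_var and c1 = coords_rotate[OF coords_var] and c2 = coords_rotate[OF coords_rotate[OF coords_var]]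
  have F: "fermat = varX ^ 3 + varY ^ 3 + varZ ^ 3" "fermat = varY ^ 3 + varZ ^ 3 + varX ^ 3"
    "fermat = varZ ^ 3 + varX ^ 3 + varY ^ 3" by (simp_all add: fermat_def add_ac)
  have three: "s = 0 \<or> s = 1 \<or> s = 2" if "s < 3" for s :: nat using that by auto
  show "m_syzygy (fermat * tconic t \<beta> \<gamma> * tconic t' \<beta>' \<gamma>') 2 [3, 3]" if "t = t'" "\<beta> = \<beta>'" "\<gamma> \<noteq> \<gamma>'"
    using three[OF t(1)] same_type_pair(1)[OF c0 F(1) \<beta> \<gamma> that(2,3)] same_type_pair(1)[OF c1 F(2) \<beta> \<gamma> that(2,3)]
      same_type_pair(1)[OF c2 F(3) \<beta> \<gamma> that(2,3)] that(1) by (auto simp: tconic_def)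
  show "m_syzygy (fermat * tconic t \<beta> \<gamma> * tconic t' \<beta>' \<gamma>') 3 [3, 4, 4]" if neq: "\<not> (t = t' \<and> \<beta> = \<beta>')"
  proof (cases "t = t'")
    case True
    with neq have "\<beta> \<noteq> \<beta>'" by simp
    then show ?thesis
      using three[OF t(1)] same_type_pair(2)[OF c0 F(1) \<beta> \<gamma>] same_type_pair(2)[OF c1 F(2) \<beta> \<gamma>]
        same_type_pair(2)[OF c2 F(3) \<beta> \<gamma>] True by (auto simp: tconic_def)
  next
    case False
    note n = next_type_pair[OF c0 F(1) \<beta> \<gamma>] next_type_pair[OF c1 F(2) \<beta> \<gamma>] next_type_pair[OF c2 F(3) \<beta> \<gamma>]
    note n' = next_type_pair[OF c0 F(1) \<beta>(2,1) \<gamma>(2,1)] next_type_pair[OF c1 F(2) \<beta>(2,1) \<gamma>(2,1)]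
      next_type_pair[OF c2 F(3) \<beta>(2,1) \<gamma>(2,1)]
    show ?thesis
      using three[OF t(1)] three[OF t(2)] False
    proof (elim disjE)
      assume "t = 0" "t' = 1" then show ?thesis using n(1) by (simp add: tconic_def)
    next
      assume "t = 1" "t' = 2" then show ?thesis using n(2) by (simp add: tconic_def)
    next
      assume "t = 2" "t' = 0" then show ?thesis using n(3) by (simp add: tconic_def)
    next
      assume "t = 1" "t' = 0" then show ?thesis using n'(1) by (simp add: tconic_def mult_ac)
    next
      assume "t = 2" "t' = 1" then show ?thesis using n'(2) by (simp add: tconic_def mult_ac)
    next
      assume "t = 0" "t' = 2" then show ?thesis using n'(3) by (simp add: tconic_def mult_ac)
    qed simp_all
  qed
qed

text \<open>The number of generators is an invariant of \<open>f\<close>; this upgrades the two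
  implications of the classification to equivalences.\<close>

lemma m_syzygy_unique:
  assumes "m_syzygy f m ds" "m_syzygy f n es"
  shows "m = n"
  using assms unfolding m_syzygy_def by (meson le_antisym)

theorem mainTheorem10:
  fixes q q' :: S
  assumes "hyperosc_conic fermat q" and "hyperosc_conic fermat q'"
    and "\<forall>c. q' \<noteq> constS c * q"
  shows "((\<exists>j\<in>{1..9}. q \<in> Pset j \<and> q' \<in> Pset j) \<longleftrightarrow> free_exps (fermat * q * q') 3 3)
       \<and> ((\<not> (\<exists>j\<in>{1..9}. q \<in> Pset j \<and> q' \<in> Pset j)) \<longleftrightarrow> nearly_free_exps (fermat * q * q') 3 4)"
proof -
  let ?f = "fermat * q * q'"
  obtain k t \<beta> \<gamma> where q: "k \<noteq> 0" "t < 3" "\<beta> ^ 3 = 1" "\<gamma> ^ 3 = -2" "q = constS k * tconic t \<beta> \<gamma>"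
    using hyperosc_tconic[OF assms(1)] by metis
  obtain k' t' \<beta>' \<gamma>' where q': "k' \<noteq> 0" "t' < 3" "\<beta>' ^ 3 = 1" "\<gamma>' ^ 3 = -2" "q' = constS k' * tconic t' \<beta>' \<gamma>'"
    using hyperosc_tconic[OF assms(2)] by metis
  have P: "(\<exists>j\<in>{1..9}. q \<in> Pset j \<and> q' \<in> Pset j) \<longleftrightarrow> t = t' \<and> \<beta> = \<beta>'"
    by (rule common_Pset_iff[OF assms(1) q(5,1-4) assms(2) q'(5,1-4)])
  have f: "?f = constS (k * k') * (fermat * tconic t \<beta> \<gamma> * tconic t' \<beta>' \<gamma>')"
    unfolding q(5) q'(5) constS_hom by (simp add: mult_ac)
  have scale: "m_syzygy ?f = m_syzygy (fermat * tconic t \<beta> \<gamma> * tconic t' \<beta>' \<gamma>')"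
    unfolding f using q(1) q'(1) by (intro m_syzygy_scale) simp
  have free: "m_syzygy ?f 2 [3, 3]" if "t = t'" "\<beta> = \<beta>'"
  proof -
    \<comment> \<open>Agreement of all three parameters would make the two conics
      proportional.\<close>
    have "\<gamma> \<noteq> \<gamma>'"
    proof
      assume "\<gamma> = \<gamma>'"
      then have "q' = constS (k' / k) * q"
        using q q' that by (simp flip: constS_hom mult.assoc)
      with assms(3) show False by blast
    qed
    then show ?thesis unfolding scale using tconic_pair(1)[OF q(2) q'(2) q(3) q'(3) q(4) q'(4)] that by blast
  qed
  have nearly: "m_syzygy ?f 3 [3, 4, 4]" if "\<not> (t = t' \<and> \<beta> = \<beta>')"
    unfolding scale using tconic_pair(2)[OF q(2) q'(2) q(3) q'(3) q(4) q'(4) that] .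
  have "homog 7 ?f" and "?f \<noteq> 0"
  proof -
    have "homog 3 fermat"
      unfolding fermat_def using homog_power[of 1 _ 3] by (intro homog_add) (metis homog_gens(1-3) mult.right_neutral)+
    moreover have h: "homog 2 q" "homog 2 q'" "q \<noteq> 0" "q' \<noteq> 0"
      using assms unfolding hyperosc_conic_def by auto
    ultimately have "homog (3 + 2 + 2) ?f" by (intro homog_mult)
    then show "homog 7 ?f" by simp
    have "evalS fermat (1, 0, 0) = 1" by (simp add: fermat_def evalS_hom evalS_gens)
    then have "fermat \<noteq> 0" using evalS_hom(1)[of "(1, 0, 0)"] by auto
    then show "?f \<noteq> 0" using h by simp
  qed
  then have nf_iff: "nearly_free_exps ?f 3 4 \<longleftrightarrow> m_syzygy ?f 3 [3, 4, 4]"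
    unfolding nearly_free_exps_def by auto
  have exclusive: "\<not> (m_syzygy ?f 2 [3, 3] \<and> m_syzygy ?f 3 [3, 4, 4])"
    using m_syzygy_unique[of ?f 2 _ 3] by auto
  show ?thesis
    unfolding P nf_iff free_exps_def using free nearly exclusive by blast
qed

end
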